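(* Let $n\geq 2$ and let $Y=\widetilde{\bigvee}_{j\in\mathbb{N}}A_j$ be the shrinking wedge of a sequence $(A_j,a_j)$, $j\in\mathbb{N}$, of based spaces, with wedge point $b_0$. Then the canonical homomorphism \[\phi:\pi_n(Y,b_0)\to \prod_{j\in\mathbb{N}}\pi_n(A_j,a_j),\quad \phi([f])=([r_1\circ f],[r_2\circ f],[r_3\circ f],\dots )\] is a split epimorphism. Moreover, if $(A_j,a_j)$ is sequentially $(n-1)$-connected for all $j\in\mathbb{N}$, then $\phi$ is an isomorphism.
   Context: All spaces Hausdorff. The shrinking wedge $\widetilde{\bigvee}_j(A_j,a_j)$ is the one-point union $\bigvee_j A_j$ (all $a_j$ identified to $b_0$) with the topology in which $U$ is open iff $U\cap A_j$ is open in $A_j$ for all $j$ and, whenever $b_0\in U$, $A_j\subseteq U$ for all but finitely many $j$. $r_j:Y\to A_j$ collapses all $A_i$, $i\ne j$, to $a_j$. $\mathbb{H}_0=\{0\}\cup\{1/m\}$ based at $0$ and, for $k\ge1$, $\mathbb{H}_k$ is the shrinking wedge of countably many copies of $S^k$. $(A,a)$ is sequentially $m$-connected if the set of based homotopy classes $[(\mathbb{H}_k,b_0),(A,a)]$ is a singleton for each $0\le k\le m$. *)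

theory Defs
  imports "HOL-Analysis.Analysis" "HOL-Algebra.Product_Groups"
begin

text \<open>All spaces A j live in a common type 'a. The wedge carrier consists of the
wedge point None together with Some (j,x) for the non-base points x of A j.\<close>

definition wedge_carrier :: "(nat \<Rightarrow> 'a topology) \<Rightarrow> (nat \<Rightarrow> 'a) \<Rightarrow> (nat \<times> 'a) option set" where
  "wedge_carrier A a = insert None {Some (j, x) | j x. x \<in> topspace (A j) \<and> x \<noteq> a j}"

definition wedge_inj :: "(nat \<Rightarrow> 'a) \<Rightarrow> nat \<Rightarrow> 'a \<Rightarrow> (nat \<times> 'a) option" where
  "wedge_inj a j x = (if x = a j then None else Some (j, x))"

definition shrinking_wedge :: "(nat \<Rightarrow> 'a topology) \<Rightarrow> (nat \<Rightarrow> 'a) \<Rightarrow> (nat \<times> 'a) option topology" where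
  "shrinking_wedge A a = topology (\<lambda>U.
     U \<subseteq> wedge_carrier A a \<and>
     (\<forall>j. openin (A j) {x \<in> topspace (A j). wedge_inj a j x \<in> U}) \<and>
     (None \<in> U \<longrightarrow> finite {j. \<not> (wedge_inj a j ` topspace (A j) \<subseteq> U)}))"

definition wedge_retract :: "(nat \<Rightarrow> 'a) \<Rightarrow> nat \<Rightarrow> (nat \<times> 'a) option \<Rightarrow> 'a" where
  "wedge_retract a j y = (case y of None \<Rightarrow> a j | Some (i, x) \<Rightarrow> if i = j then x else a j)"

definition cube :: "nat \<Rightarrow> (nat \<Rightarrow> real) topology" where
  "cube n = subtopology (Euclidean_space n) {t. \<forall>i<n. 0 \<le> t i \<and> t i \<le> 1}"

definition cube_boundary :: "nat \<Rightarrow> (nat \<Rightarrow> real) set" where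
  "cube_boundary n = {t \<in> topspace (cube n). \<exists>i<n. t i = 0 \<or> t i = 1}"

definition relcube_maps :: "nat \<Rightarrow> 'a topology \<Rightarrow> 'a \<Rightarrow> ((nat \<Rightarrow> real) \<Rightarrow> 'a) set" where
  "relcube_maps n X x = {f. continuous_map (cube n) X f \<and> f ` cube_boundary n \<subseteq> {x}}"

definition homotopy_class :: "nat \<Rightarrow> 'a topology \<Rightarrow> 'a \<Rightarrow> ((nat \<Rightarrow> real) \<Rightarrow> 'a) \<Rightarrow> ((nat \<Rightarrow> real) \<Rightarrow> 'a) set" where
  "homotopy_class n X x f = {g. homotopic_with (\<lambda>h. h ` cube_boundary n \<subseteq> {x}) (cube n) X f g}"

definition concat_cube :: "((nat \<Rightarrow> real) \<Rightarrow> 'a) \<Rightarrow> ((nat \<Rightarrow> real) \<Rightarrow> 'a) \<Rightarrow> (nat \<Rightarrow> real) \<Rightarrow> 'a" where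
  "concat_cube f g = (\<lambda>t. if t 0 \<le> 1/2 then f (t(0 := 2 * t 0)) else g (t(0 := 2 * t 0 - 1)))"

definition homotopy_group :: "nat \<Rightarrow> 'a topology \<Rightarrow> 'a \<Rightarrow> ((nat \<Rightarrow> real) \<Rightarrow> 'a) set monoid" where
  "homotopy_group n X x =
    \<lparr>carrier = homotopy_class n X x ` relcube_maps n X x,
     mult = (\<lambda>c d. homotopy_class n X x (concat_cube (SOME f. f \<in> c) (SOME g. g \<in> d))),
     one = homotopy_class n X x (\<lambda>t. x)\<rparr>"

definition based_htpy_classes :: "'b topology \<Rightarrow> 'b \<Rightarrow> 'a topology \<Rightarrow> 'a \<Rightarrow> ('b \<Rightarrow> 'a) set set" where
  "based_htpy_classes X x0 Z z =
     (\<lambda>f. {g. homotopic_with (\<lambda>h. h x0 = z) X Z f g}) ` {f. continuous_map X Z f \<and> f x0 = z}"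

definition harmonic_space :: "real topology" where
  "harmonic_space = top_of_set (insert 0 {1 / real m | m. m \<ge> 1})"

definition sphere_base :: "nat \<Rightarrow> real" where
  "sphere_base = (\<lambda>i. if i = 0 then 1 else 0)"

definition earring_space :: "nat \<Rightarrow> (nat \<times> (nat \<Rightarrow> real)) option topology" where
  "earring_space k = shrinking_wedge (\<lambda>_. nsphere k) (\<lambda>_. sphere_base)"

definition seq_connected :: "nat \<Rightarrow> 'a topology \<Rightarrow> 'a \<Rightarrow> bool" where
  "seq_connected m Z z \<longleftrightarrow>
     is_singleton (based_htpy_classes harmonic_space 0 Z z) \<and>
     (\<forall>k. 1 \<le> k \<and> k \<le> m \<longrightarrow> is_singleton (based_htpy_classes (earring_space k) None Z z))"

definition canonical_phi :: "nat \<Rightarrow> (nat \<Rightarrow> 'a topology) \<Rightarrow> (nat \<Rightarrow> 'a) \<Rightarrow>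
    ((nat \<Rightarrow> real) \<Rightarrow> (nat \<times> 'a) option) set \<Rightarrow> nat \<Rightarrow> ((nat \<Rightarrow> real) \<Rightarrow> 'a) set" where
  "canonical_phi n A a c =
     (\<lambda>j\<in>UNIV. homotopy_class n (A j) (a j) (wedge_retract a j \<circ> (SOME f. f \<in> c)))"

end

theory Submission
  imports Defs
begin

text \<open>A map into the shrinking wedge \<open>Y\<close> is continuous iff all its retracts to the \<open>A j\<close> are, so
  \<open>Y\<close> is the subspace of the product in which at most one coordinate is not the base point. The
  section places representatives of the given classes side by side in the direction of coordinate 1;
  since the group operation uses coordinate 0, it is a homomorphism on the nose.

  For injectivity, let \<open>f\<close> represent an element of \<open>\<pi>\<^sub>n(Y)\<close>, and let \<open>U j\<close> be the open set where
  its \<open>j\<close>-th retract is not the base point. A Whitney decomposition of \<open>U j\<close> into dyadic boxes is a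
  locally finite cell complex whose cells shrink towards the complement, so sequential connectedness
  of \<open>A j\<close>, applied to all cells of one dimension at once, deforms \<open>f\<close> relative to the complement
  until the boundaries of all boxes go to the base point. Now \<open>f\<close> is an infinite concatenation of maps of
  boxes, each with values in a single \<open>A j\<close>. Commutativity of \<open>\<pi>\<^sub>n\<close>, applied infinitely often
  while splitting off the boxes in the order of their size, turns it into a
  concatenation along coordinate 0, and moving the \<open>k\<close>-th piece in the direction of
  coordinate 1 into the slab belonging to its \<open>A j\<close> gives the value of the section at the image of \<open>f\<close>.\<close>

subsection \<open>Cubes as subsets of the function space\<close>

text \<open>All infinite gluing rests on one principle: closed pieces, locally finite off a set sent
  to the base point, glue to a continuous map if all but finitely many of them map into any given
  neighbourhood of the base point. The cells of \<open>U j\<close> accumulate at the complement,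
  where null homotopies chosen cell by cell would be uncontrolled; sequential connectedness
  contracts a null sequence of spheres by a null sequence of homotopies. The prism over a d-cell has
  a d-sphere as boundary, so spheres of dimension below n serve all cells of dimension below n; over
  the n-cells the homotopy is merely extended. The search must be breadth first: a box contained in
  no \<open>U j\<close> may have to be refined forever, and refining its first half at once would
  leave the rest waiting forever. With a queue, all waiting boxes become uniformly small. Their
  boundaries go to the base point, so none of them lies inside the set where the map differs from
  it, which forces the images of small boxes close to the base point. Halving one coordinate at a
  time makes each split a single binary concatenation.\<close>

definition ucube :: "nat \<Rightarrow> (nat \<Rightarrow> real) set" where
  "ucube n = {t. (\<forall>i<n. 0 \<le> t i \<and> t i \<le> 1) \<and> (\<forall>i\<ge>n. t i = 0)}"

text \<open>As a subspace of the type class topology on functions, the cube admits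
  \<open>continuous_on\<close> and \<open>compact\<close> for all explicit formulas below.\<close>

lemma cube_eq: "cube n = top_of_set (ucube n)"
proof -
  have "{x. \<forall>i\<ge>n. x i = 0} \<inter> {t. \<forall>i<n. 0 \<le> t i \<and> t i \<le> 1} = ucube n"
    by (auto simp: ucube_def)
  then show ?thesis
    by (simp add: cube_def Euclidean_space_def euclidean_product_topology subtopology_subtopology)
qed

lemma topspace_cube [simp]: "topspace (cube n) = ucube n"
  by (simp add: cube_eq)

lemma cube_boundary_eq: "cube_boundary n = {t \<in> ucube n. \<exists>i<n. t i = 0 \<or> t i = 1}"
  by (simp add: cube_boundary_def)

lemma cube_boundary_subset: "cube_boundary n \<subseteq> ucube n"
  by (auto simp: cube_boundary_eq)

lemma compact_ucube: "compact (ucube n)"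
proof -
  have "ucube n = PiE UNIV (\<lambda>i. if i < n then {0..1} else {0})"
    by (auto simp: ucube_def PiE_iff split: if_splits)
  moreover have "compactin (product_topology (\<lambda>i::nat. euclideanreal) UNIV) (PiE UNIV (\<lambda>i. if i < n then {0..1} else {0}))"
    by (subst compactin_PiE) auto
  ultimately show ?thesis
    by (simp add: euclidean_product_topology)
qed

lemma continuous_on_fun_upd [continuous_intros]:
  fixes f :: "'b::topological_space \<Rightarrow> nat \<Rightarrow> real"
  assumes "continuous_on S f" "continuous_on S g"
  shows "continuous_on S (\<lambda>p. (f p)(i := g p))"
proof (rule continuous_on_coordinatewise_then_product)
  fix k show "continuous_on S (\<lambda>p. ((f p)(i := g p)) k)"
    using assms by (cases "k = i") (auto intro: continuous_on_product_then_coordinatewise)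
qed

lemma continuous_on_snd_apply [continuous_intros]:
  fixes S :: "('b::topological_space \<times> (nat \<Rightarrow> real)) set"
  shows "continuous_on S (\<lambda>p. snd p i)"
  by (rule continuous_on_product_then_coordinatewise[OF continuous_on_snd[OF continuous_on_id]])

lemma continuous_map_compose_on:
  assumes "continuous_map (top_of_set T) X f" "continuous_on S \<phi>" "\<And>p. p \<in> S \<Longrightarrow> \<phi> p \<in> T"
  shows "continuous_map (top_of_set S) X (\<lambda>p. f (\<phi> p))"
proof -
  have "continuous_map (top_of_set S) (top_of_set T) \<phi>"
    using assms by (auto simp: continuous_map_in_subtopology)
  from continuous_map_compose[OF this assms(1)] show ?thesis by (simp add: o_def)
qed

lemma continuous_map_cases_on:
  fixes p q :: "'b::topological_space \<Rightarrow> real"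
  assumes "continuous_on S p" "continuous_on S q"
    and "continuous_map (top_of_set {x\<in>S. p x \<le> q x}) X f"
    and "continuous_map (top_of_set {x\<in>S. q x \<le> p x}) X g"
    and "\<And>x. x \<in> S \<Longrightarrow> p x = q x \<Longrightarrow> f x = g x"
  shows "continuous_map (top_of_set S) X (\<lambda>x. if p x \<le> q x then f x else g x)"
proof (rule continuous_map_cases_le)
  have "S \<inter> {x \<in> S. p x \<le> q x} = {x \<in> S. p x \<le> q x}" "S \<inter> {x \<in> S. q x \<le> p x} = {x \<in> S. q x \<le> p x}" by auto
  then show "continuous_map (subtopology (top_of_set S) {x \<in> topspace (top_of_set S). p x \<le> q x}) X f"
    "continuous_map (subtopology (top_of_set S) {x \<in> topspace (top_of_set S). q x \<le> p x}) X g"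
    using assms by (simp_all add: subtopology_subtopology)
qed (use assms in auto)

lemma continuous_map_top_of_set_cong:
  assumes "continuous_map (top_of_set S) X f" "\<And>x. x \<in> S \<Longrightarrow> f x = g x"
  shows "continuous_map (top_of_set S) X g"
  using assms by (metis continuous_map_eq topspace_euclidean_subtopology)

lemma continuous_map_top_of_set_subset:
  assumes "continuous_map (top_of_set S) X f" "T \<subseteq> S"
  shows "continuous_map (top_of_set T) X f"
  using continuous_map_from_subtopology_mono[OF assms] .

definition cube_htp :: "nat \<Rightarrow> 'a topology \<Rightarrow> 'a \<Rightarrow> ((nat \<Rightarrow> real) \<Rightarrow> 'a) \<Rightarrow> ((nat \<Rightarrow> real) \<Rightarrow> 'a) \<Rightarrow> bool" where
  "cube_htp n X x f g \<longleftrightarrow> homotopic_with (\<lambda>h. h ` cube_boundary n \<subseteq> {x}) (cube n) X f g"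

lemma cube_htp_sym: "cube_htp n X x f g \<Longrightarrow> cube_htp n X x g f"
  unfolding cube_htp_def by (rule homotopic_with_symD)

lemma cube_htp_trans: "cube_htp n X x f g \<Longrightarrow> cube_htp n X x g h \<Longrightarrow> cube_htp n X x f h"
  unfolding cube_htp_def by (rule homotopic_with_trans)

lemma cube_htp_iff:
  "cube_htp n X x f g \<longleftrightarrow> (\<exists>h. continuous_map (top_of_set ({0..1::real} \<times> ucube n)) X h \<and>
     (\<forall>t\<in>ucube n. h (0, t) = f t) \<and> (\<forall>t\<in>ucube n. h (1, t) = g t) \<and>
     (\<forall>s\<in>{0..1}. \<forall>t\<in>cube_boundary n. h (s, t) = x))"
proof -
  have *: "prod_topology (top_of_set {0..1::real}) (cube n) = top_of_set ({0..1::real} \<times> ucube n)"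
    by (simp add: cube_eq prod_topology_subtopology_eu)
  have "cube_htp n X x f g \<longleftrightarrow> (\<exists>h. continuous_map (prod_topology (top_of_set {0..1::real}) (cube n)) X h \<and>
     (\<forall>t\<in>topspace (cube n). h (0, t) = f t) \<and> (\<forall>t\<in>topspace (cube n). h (1, t) = g t) \<and>
     (\<forall>s\<in>{0..1}. (\<lambda>t. h (s,t)) ` cube_boundary n \<subseteq> {x}))"
    unfolding cube_htp_def
  proof (rule homotopic_with[where P="\<lambda>h. h ` cube_boundary n \<subseteq> {x}"])
    fix h k :: "(nat \<Rightarrow> real) \<Rightarrow> 'a"
    assume "\<And>x. x \<in> topspace (cube n) \<Longrightarrow> h x = k x"
    then have "h ` cube_boundary n = k ` cube_boundary n"
      using cube_boundary_subset by (intro image_cong) auto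
    then show "(h ` cube_boundary n \<subseteq> {x}) = (k ` cube_boundary n \<subseteq> {x})" by simp
  qed
  then show ?thesis unfolding * by (auto simp: image_subset_iff)
qed

lemma cube_htpI:
  assumes "continuous_map (top_of_set ({0..1::real} \<times> ucube n)) X h"
    and "\<And>t. t \<in> ucube n \<Longrightarrow> h (0, t) = f t" "\<And>t. t \<in> ucube n \<Longrightarrow> h (1, t) = g t"
    and "\<And>s t. 0 \<le> s \<Longrightarrow> s \<le> 1 \<Longrightarrow> t \<in> cube_boundary n \<Longrightarrow> h (s, t) = x"
  shows "cube_htp n X x f g"
  unfolding cube_htp_iff using assms by (intro exI[of _ h]) auto

lemma relcube_maps_iff:
  "f \<in> relcube_maps n X x \<longleftrightarrow> continuous_map (top_of_set (ucube n)) X f \<and> (\<forall>t\<in>cube_boundary n. f t = x)"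
  by (auto simp: relcube_maps_def cube_eq)

lemma cube_htp_refl: "f \<in> relcube_maps n X x \<Longrightarrow> cube_htp n X x f f"
  by (simp add: relcube_maps_def cube_htp_def)

lemma cube_htp_imp_relcube:
  assumes "cube_htp n X x f g" shows "f \<in> relcube_maps n X x" "g \<in> relcube_maps n X x"
  using homotopic_with_imp_continuous_maps[OF assms[unfolded cube_htp_def]]
    homotopic_with_imp_property[OF assms[unfolded cube_htp_def]]
  by (auto simp: relcube_maps_def)

lemma cube_htp_cong:
  assumes "f \<in> relcube_maps n X x" "\<And>t. t \<in> ucube n \<Longrightarrow> f t = g t"
  shows "cube_htp n X x f g"
proof (rule cube_htpI[where h="\<lambda>(s,t). f t"])
  show "continuous_map (top_of_set ({0..1::real} \<times> ucube n)) X (\<lambda>(s, t). f t)"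
    using assms(1) unfolding relcube_maps_iff split_def
    by (intro continuous_map_compose_on[where T="ucube n" and f=f and \<phi>=snd])
       (auto intro: continuous_on_snd continuous_on_id)
qed (use assms in \<open>auto simp: relcube_maps_iff\<close>)

lemma const_relcube: "x \<in> topspace X \<Longrightarrow> (\<lambda>t. x) \<in> relcube_maps n X x"
  by (auto simp: relcube_maps_iff)

lemma homotopy_class_eq: "homotopy_class n X x f = {g. cube_htp n X x f g}"
  by (simp add: homotopy_class_def cube_htp_def)

lemma homotopy_class_eq_iff:
  assumes "f \<in> relcube_maps n X x"
  shows "homotopy_class n X x f = homotopy_class n X x g \<longleftrightarrow> cube_htp n X x f g"
proof
  assume "homotopy_class n X x f = homotopy_class n X x g"
  then have "f \<in> homotopy_class n X x g"
    using cube_htp_refl[OF assms] by (auto simp: homotopy_class_eq)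
  then show "cube_htp n X x f g" by (simp add: homotopy_class_eq cube_htp_sym)
next
  assume "cube_htp n X x f g"
  then show "homotopy_class n X x f = homotopy_class n X x g"
    unfolding homotopy_class_eq by (auto intro: cube_htp_trans cube_htp_sym)
qed

text \<open>The group operation and \<open>canonical_phi\<close> choose representatives by
  \<open>SOME\<close>; this is what makes their values independent of the choice.\<close>

lemma some_in_homotopy_class:
  assumes "f \<in> relcube_maps n X x"
  shows "cube_htp n X x f (SOME g. g \<in> homotopy_class n X x f)"
proof -
  have "f \<in> homotopy_class n X x f" using cube_htp_refl[OF assms] by (simp add: homotopy_class_eq)
  then have "(SOME g. g \<in> homotopy_class n X x f) \<in> homotopy_class n X x f" by (rule someI[where P="\<lambda>g. g \<in> homotopy_class n X x f"])
  then show ?thesis by (simp add: homotopy_class_eq)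
qed

lemma cube_htp_compose:
  assumes "cube_htp n X x f g" "continuous_map X Y h" "h x = y"
  shows "cube_htp n Y y (h \<circ> f) (h \<circ> g)"
  unfolding cube_htp_def
proof (rule homotopic_with_compose_continuous_map_left[OF assms(1)[unfolded cube_htp_def] assms(2)])
  show "(h \<circ> j) ` cube_boundary n \<subseteq> {y}" if "j ` cube_boundary n \<subseteq> {x}" for j
    using that assms(3) by auto
qed

subsection \<open>Concatenation in the direction of a coordinate\<close>

text \<open>The group law uses coordinate 0, but the Eckmann-Hilton argument needs a second
  direction, and dyadic boxes are cut in all directions in turn.\<close>

definition concat_at :: "nat \<Rightarrow> ((nat \<Rightarrow> real) \<Rightarrow> 'a) \<Rightarrow> ((nat \<Rightarrow> real) \<Rightarrow> 'a) \<Rightarrow> (nat \<Rightarrow> real) \<Rightarrow> 'a" where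
  "concat_at i f g = (\<lambda>t. if t i \<le> 1/2 then f (t(i := 2 * t i)) else g (t(i := 2 * t i - 1)))"

lemma concat_cube_eq: "concat_cube = concat_at 0"
  by (simp add: concat_cube_def concat_at_def fun_eq_iff)

lemma ucube_upd: "t \<in> ucube n \<Longrightarrow> i < n \<Longrightarrow> 0 \<le> u \<Longrightarrow> u \<le> 1 \<Longrightarrow> t(i := u) \<in> ucube n"
  by (auto simp: ucube_def)

lemma cube_boundary_upd:
  "t \<in> ucube n \<Longrightarrow> i < n \<Longrightarrow> u = 0 \<or> u = 1 \<Longrightarrow> t(i := u) \<in> cube_boundary n"
  by (auto simp: cube_boundary_eq ucube_def)

lemma cube_boundary_upd_other:
  "t \<in> cube_boundary n \<Longrightarrow> i < n \<Longrightarrow> 0 \<le> u \<Longrightarrow> u \<le> 1 \<Longrightarrow> t i \<noteq> 0 \<Longrightarrow> t i \<noteq> 1 \<Longrightarrow> t(i := u) \<in> cube_boundary n"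
  unfolding cube_boundary_eq by (auto simp: ucube_upd)

lemma cube_boundary_upd_fix:
  assumes "t \<in> cube_boundary n" "i < n" "0 \<le> u" "u \<le> 1" "t i = 0 \<Longrightarrow> u = 0 \<or> u = 1" "t i = 1 \<Longrightarrow> u = 0 \<or> u = 1"
  shows "t(i := u) \<in> cube_boundary n"
  using assms cube_boundary_upd_other cube_boundary_upd cube_boundary_subset by blast

lemma ucube_coord: "t \<in> ucube n \<Longrightarrow> 0 \<le> t i \<and> t i \<le> 1"
  by (cases "i < n") (auto simp: ucube_def)

lemma concat_at_htp:
  assumes "cube_htp n X x f f'" "cube_htp n X x g g'" "i < n"
  shows "cube_htp n X x (concat_at i f g) (concat_at i f' g')"
proof -
  obtain h where h: "continuous_map (top_of_set ({0..1::real} \<times> ucube n)) X h"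
     "\<And>t. t\<in>ucube n \<Longrightarrow> h (0, t) = f t" "\<And>t. t\<in>ucube n \<Longrightarrow> h (1, t) = f' t"
     "\<And>s t. s\<in>{0..1} \<Longrightarrow> t\<in>cube_boundary n \<Longrightarrow> h (s, t) = x"
    using assms(1) unfolding cube_htp_iff by blast
  obtain k where k: "continuous_map (top_of_set ({0..1::real} \<times> ucube n)) X k"
     "\<And>t. t\<in>ucube n \<Longrightarrow> k (0, t) = g t" "\<And>t. t\<in>ucube n \<Longrightarrow> k (1, t) = g' t"
     "\<And>s t. s\<in>{0..1} \<Longrightarrow> t\<in>cube_boundary n \<Longrightarrow> k (s, t) = x"
    using assms(2) unfolding cube_htp_iff by blast
  note upd = ucube_upd[OF _ \<open>i < n\<close>]
  have bd: "t(i := 2 * t i) \<in> cube_boundary n" if "t \<in> cube_boundary n" "t i \<le> 1/2" for t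
    using that assms(3) cube_boundary_subset[of n] ucube_coord[of t n i]
    by (intro cube_boundary_upd_fix) auto
  have bd': "t(i := 2 * t i - 1) \<in> cube_boundary n" if "t \<in> cube_boundary n" "\<not> t i \<le> 1/2" for t
    using that assms(3) cube_boundary_subset[of n] ucube_coord[of t n i]
    by (intro cube_boundary_upd_fix) auto
  show ?thesis
  proof (rule cube_htpI[where h="\<lambda>p. if snd p i \<le> 1/2 then h (fst p, (snd p)(i := 2 * snd p i)) else k (fst p, (snd p)(i := 2 * snd p i - 1))"])
    show "continuous_map (top_of_set ({0..1::real} \<times> ucube n)) X
     (\<lambda>p. if snd p i \<le> 1/2 then h (fst p, (snd p)(i := 2 * snd p i)) else k (fst p, (snd p)(i := 2 * snd p i - 1)))"
      using assms(3)
      by (intro continuous_map_cases_on continuous_map_compose_on[OF h(1)] continuous_map_compose_on[OF k(1)] continuous_intros)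
         (auto intro!: upd simp: h(4) k(4) cube_boundary_upd dest: ucube_coord[where i=i])
  qed (use h k bd bd' in \<open>auto simp: concat_at_def intro!: h(2,3) k(2,3) upd dest: ucube_coord[where i=i]\<close>)
qed

lemma concat_at_relcube:
  assumes "f \<in> relcube_maps n X x" "g \<in> relcube_maps n X x" "i < n"
  shows "concat_at i f g \<in> relcube_maps n X x"
  by (rule cube_htp_imp_relcube(1)[OF concat_at_htp[OF assms(1,2)[THEN cube_htp_refl] assms(3)]])

text \<open>The straight line from the identity to \<open>c\<close> consists of reparametrisations
  that fix both ends of the interval, so the boundary condition survives.\<close>

lemma cube_htp_reparam:
  assumes f: "f \<in> relcube_maps n X x" and i: "i < n" and c: "continuous_on {0..1} c"
    and "c ` {0..1} \<subseteq> {0..1}" "c 0 = 0" "c 1 = 1"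
  shows "cube_htp n X x f (\<lambda>t. f (t(i := c (t i))))"
proof -
  let ?u = "\<lambda>s t. (1 - s) * t i + s * c (t i)"
  have c01: "0 \<le> c (t i)" "c (t i) \<le> 1" if "t \<in> ucube n" for t
    using assms(4) ucube_coord[OF that, of i] by (auto simp: image_subset_iff)
  have u01: "0 \<le> ?u s t \<and> ?u s t \<le> 1" if "t \<in> ucube n" "0 \<le> s" "s \<le> 1" for s t
    using c01[OF that(1)] ucube_coord[OF that(1), of i] that
    by (intro conjI convex_bound_le[of "t i" 1 "c (t i)" "1-s" s, simplified]) auto
  note fc = f[unfolded relcube_maps_iff]
  show ?thesis
  proof (rule cube_htpI[where h="\<lambda>p. f ((snd p)(i := ?u (fst p) (snd p)))"])
    have "continuous_on ({0..1} \<times> ucube n) (\<lambda>p. c (snd p i))"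
      by (intro continuous_on_compose2[OF c] continuous_intros) (auto dest: ucube_coord)
    then show "continuous_map (top_of_set ({0..1::real} \<times> ucube n)) X (\<lambda>p. f ((snd p)(i := ?u (fst p) (snd p))))"
      using u01 i
      by (intro continuous_map_compose_on[OF conjunct1[OF fc]] continuous_intros) (auto intro!: ucube_upd)
  next
    fix s::real and t assume s: "0 \<le> s" "s \<le> 1" and t: "t \<in> cube_boundary n"
    then have "t(i := ?u s t) \<in> cube_boundary n"
      using u01[of t s] s cube_boundary_subset[of n] assms(5,6) i
      by (intro cube_boundary_upd_fix) auto
    then show "f ((snd (s, t))(i := ?u (fst (s, t)) (snd (s, t)))) = x"
      using fc by auto
  qed auto
qed

text \<open>The concatenation is the reparametrisation that runs through \<open>f\<close> at double
  speed and then rests at the end face.\<close>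

lemma concat_at_unit_right:
  assumes f: "f \<in> relcube_maps n X x" and i: "i < n"
  shows "cube_htp n X x (concat_at i f (\<lambda>t. x)) f"
proof -
  have "cube_htp n X x f (\<lambda>t. f (t(i := min 1 (2 * t i))))"
    using f i by (intro cube_htp_reparam[where c="\<lambda>u. min 1 (2 * u)"]) (auto intro!: continuous_intros)
  moreover have "f (t(i := min 1 (2 * t i))) = concat_at i f (\<lambda>t. x) t" if "t \<in> ucube n" for t
  proof -
    have "min 1 (2 * t i) = (if t i \<le> 1/2 then 2 * t i else 1)" by auto
    then show ?thesis
      using f cube_boundary_upd[OF that i, of 1] by (simp add: concat_at_def relcube_maps_iff)
  qed
  ultimately show ?thesis
    by (meson cube_htp_cong cube_htp_imp_relcube(2) cube_htp_sym cube_htp_trans)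
qed

lemma concat_at_unit_left:
  assumes f: "f \<in> relcube_maps n X x" and i: "i < n"
  shows "cube_htp n X x (concat_at i (\<lambda>t. x) f) f"
proof -
  have "cube_htp n X x f (\<lambda>t. f (t(i := max 0 (2 * t i - 1))))"
    using f i by (intro cube_htp_reparam[where c="\<lambda>u. max 0 (2 * u - 1)"]) (auto intro!: continuous_intros)
  moreover have "f (t(i := max 0 (2 * t i - 1))) = concat_at i (\<lambda>t. x) f t" if "t \<in> ucube n" for t
  proof -
    have "max 0 (2 * t i - 1) = (if t i \<le> 1/2 then 0 else 2 * t i - 1)" by auto
    then show ?thesis
      using f cube_boundary_upd[OF that i, of 0] by (simp add: concat_at_def relcube_maps_iff)
  qed
  ultimately show ?thesis
    by (meson cube_htp_cong cube_htp_imp_relcube(2) cube_htp_sym cube_htp_trans)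
qed

section \<open>The Eckmann-Hilton argument\<close>

lemma concat_at_interchange:
  "i \<noteq> j \<Longrightarrow> concat_at i (concat_at j f g) (concat_at j h k) = concat_at j (concat_at i f h) (concat_at i g k)"
  by (auto simp: concat_at_def fun_eq_iff fun_upd_twist)

text \<open>In a 2 x 2 array with \<open>f\<close> and \<open>g\<close> on one diagonal and
  constants on the other, the two orders of reading give the two sides.\<close>

lemma concat_at_indep:
  assumes f: "f \<in> relcube_maps n X x" and g: "g \<in> relcube_maps n X x" and ij: "i < n" "j < n" "i \<noteq> j"
  shows "cube_htp n X x (concat_at i f g) (concat_at j f g)"
proof -
  let ?e = "\<lambda>t::nat\<Rightarrow>real. x"
  have "cube_htp n X x (concat_at i (concat_at j f ?e) (concat_at j ?e g)) (concat_at i f g)"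
    by (intro concat_at_htp concat_at_unit_left concat_at_unit_right f g ij)
  moreover have "cube_htp n X x (concat_at j (concat_at i f ?e) (concat_at i ?e g)) (concat_at j f g)"
    by (intro concat_at_htp concat_at_unit_left concat_at_unit_right f g ij)
  ultimately show ?thesis
    unfolding concat_at_interchange[OF ij(3)] by (meson cube_htp_sym cube_htp_trans)
qed

text \<open>The same array with the constants on the other diagonal, which reverses the order in one
  of the two readings.\<close>

lemma concat_at_swap:
  assumes f: "f \<in> relcube_maps n X x" and g: "g \<in> relcube_maps n X x" and ij: "i < n" "j < n" "i \<noteq> j"
  shows "cube_htp n X x (concat_at i f g) (concat_at j g f)"
proof -
  let ?e = "\<lambda>t::nat\<Rightarrow>real. x"
  have "cube_htp n X x (concat_at i (concat_at j ?e f) (concat_at j g ?e)) (concat_at i f g)"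
    by (intro concat_at_htp concat_at_unit_left concat_at_unit_right f g ij)
  moreover have "cube_htp n X x (concat_at j (concat_at i ?e g) (concat_at i f ?e)) (concat_at j g f)"
    by (intro concat_at_htp concat_at_unit_left concat_at_unit_right f g ij)
  ultimately show ?thesis
    unfolding concat_at_interchange[OF ij(3)] by (meson cube_htp_sym cube_htp_trans)
qed

lemma ex_other_coordinate: "2 \<le> n \<Longrightarrow> \<exists>j<n. j \<noteq> (i::nat)"
  by (cases "i = 0") (auto intro: exI[of _ 1] exI[of _ 0])

lemma concat_at_commute:
  assumes "f \<in> relcube_maps n X x" "g \<in> relcube_maps n X x" "2 \<le> n" "i < n"
  shows "cube_htp n X x (concat_at i f g) (concat_at i g f)"
proof -
  obtain j where "j < n" "j \<noteq> i" using ex_other_coordinate assms by blast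
  then show ?thesis
    using concat_at_swap[of f n X x g i j] concat_at_indep[of g n X x f j i] assms
    by (metis cube_htp_trans)
qed

text \<open>Again an interchange, with entries \<open>f\<close>, \<open>g\<close>, constant,
  \<open>h\<close>: the second coordinate replaces the usual piecewise linear
  reparametrisation.\<close>

lemma concat_at_assoc:
  assumes f: "f \<in> relcube_maps n X x" and g: "g \<in> relcube_maps n X x" and h: "h \<in> relcube_maps n X x"
    and n: "2 \<le> n" and i: "i < n"
  shows "cube_htp n X x (concat_at i (concat_at i f g) h) (concat_at i f (concat_at i g h))"
proof -
  let ?e = "\<lambda>t::nat\<Rightarrow>real. x"
  obtain j where j: "j < n" "i \<noteq> j" using ex_other_coordinate[OF n] by metis
  have "cube_htp n X x (concat_at i (concat_at j f g) (concat_at j ?e h)) (concat_at i (concat_at i f g) h)"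
    using j i by (intro concat_at_htp concat_at_unit_left concat_at_indep f g h) auto
  moreover have "cube_htp n X x (concat_at j (concat_at i f ?e) (concat_at i g h)) (concat_at j f (concat_at i g h))"
    using j i by (intro concat_at_htp concat_at_unit_right cube_htp_refl concat_at_relcube f g h)
  moreover have "cube_htp n X x (concat_at j f (concat_at i g h)) (concat_at i f (concat_at i g h))"
    using j i by (intro concat_at_indep concat_at_relcube f g h) auto
  ultimately show ?thesis
    unfolding concat_at_interchange[OF j(2)] by (meson cube_htp_sym cube_htp_trans)
qed

subsection \<open>The shrinking wedge as a subspace of the product\<close>

lemma wedge_inj_in_carrier: "x \<in> topspace (A j) \<Longrightarrow> wedge_inj a j x \<in> wedge_carrier A a"
  by (auto simp: wedge_inj_def wedge_carrier_def)

lemma openin_shrinking_wedge: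
  "openin (shrinking_wedge A a) U \<longleftrightarrow>
     U \<subseteq> wedge_carrier A a \<and>
     (\<forall>j. openin (A j) {x \<in> topspace (A j). wedge_inj a j x \<in> U}) \<and>
     (None \<in> U \<longrightarrow> finite {j. \<not> (wedge_inj a j ` topspace (A j) \<subseteq> U)})"
proof -
  have "istopology (\<lambda>U. U \<subseteq> wedge_carrier A a \<and>
     (\<forall>j. openin (A j) {x \<in> topspace (A j). wedge_inj a j x \<in> U}) \<and>
     (None \<in> U \<longrightarrow> finite {j. \<not> (wedge_inj a j ` topspace (A j) \<subseteq> U)}))" (is "istopology ?L")
    unfolding istopology_def
  proof (intro conjI allI impI)
    fix S T assume S: "?L S" and T: "?L T"
    show "S \<inter> T \<subseteq> wedge_carrier A a" using S by auto
    show "openin (A j) {x \<in> topspace (A j). wedge_inj a j x \<in> S \<inter> T}" for j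
    proof -
      have "{x \<in> topspace (A j). wedge_inj a j x \<in> S \<inter> T} = {x \<in> topspace (A j). wedge_inj a j x \<in> S} \<inter> {x \<in> topspace (A j). wedge_inj a j x \<in> T}" by auto
      then show ?thesis using S T by (simp add: openin_Int)
    qed
    assume "None \<in> S \<inter> T"
    then have "finite ({j. \<not> (wedge_inj a j ` topspace (A j) \<subseteq> S)} \<union> {j. \<not> (wedge_inj a j ` topspace (A j) \<subseteq> T)})"
      using S T by auto
    then show "finite {j. \<not> (wedge_inj a j ` topspace (A j) \<subseteq> S \<inter> T)}"
      by (rule finite_subset[rotated]) auto
  next
    fix \<K> assume K: "\<forall>S\<in>\<K>. ?L S"
    show "\<Union>\<K> \<subseteq> wedge_carrier A a" using K by blast
    show "openin (A j) {x \<in> topspace (A j). wedge_inj a j x \<in> \<Union>\<K>}" for j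
    proof -
      have "{x \<in> topspace (A j). wedge_inj a j x \<in> \<Union>\<K>} = (\<Union>S\<in>\<K>. {x \<in> topspace (A j). wedge_inj a j x \<in> S})" by auto
      then show ?thesis using K by auto
    qed
    assume "None \<in> \<Union>\<K>"
    then obtain S where S: "S \<in> \<K>" "None \<in> S" by auto
    then have "finite {j. \<not> (wedge_inj a j ` topspace (A j) \<subseteq> S)}" using K by blast
    then show "finite {j. \<not> (wedge_inj a j ` topspace (A j) \<subseteq> \<Union>\<K>)}"
      by (rule finite_subset[rotated]) (use S in auto)
  qed
  then show ?thesis by (simp add: shrinking_wedge_def topology_inverse')
qed

lemma topspace_shrinking_wedge [simp]: "topspace (shrinking_wedge A a) = wedge_carrier A a"
proof -
  have *: "{x \<in> topspace (A j). wedge_inj a j x \<in> wedge_carrier A a} = topspace (A j)" for j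
    using wedge_inj_in_carrier by fastforce
  have "wedge_inj a j ` topspace (A j) \<subseteq> wedge_carrier A a" for j
    using wedge_inj_in_carrier by fastforce
  then have "openin (shrinking_wedge A a) (wedge_carrier A a)"
    by (simp add: openin_shrinking_wedge *)
  then show ?thesis
    by (metis openin_shrinking_wedge openin_subset openin_topspace subset_antisym)
qed

lemma None_in_wedge [simp]: "None \<in> wedge_carrier A a"
  by (simp add: wedge_carrier_def)

lemma wedge_retract_None [simp]: "wedge_retract a j None = a j"
  by (simp add: wedge_retract_def)

lemma wedge_retract_Some [simp]: "wedge_retract a j (Some (i, x)) = (if i = j then x else a j)"
  by (simp add: wedge_retract_def)

lemma wedge_retract_in: 
  assumes "\<And>j. a j \<in> topspace (A j)" "y \<in> wedge_carrier A a"
  shows "wedge_retract a j y \<in> topspace (A j)"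
  using assms by (auto simp: wedge_carrier_def)

text \<open>A neighbourhood \<open>U\<close> of the wedge point contains all but finitely many
  summands, so membership in \<open>U\<close> is a finite conjunction of conditions on the retracts.
  If \<open>U\<close> misses the wedge point, it is a disjunction, which may be infinite.\<close>

lemma continuous_map_into_wedge:
  assumes base: "\<And>j. a j \<in> topspace (A j)"
    and F: "\<And>t. t \<in> topspace Z \<Longrightarrow> F t \<in> wedge_carrier A a"
    and cont: "\<And>j. continuous_map Z (A j) (\<lambda>t. wedge_retract a j (F t))"
  shows "continuous_map Z (shrinking_wedge A a) F"
  unfolding continuous_map_def
proof (intro conjI allI impI)
  show "F \<in> topspace Z \<rightarrow> topspace (shrinking_wedge A a)" using F by auto
next
  fix U assume "openin (shrinking_wedge A a) U"
  then have U: "U \<subseteq> wedge_carrier A a" 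
    "\<And>j. openin (A j) {x \<in> topspace (A j). wedge_inj a j x \<in> U}"
    "None \<in> U \<Longrightarrow> finite {j. \<not> (wedge_inj a j ` topspace (A j) \<subseteq> U)}"
    by (auto simp: openin_shrinking_wedge)
  define V where "V j = {x \<in> topspace (A j). wedge_inj a j x \<in> U}" for j
  have pre: "openin Z {t \<in> topspace Z. wedge_retract a j (F t) \<in> V j}" for j
    using cont[of j] U(2)[of j] unfolding V_def continuous_map_def by auto
  show "openin Z {t \<in> topspace Z. F t \<in> U}"
  proof (cases "None \<in> U")
    case True
    let ?J = "{j. \<not> (wedge_inj a j ` topspace (A j) \<subseteq> U)}"
    have "(F t \<in> U) = (\<forall>j\<in>?J. wedge_retract a j (F t) \<in> V j)" if t: "t \<in> topspace Z" for t
    proof (cases "F t")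
      case None
      then show ?thesis using True base by (auto simp: V_def wedge_inj_def)
    next
      case (Some p)
      then obtain i x where ix: "F t = Some (i, x)" "x \<in> topspace (A i)" "x \<noteq> a i"
        using F[OF t] by (auto simp: wedge_carrier_def)
      have inj: "wedge_inj a i x = Some (i,x)" using ix by (simp add: wedge_inj_def)
      show ?thesis
      proof
        assume "F t \<in> U"
        then show "\<forall>j\<in>?J. wedge_retract a j (F t) \<in> V j"
          using ix inj True base by (auto simp: V_def wedge_inj_def)
      next
        assume *: "\<forall>j\<in>?J. wedge_retract a j (F t) \<in> V j"
        show "F t \<in> U"
        proof (cases "i \<in> ?J")
          case True
          then have "wedge_retract a i (F t) \<in> V i" using * by blast
          then show ?thesis using ix inj by (simp add: V_def)
        next
          case False
          then show ?thesis using ix inj by (auto simp: image_subset_iff)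
        qed
      qed
    qed
    then have "{t \<in> topspace Z. F t \<in> U} = (\<Inter>j\<in>?J. {t \<in> topspace Z. wedge_retract a j (F t) \<in> V j}) \<inter> topspace Z"
      by auto
    moreover have "openin Z ((\<Inter>j\<in>?J. {t \<in> topspace Z. wedge_retract a j (F t) \<in> V j}) \<inter> topspace Z)"
    proof (cases "?J = {}")
      case False
      then show ?thesis using U(3)[OF True] pre by (intro openin_Int openin_INT2) auto
    qed simp
    ultimately show ?thesis by simp
  next
    case False
    have "(F t \<in> U) = (\<exists>j. wedge_retract a j (F t) \<in> V j)" if t: "t \<in> topspace Z" for t
    proof (cases "F t")
      case None
      then show ?thesis using False by (auto simp: V_def wedge_inj_def)
    next
      case (Some p)
      then obtain i x where ix: "F t = Some (i, x)" "x \<in> topspace (A i)" "x \<noteq> a i"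
        using F[OF t] by (auto simp: wedge_carrier_def)
      then show ?thesis using False by (auto simp: V_def wedge_inj_def split: if_splits)
    qed
    then have "{t \<in> topspace Z. F t \<in> U} = (\<Union>j. {t \<in> topspace Z. wedge_retract a j (F t) \<in> V j})"
      by auto
    then show ?thesis using pre by auto
  qed
qed

lemma continuous_map_wedge_retract:
  assumes base: "\<And>j. a j \<in> topspace (A j)"
  shows "continuous_map (shrinking_wedge A a) (A j) (wedge_retract a j)"
  unfolding continuous_map_def
proof (intro conjI allI impI)
  show "wedge_retract a j \<in> topspace (shrinking_wedge A a) \<rightarrow> topspace (A j)"
    using wedge_retract_in[where A=A, OF base] by auto
  fix V assume V: "openin (A j) V"
  let ?U = "{y \<in> wedge_carrier A a. wedge_retract a j y \<in> V}"
  have "openin (A i) {x \<in> topspace (A i). wedge_inj a i x \<in> ?U}" for i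
  proof (cases "i = j")
    case True
    then have "{x \<in> topspace (A i). wedge_inj a i x \<in> ?U} = V"
      using openin_subset[OF V] by (auto simp: wedge_inj_def wedge_carrier_def split: if_splits)
    then show ?thesis using V True by simp
  next
    case False
    then have "{x \<in> topspace (A i). wedge_inj a i x \<in> ?U} = (if a j \<in> V then topspace (A i) else {})"
      by (auto simp: wedge_inj_def wedge_carrier_def split: if_splits)
    then show ?thesis by simp
  qed
  moreover have "finite {i. \<not> wedge_inj a i ` topspace (A i) \<subseteq> ?U}" if "None \<in> ?U"
  proof -
    have "{i. \<not> wedge_inj a i ` topspace (A i) \<subseteq> ?U} \<subseteq> {j}"
      using that by (auto simp: wedge_inj_def wedge_carrier_def split: if_splits)
    then show ?thesis using finite_subset by blast
  qed
  ultimately have "openin (shrinking_wedge A a) ?U"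
    unfolding openin_shrinking_wedge by auto
  then show "openin (shrinking_wedge A a) {x \<in> topspace (shrinking_wedge A a). wedge_retract a j x \<in> V}"
    by simp
qed

text \<open>Inverse of the map that sends a point of the wedge to the family of its retracts. It is
  meaningful when at most one coordinate \<open>u j\<close> differs from \<open>a j\<close>; for
  other families the choice is arbitrary.\<close>

definition wedge_point :: "(nat \<Rightarrow> 'a) \<Rightarrow> (nat \<Rightarrow> 'a) \<Rightarrow> (nat \<times> 'a) option" where
  "wedge_point a u = (if \<exists>j. u j \<noteq> a j then (let j = SOME j. u j \<noteq> a j in Some (j, u j)) else None)"

lemma wedge_point_cases:
  assumes "\<And>i j. u i \<noteq> a i \<Longrightarrow> u j \<noteq> a j \<Longrightarrow> i = j"
  obtains "wedge_point a u = None" "\<And>j. u j = a j"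
    | i where "wedge_point a u = Some (i, u i)" "u i \<noteq> a i" "\<And>j. j \<noteq> i \<Longrightarrow> u j = a j"
proof (cases "\<exists>j. u j \<noteq> a j")
  case True
  define i where "i = (SOME j. u j \<noteq> a j)"
  have i: "u i \<noteq> a i" using True unfolding i_def by (rule someI_ex)
  have "wedge_point a u = Some (i, u i)" using True by (simp add: wedge_point_def i_def Let_def)
  then show thesis using that(2) i assms by blast
next
  case False
  then show thesis using that(1) by (auto simp: wedge_point_def)
qed

lemma wedge_retract_point:
  assumes "\<And>i j. u i \<noteq> a i \<Longrightarrow> u j \<noteq> a j \<Longrightarrow> i = j"
  shows "wedge_retract a j (wedge_point a u) = u j"
proof (rule wedge_point_cases[OF assms])
  assume "wedge_point a u = None" "\<And>j. u j = a j"
  then show ?thesis by (metis wedge_retract_None)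
qed auto

lemma wedge_point_in:
  assumes "\<And>i j. u i \<noteq> a i \<Longrightarrow> u j \<noteq> a j \<Longrightarrow> i = j" "\<And>j. u j \<in> topspace (A j)"
  shows "wedge_point a u \<in> wedge_carrier A a"
  using assms(1) by (rule wedge_point_cases) (auto simp: wedge_carrier_def assms(2))

lemma wedge_eqI:
  assumes "y \<in> wedge_carrier A a" "z \<in> wedge_carrier A a" "\<And>j. wedge_retract a j y = wedge_retract a j z"
  shows "y = z"
  using assms(1,2) assms(3)[of "case y of Some (i, x) \<Rightarrow> i"] assms(3)[of "case z of Some (i, x) \<Rightarrow> i"]
  by (auto simp: wedge_carrier_def split: if_splits)

lemma wedge_retract_inj_on:
  assumes "y \<in> wedge_carrier A a" "wedge_retract a i y \<noteq> a i" "wedge_retract a j y \<noteq> a j"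
  shows "i = j"
  using assms by (auto simp: wedge_carrier_def split: if_splits)

text \<open>All maps and homotopies into the wedge are built this way, coordinate by coordinate, so
  that nothing has to be checked separately at the wedge point.\<close>

lemma continuous_map_wedge_point:
  assumes base: "\<And>j. a j \<in> topspace (A j)"
    and one: "\<And>t i j. t \<in> topspace Z \<Longrightarrow> u t i \<noteq> a i \<Longrightarrow> u t j \<noteq> a j \<Longrightarrow> i = j"
    and cont: "\<And>j. continuous_map Z (A j) (\<lambda>t. u t j)"
  shows "continuous_map Z (shrinking_wedge A a) (\<lambda>t. wedge_point a (u t))"
proof (rule continuous_map_into_wedge[OF base])
  fix t assume t: "t \<in> topspace Z"
  show "wedge_point a (u t) \<in> wedge_carrier A a"
    using one[OF t] continuous_map_image_subset_topspace[OF cont] t by (intro wedge_point_in) blast+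
next
  fix j
  show "continuous_map Z (A j) (\<lambda>t. wedge_retract a j (wedge_point a (u t)))"
    by (rule continuous_map_eq[OF cont[of j]]) (metis one wedge_retract_point)
qed

subsection \<open>The canonical homomorphism and its section\<close>

text \<open>Stretches the slab from 1 - 1/2^j to 1 - 1/2^(j+1) onto the unit interval; the factor is
  the inverse of its length. Outside the slab the value is clamped to an end, where a relative cube
  map takes the base point value, so in \<open>inf_concat\<close> at most one coordinate is
  nontrivial.\<close>

definition slab_clamp :: "nat \<Rightarrow> real \<Rightarrow> real" where
  "slab_clamp j x = min 1 (max 0 (2 ^ (j + 1) * (x - (1 - 1 / 2 ^ j))))"

definition inf_concat :: "(nat \<Rightarrow> 'a) \<Rightarrow> (nat \<Rightarrow> (nat \<Rightarrow> real) \<Rightarrow> 'a) \<Rightarrow> (nat \<Rightarrow> real) \<Rightarrow> (nat \<times> 'a) option" where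
  "inf_concat a f = (\<lambda>t. wedge_point a (\<lambda>j. f j (t(1 := slab_clamp j (t 1)))))"

lemma slab_clamp_bounds: "0 \<le> slab_clamp j x" "slab_clamp j x \<le> 1"
  by (auto simp: slab_clamp_def)

lemma slab_clamp_0 [simp]: "slab_clamp j 0 = 0"
proof -
  have "2 ^ (j + 1) * (0 - (1 - 1 / 2 ^ j)) \<le> (0::real)"
    by (rule mult_nonneg_nonpos) auto
  then show ?thesis by (simp add: slab_clamp_def)
qed

lemma slab_clamp_1 [simp]: "slab_clamp j 1 = 1"
  by (simp add: slab_clamp_def)

lemma continuous_on_slab_clamp: "continuous_on S (slab_clamp j)"
  unfolding slab_clamp_def by (intro continuous_intros)

lemma slab_clamp_interior:
  assumes "slab_clamp j x \<noteq> 0" "slab_clamp j x \<noteq> 1"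
  shows "1 - 1 / 2 ^ j < x \<and> x < 1 - 1 / 2 ^ Suc j"
proof -
  define z where "z = 2 ^ (j + 1) * (x - (1 - 1 / 2 ^ j))"
  have "0 < z" "z < 1"
    using assms unfolding slab_clamp_def z_def[symmetric] by (auto simp: min_def max_def split: if_splits)
  then have "0 < 2 ^ (j + 1) * (x - (1 - 1 / 2 ^ j))" "2 ^ (j + 1) * (x - (1 - 1 / 2 ^ j)) < 1"
    by (simp_all add: z_def)
  then have "0 < x - (1 - 1 / 2 ^ j)" "x - (1 - 1 / 2 ^ j) < 1 / 2 ^ (j + 1)"
    by (simp_all add: zero_less_mult_iff pos_less_divide_eq mult.commute)
  moreover have "1 - 1 / 2 ^ Suc j = 1 - 1 / 2 ^ j + 1 / (2::real) ^ (j+1)" by simp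
  ultimately show ?thesis by linarith
qed

lemma slab_clamp_unique:
  assumes "slab_clamp i x \<noteq> 0" "slab_clamp i x \<noteq> 1" "slab_clamp j x \<noteq> 0" "slab_clamp j x \<noteq> 1"
  shows "i = j"
proof -
  have *: False if "i < j" "slab_clamp i x \<noteq> 0" "slab_clamp i x \<noteq> 1" "slab_clamp j x \<noteq> 0" "slab_clamp j x \<noteq> 1" for i j
  proof -
    have "1 / (2::real) ^ j \<le> 1 / 2 ^ Suc i"
      using that(1) by (intro divide_left_mono power_increasing) auto
    then show False using slab_clamp_interior[OF that(2,3)] slab_clamp_interior[OF that(4,5)] by linarith
  qed
  show ?thesis using *[of i j] *[of j i] assms by (metis linorder_neqE_nat)
qed

lemma inf_concat_at_most_one:
  assumes f: "\<And>j. f j \<in> relcube_maps n (A j) (a j)" and "1 < n" "t \<in> ucube n"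
    and "f i (t(1 := slab_clamp i (t 1))) \<noteq> a i" "f j (t(1 := slab_clamp j (t 1))) \<noteq> a j"
  shows "i = j"
proof -
  have "slab_clamp k (t 1) \<noteq> 0 \<and> slab_clamp k (t 1) \<noteq> 1" if "f k (t(1 := slab_clamp k (t 1))) \<noteq> a k" for k
    using that f[of k] cube_boundary_upd[OF assms(3,2), of "slab_clamp k (t 1)"] by (auto simp: relcube_maps_iff)
  then show ?thesis using assms slab_clamp_unique by blast
qed

lemma slab_in_boundary:
  assumes "t \<in> cube_boundary n" "1 < n"
  shows "t(1 := slab_clamp j (t 1)) \<in> cube_boundary n"
  using assms by (intro cube_boundary_upd_fix) (auto simp: slab_clamp_bounds)

lemma slab_in_ucube:
  assumes "t \<in> ucube n" "1 < n"
  shows "t(1 := slab_clamp j (t 1)) \<in> ucube n"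
  using assms by (intro ucube_upd) (auto simp: slab_clamp_bounds)

lemma wedge_point_base: "(\<And>j. u j = a j) \<Longrightarrow> wedge_point a u = None"
  by (simp add: wedge_point_def)

text \<open>All homotopies run simultaneously, each in its own slab. No uniformity among them is
  needed, since continuity is tested in each \<open>A j\<close> separately; this permits replacing
  infinitely many representatives at once.\<close>

lemma inf_concat_htp:
  assumes base: "\<And>j. a j \<in> topspace (A j)" and n: "1 < n"
    and fg: "\<And>j. cube_htp n (A j) (a j) (f j) (g j)"
  shows "cube_htp n (shrinking_wedge A a) None (inf_concat a f) (inf_concat a g)"
proof -
  have "\<forall>j. \<exists>h. continuous_map (top_of_set ({0..1::real} \<times> ucube n)) (A j) h \<and>
     (\<forall>t\<in>ucube n. h (0, t) = f j t) \<and> (\<forall>t\<in>ucube n. h (1, t) = g j t) \<and>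
     (\<forall>s\<in>{0..1}. \<forall>t\<in>cube_boundary n. h (s, t) = a j)"
    using fg unfolding cube_htp_iff by blast
  then obtain h where h: "\<And>j. continuous_map (top_of_set ({0..1::real} \<times> ucube n)) (A j) (h j)"
     "\<And>j t. t\<in>ucube n \<Longrightarrow> h j (0, t) = f j t" "\<And>j t. t\<in>ucube n \<Longrightarrow> h j (1, t) = g j t"
     "\<And>j s t. s\<in>{0..1} \<Longrightarrow> t\<in>cube_boundary n \<Longrightarrow> h j (s, t) = a j"
    by metis
  let ?u = "\<lambda>p j. h j (fst p, (snd p)(1 := slab_clamp j (snd p 1)))"
  show ?thesis
  proof (rule cube_htpI[where h="\<lambda>p. wedge_point a (?u p)"])
    show "continuous_map (top_of_set ({0..1::real} \<times> ucube n)) (shrinking_wedge A a) (\<lambda>p. wedge_point a (?u p))"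
    proof (rule continuous_map_wedge_point[OF base])
      fix p i j
      assume p: "p \<in> topspace (top_of_set ({0..1::real} \<times> ucube n))" and "?u p i \<noteq> a i" "?u p j \<noteq> a j"
      have "slab_clamp k (snd p 1) \<noteq> 0 \<and> slab_clamp k (snd p 1) \<noteq> 1" if "?u p k \<noteq> a k" for k
        using that p h(4)[of "fst p" "(snd p)(1 := slab_clamp k (snd p 1))" k] cube_boundary_upd[of "snd p" n 1 "slab_clamp k (snd p 1)"] n by auto
      then show "i = j" using \<open>?u p i \<noteq> a i\<close> \<open>?u p j \<noteq> a j\<close> slab_clamp_unique by blast
    next
      fix j
      have "continuous_on ({0..1::real} \<times> ucube n) (\<lambda>p. slab_clamp j (snd p 1))"
        by (rule continuous_on_compose2[OF continuous_on_slab_clamp[of UNIV]]) (auto intro!: continuous_intros)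
      then show "continuous_map (top_of_set ({0..1::real} \<times> ucube n)) (A j) (\<lambda>p. ?u p j)"
        by (intro continuous_map_compose_on[OF h(1)] continuous_intros) (use slab_in_ucube n in auto)
    qed
  next
    show "wedge_point a (?u (s, t)) = None" if "0 \<le> s" "s \<le> 1" "t \<in> cube_boundary n" for s t
      using that h(4) slab_in_boundary[OF that(3) n] by (intro wedge_point_base) auto
  qed (use slab_in_ucube[OF _ n] h in \<open>auto simp: inf_concat_def\<close>)
qed

lemma inf_concat_relcube:
  assumes base: "\<And>j. a j \<in> topspace (A j)" and n: "1 < n"
    and f: "\<And>j. f j \<in> relcube_maps n (A j) (a j)"
  shows "inf_concat a f \<in> relcube_maps n (shrinking_wedge A a) None"
  by (rule cube_htp_imp_relcube(1)[OF inf_concat_htp[OF base n cube_htp_refl[OF f]]])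

text \<open>The \<open>j\<close>-th coordinate is \<open>f j\<close> reparametrised by
  \<open>slab_clamp j\<close>, which fixes both ends.\<close>

lemma wedge_retract_inf_concat:
  assumes base: "\<And>j. a j \<in> topspace (A j)" and n: "1 < n"
    and f: "\<And>j. f j \<in> relcube_maps n (A j) (a j)"
  shows "cube_htp n (A j) (a j) (f j) (wedge_retract a j \<circ> inf_concat a f)"
proof -
  have "cube_htp n (A j) (a j) (f j) (\<lambda>t. f j (t(1 := slab_clamp j (t 1))))"
    using slab_clamp_bounds by (intro cube_htp_reparam[OF f n continuous_on_slab_clamp]) auto
  moreover have "f j (t(1 := slab_clamp j (t 1))) = (wedge_retract a j \<circ> inf_concat a f) t" if "t \<in> ucube n" for t
    using inf_concat_at_most_one[OF f n that] by (simp add: inf_concat_def wedge_retract_point)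
  ultimately show ?thesis
    by (meson cube_htp_cong cube_htp_imp_relcube(2) cube_htp_trans)
qed

lemma inf_concat_concat:
   "inf_concat a (\<lambda>j. concat_at 0 (f j) (g j)) = concat_at 0 (inf_concat a f) (inf_concat a g)"
  by (auto simp: inf_concat_def concat_at_def fun_eq_iff fun_upd_twist)

lemma concat_at_compose: "h \<circ> concat_at i f g = concat_at i (h \<circ> f) (h \<circ> g)"
  by (auto simp: concat_at_def)

lemma relcube_compose:
  assumes "f \<in> relcube_maps n X x" "continuous_map X Y h" "h x = y"
  shows "h \<circ> f \<in> relcube_maps n Y y"
  by (rule cube_htp_imp_relcube(1)[OF cube_htp_compose[OF cube_htp_refl[OF assms(1)] assms(2,3)]])

lemma carrier_homotopy_group: "carrier (homotopy_group n X x) = homotopy_class n X x ` relcube_maps n X x"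
  by (simp add: homotopy_group_def)

lemma mult_homotopy_class:
  assumes "f \<in> relcube_maps n X x" "g \<in> relcube_maps n X x" "0 < n"
  shows "homotopy_class n X x f \<otimes>\<^bsub>homotopy_group n X x\<^esub> homotopy_class n X x g = homotopy_class n X x (concat_at 0 f g)"
proof -
  have "cube_htp n X x (concat_at 0 f g) (concat_at 0 (SOME h. h \<in> homotopy_class n X x f) (SOME h. h \<in> homotopy_class n X x g))"
    by (intro concat_at_htp some_in_homotopy_class assms)
  then show ?thesis
    unfolding homotopy_class_eq_iff[OF concat_at_relcube[OF assms(1,2,3)], symmetric]
    by (simp add: homotopy_group_def concat_cube_eq)
qed

lemma canonical_phi_class:
  assumes base: "\<And>j. a j \<in> topspace (A j)"
    and f: "f \<in> relcube_maps n (shrinking_wedge A a) None"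
  shows "canonical_phi n A a (homotopy_class n (shrinking_wedge A a) None f) =
    (\<lambda>j. homotopy_class n (A j) (a j) (wedge_retract a j \<circ> f))"
proof
  fix j
  have "cube_htp n (A j) (a j) (wedge_retract a j \<circ> f) (wedge_retract a j \<circ> (SOME g. g \<in> homotopy_class n (shrinking_wedge A a) None f))"
    by (intro cube_htp_compose[OF some_in_homotopy_class[OF f]] continuous_map_wedge_retract base) simp
  note homotopy_class_eq_iff[THEN iffD2, OF cube_htp_imp_relcube(1), OF this this]
  then show "canonical_phi n A a (homotopy_class n (shrinking_wedge A a) None f) j = homotopy_class n (A j) (a j) (wedge_retract a j \<circ> f)"
    by (simp add: canonical_phi_def)
qed

lemma canonical_phi_hom:
  assumes base: "\<And>j. a j \<in> topspace (A j)" and n: "0 < n"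
  shows "canonical_phi n A a \<in> hom (homotopy_group n (shrinking_wedge A a) None)
                                  (product_group UNIV (\<lambda>j. homotopy_group n (A j) (a j)))"
proof -
  have ret: "wedge_retract a j \<circ> f \<in> relcube_maps n (A j) (a j)" if "f \<in> relcube_maps n (shrinking_wedge A a) None" for f j
    using that by (rule relcube_compose[OF _ continuous_map_wedge_retract[where A=A, OF base]]) simp
  show ?thesis
    unfolding hom_def
  proof (intro CollectI conjI ballI)
    show "canonical_phi n A a \<in> carrier (homotopy_group n (shrinking_wedge A a) None) \<rightarrow>
       carrier (product_group UNIV (\<lambda>j. homotopy_group n (A j) (a j)))"
      using canonical_phi_class[where A=A and n=n, OF base] ret by (auto simp: carrier_homotopy_group)
    fix c d assume "c \<in> carrier (homotopy_group n (shrinking_wedge A a) None)" "d \<in> carrier (homotopy_group n (shrinking_wedge A a) None)"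
    then obtain f g where f: "f \<in> relcube_maps n (shrinking_wedge A a) None" "c = homotopy_class n (shrinking_wedge A a) None f"
      and g: "g \<in> relcube_maps n (shrinking_wedge A a) None" "d = homotopy_class n (shrinking_wedge A a) None g"
      by (auto simp: carrier_homotopy_group)
    show "canonical_phi n A a (c \<otimes>\<^bsub>homotopy_group n (shrinking_wedge A a) None\<^esub> d) =
       canonical_phi n A a c \<otimes>\<^bsub>product_group UNIV (\<lambda>j. homotopy_group n (A j) (a j))\<^esub> canonical_phi n A a d"
      using f g n ret
      by (simp add: mult_homotopy_class canonical_phi_class[where A=A, OF base] concat_at_relcube concat_at_compose product_group_def fun_eq_iff)
  qed
qed

definition wedge_section :: "nat \<Rightarrow> (nat \<Rightarrow> 'a topology) \<Rightarrow> (nat \<Rightarrow> 'a) \<Rightarrow> (nat \<Rightarrow> ((nat \<Rightarrow> real) \<Rightarrow> 'a) set) \<Rightarrow> ((nat \<Rightarrow> real) \<Rightarrow> (nat \<times> 'a) option) set" where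
  "wedge_section n A a y = homotopy_class n (shrinking_wedge A a) None (inf_concat a (\<lambda>j. SOME f. f \<in> y j))"

lemma wedge_section_class:
  assumes base: "\<And>j. a j \<in> topspace (A j)" and n: "1 < n"
    and f: "\<And>j. f j \<in> relcube_maps n (A j) (a j)"
  shows "wedge_section n A a (\<lambda>j. homotopy_class n (A j) (a j) (f j)) = homotopy_class n (shrinking_wedge A a) None (inf_concat a f)"
proof -
  have "cube_htp n (shrinking_wedge A a) None (inf_concat a f) (inf_concat a (\<lambda>j. SOME g. g \<in> homotopy_class n (A j) (a j) (f j)))"
    by (intro inf_concat_htp base n some_in_homotopy_class f)
  note homotopy_class_eq_iff[THEN iffD2, OF cube_htp_imp_relcube(1), OF this this]
  then show ?thesis by (simp add: wedge_section_def)
qed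

lemma product_carrierD:
  assumes "y \<in> carrier (product_group UNIV (\<lambda>j. homotopy_group n (A j) (a j)))"
  shows "\<exists>f. (\<forall>j. f j \<in> relcube_maps n (A j) (a j)) \<and> y = (\<lambda>j. homotopy_class n (A j) (a j) (f j))"
proof -
  have "\<forall>j. \<exists>f. f \<in> relcube_maps n (A j) (a j) \<and> y j = homotopy_class n (A j) (a j) f"
    using assms by (auto simp: carrier_homotopy_group PiE_iff image_iff)
  then obtain f where "\<And>j. f j \<in> relcube_maps n (A j) (a j) \<and> y j = homotopy_class n (A j) (a j) (f j)" by metis
  then show ?thesis by (intro exI[of _ f]) (auto simp: fun_eq_iff)
qed

lemma wedge_section_hom:
  assumes base: "\<And>j. a j \<in> topspace (A j)" and n: "1 < n"
  shows "wedge_section n A a \<in> hom (product_group UNIV (\<lambda>j. homotopy_group n (A j) (a j)))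
      (homotopy_group n (shrinking_wedge A a) None)"
  unfolding hom_def
proof (intro CollectI conjI ballI funcsetI)
  fix y assume "y \<in> carrier (product_group UNIV (\<lambda>j. homotopy_group n (A j) (a j)))"
  then obtain f where "\<forall>j. f j \<in> relcube_maps n (A j) (a j)" "y = (\<lambda>j. homotopy_class n (A j) (a j) (f j))"
    using product_carrierD by blast
  then show "wedge_section n A a y \<in> carrier (homotopy_group n (shrinking_wedge A a) None)"
    using wedge_section_class[where A=A, OF base n] inf_concat_relcube[where A=A, OF base n]
    by (auto simp: carrier_homotopy_group)
next
  fix y z
  assume "y \<in> carrier (product_group UNIV (\<lambda>j. homotopy_group n (A j) (a j)))"
    "z \<in> carrier (product_group UNIV (\<lambda>j. homotopy_group n (A j) (a j)))"
  then obtain f g where f: "\<And>j. f j \<in> relcube_maps n (A j) (a j)" "y = (\<lambda>j. homotopy_class n (A j) (a j) (f j))"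
    and g: "\<And>j. g j \<in> relcube_maps n (A j) (a j)" "z = (\<lambda>j. homotopy_class n (A j) (a j) (g j))"
    by (blast dest!: product_carrierD)
  have n0: "0 < n" using n by simp
  have "y \<otimes>\<^bsub>product_group UNIV (\<lambda>j. homotopy_group n (A j) (a j))\<^esub> z = (\<lambda>j. homotopy_class n (A j) (a j) (concat_at 0 (f j) (g j)))"
    using f g n0 by (simp add: product_group_def mult_homotopy_class fun_eq_iff)
  then show "wedge_section n A a (y \<otimes>\<^bsub>product_group UNIV (\<lambda>j. homotopy_group n (A j) (a j))\<^esub> z) =
     wedge_section n A a y \<otimes>\<^bsub>homotopy_group n (shrinking_wedge A a) None\<^esub> wedge_section n A a z"
    using f g n0
    by (simp add: wedge_section_class[where A=A, OF base n] concat_at_relcube inf_concat_concat mult_homotopy_class inf_concat_relcube[where A=A, OF base n])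
qed

lemma canonical_phi_section:
  assumes base: "\<And>j. a j \<in> topspace (A j)" and n: "1 < n"
    and y: "y \<in> carrier (product_group UNIV (\<lambda>j. homotopy_group n (A j) (a j)))"
  shows "canonical_phi n A a (wedge_section n A a y) = y"
proof -
  obtain f where f: "\<And>j. f j \<in> relcube_maps n (A j) (a j)" "y = (\<lambda>j. homotopy_class n (A j) (a j) (f j))"
    using product_carrierD[OF y] by blast
  have "homotopy_class n (A j) (a j) (f j) = homotopy_class n (A j) (a j) (wedge_retract a j \<circ> inf_concat a f)" for j
    unfolding homotopy_class_eq_iff[OF f(1)] by (rule wedge_retract_inf_concat[OF base n f(1)])
  moreover have "canonical_phi n A a (wedge_section n A a y) = (\<lambda>j. homotopy_class n (A j) (a j) (wedge_retract a j \<circ> inf_concat a f))"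
    unfolding f(2)
    by (simp add: wedge_section_class[where A=A, OF base n f(1)] canonical_phi_class[where A=A, OF base] inf_concat_relcube[where A=A, OF base n f(1)])
  ultimately show ?thesis using f(2) by simp
qed

subsection \<open>Gluing and telescoping\<close>

text \<open>Preimages of a closed set \<open>B\<close> are shown to be closed near every point
  outside them. Near a point off \<open>C\<close> finitely many pieces occur. At a point of
  \<open>C\<close> the value \<open>a\<close> is not in \<open>B\<close>, so by nullness only
  finitely many pieces meet the preimage anywhere.\<close>

lemma continuous_map_glue_null:
  assumes T: "closedin X T" and Z: "\<And>i. i \<in> J \<Longrightarrow> closedin X (Z i)"
    and cover: "topspace X \<subseteq> T \<union> (\<Union>i\<in>J. Z i)"
    and contT: "continuous_map (subtopology X T) Y H"
    and contZ: "\<And>i. i \<in> J \<Longrightarrow> continuous_map (subtopology X (Z i)) Y H"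
    and HC: "\<And>x. x \<in> C \<Longrightarrow> H x = a"
    and lf: "\<And>x. x \<in> topspace X \<Longrightarrow> x \<notin> C \<Longrightarrow> \<exists>N. openin X N \<and> x \<in> N \<and> finite {i\<in>J. Z i \<inter> N \<noteq> {}}"
    and null: "\<And>V. openin Y V \<Longrightarrow> a \<in> V \<Longrightarrow> finite {i\<in>J. \<not> H ` Z i \<subseteq> V}"
    and a: "a \<in> topspace Y"
  shows "continuous_map X Y H"
proof -
  have HY: "H x \<in> topspace Y" if xX: "x \<in> topspace X" for x
  proof (cases "x \<in> T")
    case True
    then show ?thesis using xX continuous_map_image_subset_topspace[OF contT] by auto
  next
    case False
    then obtain i where "i \<in> J" "x \<in> Z i" using xX cover by auto
    then show ?thesis using xX continuous_map_image_subset_topspace[OF contZ, of i] by auto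
  qed
  show ?thesis
    unfolding continuous_map_closedin
  proof (intro conjI allI impI)
    show "H \<in> topspace X \<rightarrow> topspace Y" using HY by auto
    fix B assume B: "closedin Y B"
    let ?R = "{x \<in> topspace X. H x \<in> B}"
    have clT: "closedin X (T \<inter> ?R)"
    proof -
      have "closedin (subtopology X T) {x \<in> topspace (subtopology X T). H x \<in> B}"
        using contT B by (simp add: continuous_map_closedin)
      moreover have "{x \<in> topspace (subtopology X T). H x \<in> B} = T \<inter> ?R" by auto
      ultimately show ?thesis using T closedin_trans_full by metis
    qed
    have clZ: "closedin X (Z i \<inter> ?R)" if "i \<in> J" for i
    proof -
      have "closedin (subtopology X (Z i)) {x \<in> topspace (subtopology X (Z i)). H x \<in> B}"
        using contZ[OF that] B by (simp add: continuous_map_closedin)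
      moreover have "{x \<in> topspace (subtopology X (Z i)). H x \<in> B} = Z i \<inter> ?R" by auto
      ultimately show ?thesis using Z[OF that] closedin_trans_full by metis
    qed
    have "\<exists>N. openin X N \<and> x \<in> N \<and> N \<subseteq> topspace X - ?R" if x: "x \<in> topspace X - ?R" for x
    proof -
      have "\<exists>N F. openin X N \<and> x \<in> N \<and> F \<subseteq> J \<and> finite F \<and> ?R \<inter> N \<subseteq> (T \<inter> ?R) \<union> (\<Union>i\<in>F. Z i \<inter> ?R)"
      proof (cases "x \<in> C")
        case True
        then have "a \<in> topspace Y - B" using HC x a by auto
        then have fin: "finite {i\<in>J. \<not> H ` Z i \<subseteq> topspace Y - B}" using B null by (simp add: closedin_def)
        have "y \<in> (T \<inter> ?R) \<union> (\<Union>i\<in>{i\<in>J. \<not> H ` Z i \<subseteq> topspace Y - B}. Z i \<inter> ?R)" if "y \<in> ?R" for y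
        proof (cases "y \<in> T")
          case False
          then obtain i where "i \<in> J" "y \<in> Z i" using \<open>y \<in> ?R\<close> cover by blast
          then show ?thesis using \<open>y \<in> ?R\<close> by blast
        qed (use that in auto)
        then show ?thesis using fin x
          by (intro exI[of _ "topspace X"] exI[of _ "{i\<in>J. \<not> H ` Z i \<subseteq> topspace Y - B}"]) auto
      next
        case False
        then obtain N where N: "openin X N" "x \<in> N" "finite {i\<in>J. Z i \<inter> N \<noteq> {}}" using lf x by auto
        have "y \<in> (T \<inter> ?R) \<union> (\<Union>i\<in>{i\<in>J. Z i \<inter> N \<noteq> {}}. Z i \<inter> ?R)" if "y \<in> ?R \<inter> N" for y
        proof (cases "y \<in> T")
          case False
          then obtain i where "i \<in> J" "y \<in> Z i" using \<open>y \<in> ?R \<inter> N\<close> cover by blast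
          then show ?thesis using \<open>y \<in> ?R \<inter> N\<close> by blast
        qed (use that in auto)
        then show ?thesis using N
          by (intro exI[of _ N] exI[of _ "{i\<in>J. Z i \<inter> N \<noteq> {}}"]) auto
      qed
      then obtain N F where N: "openin X N" "x \<in> N" "F \<subseteq> J" "finite F" "?R \<inter> N \<subseteq> (T \<inter> ?R) \<union> (\<Union>i\<in>F. Z i \<inter> ?R)" by blast
      let ?K = "(T \<inter> ?R) \<union> (\<Union>i\<in>F. Z i \<inter> ?R)"
      have "closedin X ?K" using clT clZ N by (intro closedin_Un closedin_Union) auto
      then have "openin X (N - ?K)" using N by blast
      moreover have "x \<in> N - ?K" using x N by auto
      moreover have "N - ?K \<subseteq> topspace X - ?R" using N(5) openin_subset[OF N(1)] by blast
      ultimately show ?thesis by blast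
    qed
    then have "openin X (topspace X - ?R)" by (subst openin_subopen) blast
    then show "closedin X ?R" by (simp add: closedin_def)
  qed
qed

lemma continuous_map_glue_null_on:
  fixes D :: "'b::topological_space set"
  assumes T: "closedin (top_of_set D) T" and Z: "\<And>i. i \<in> J \<Longrightarrow> closedin (top_of_set D) (Z i)"
    and cover: "D \<subseteq> T \<union> (\<Union>i\<in>J. Z i)"
    and contT: "continuous_map (top_of_set T) Y H"
    and contZ: "\<And>i. i \<in> J \<Longrightarrow> continuous_map (top_of_set (Z i)) Y H"
    and HC: "\<And>x. x \<in> C \<Longrightarrow> H x = a"
    and lf: "\<And>x. x \<in> D \<Longrightarrow> x \<notin> C \<Longrightarrow> \<exists>N. openin (top_of_set D) N \<and> x \<in> N \<and> finite {i\<in>J. Z i \<inter> N \<noteq> {}}"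
    and null: "\<And>V. openin Y V \<Longrightarrow> a \<in> V \<Longrightarrow> finite {i\<in>J. \<not> H ` Z i \<subseteq> V}"
    and a: "a \<in> topspace Y"
  shows "continuous_map (top_of_set D) Y H"
proof (rule continuous_map_glue_null[OF T Z _ _ _ HC _ null a])
  have sub: "subtopology (top_of_set D) W = top_of_set W" if "closedin (top_of_set D) W" for W
    using closedin_imp_subset[OF that] by (simp add: subtopology_subtopology Int_absorb1)
  show "continuous_map (subtopology (top_of_set D) T) Y H" by (simp add: sub T contT)
  show "continuous_map (subtopology (top_of_set D) (Z i)) Y H" if "i \<in> J" for i by (simp add: sub Z contZ that)
qed (use cover lf in auto)

section \<open>The slabs of coordinate 0 and the telescoping homotopy\<close>

definition slab_left :: "nat \<Rightarrow> real" where "slab_left m = 1 - 1 / 2 ^ m"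

text \<open>Slabs are half-open, a common end point belonging to the later one; the index is
  meaningful for \<open>0 \<le> r\<close> and \<open>r < 1\<close>.\<close>

definition slab_index :: "real \<Rightarrow> nat" where "slab_index r = (LEAST m. r < slab_left (Suc m))"

lemma slab_left_0 [simp]: "slab_left 0 = 0" by (simp add: slab_left_def)

lemma slab_left_less_1: "slab_left m < 1" by (simp add: slab_left_def)

lemma slab_left_nonneg: "0 \<le> slab_left m" by (simp add: slab_left_def)

lemma slab_left_less_iff: "slab_left k < slab_left m \<longleftrightarrow> k < m"
  by (simp add: slab_left_def frac_less2 divide_less_cancel field_simps)

text \<open>The part to the right of \<open>slab_left (Suc m)\<close> is the right half of the part
  to the right of \<open>slab_left m\<close>; the formula is the rescaling in the second branch of
  \<open>concat_at 0\<close>.\<close>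

lemma slab_left_Suc: "2 ^ Suc m * (r - slab_left (Suc m)) = 2 * (2 ^ m * (r - slab_left m)) - 1"
  by (simp add: slab_left_def field_simps)

lemma slab_index_exists: "r < 1 \<Longrightarrow> \<exists>m. r < slab_left (Suc m)"
proof -
  assume "r < 1"
  then obtain m where "(1/2)^m < 1 - r" using real_arch_pow_inv[of "1-r" "1/2"] by auto
  then have "r < slab_left m" by (simp add: slab_left_def power_divide)
  also have "\<dots> < slab_left (Suc m)" by (simp add: slab_left_less_iff)
  finally show ?thesis by blast
qed

lemma slab_index_upper: "r < 1 \<Longrightarrow> r < slab_left (Suc (slab_index r))"
  unfolding slab_index_def by (rule LeastI_ex) (rule slab_index_exists)

lemma slab_index_lower: "0 \<le> r \<Longrightarrow> slab_left (slab_index r) \<le> r"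
proof (cases "slab_index r")
  case (Suc k)
  then have "\<not> r < slab_left (Suc k)" using not_less_Least[of k "\<lambda>m. r < slab_left (Suc m)"] by (simp add: slab_index_def)
  then show ?thesis using Suc by simp
qed simp

lemma slab_index_eq: "slab_left m \<le> r \<Longrightarrow> r < slab_left (Suc m) \<Longrightarrow> slab_index r = m"
proof -
  assume a: "slab_left m \<le> r" "r < slab_left (Suc m)"
  then have "r < 1" "0 \<le> r" using slab_left_less_1[of "Suc m"] slab_left_nonneg[of m] by linarith+
  then have "slab_left (slab_index r) < slab_left (Suc m)" "slab_left m < slab_left (Suc (slab_index r))"
    using slab_index_upper slab_index_lower a by fastforce+
  then show ?thesis by (simp add: slab_left_less_iff)
qed

text \<open>Slab \<open>m\<close> has length 1/2^(m+1), hence the factor. The slabs accumulate at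
  \<open>t 0 = 1\<close>, where the value is the base point; continuity there is a property of the
  family \<open>e\<close>.\<close>

definition slab_concat :: "'a \<Rightarrow> (nat \<Rightarrow> (nat \<Rightarrow> real) \<Rightarrow> 'a) \<Rightarrow> (nat \<Rightarrow> real) \<Rightarrow> 'a" where
  "slab_concat x e t = (if t 0 < 1
     then let m = slab_index (t 0) in e m (t(0 := 2 ^ Suc m * (t 0 - slab_left m))) else x)"

lemma slab_coord_bounds:
  assumes "slab_left m \<le> r" "r \<le> 1"
  shows "0 \<le> 2 ^ m * (r - slab_left m)" "2 ^ m * (r - slab_left m) \<le> 1"
proof -
  show "0 \<le> 2 ^ m * (r - slab_left m)" using assms by simp
  have "2 ^ m * (r - slab_left m) \<le> 2 ^ m * (1 - slab_left m)" using assms by simp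
  also have "\<dots> = 1" by (simp add: slab_left_def)
  finally show "2 ^ m * (r - slab_left m) \<le> 1" .
qed

text \<open>Stage \<open>m\<close> of the homotopy takes place at times between \<open>slab_left m\<close> and \<open>slab_left (Suc m)\<close>
  and only moves the part of the cube to the right of \<open>slab_left m\<close>; all later stages take
  place inside \<open>S m\<close>, which gives continuity at the end.\<close>

lemma telescope_htp:
  assumes n: "0 < n" and x: "x \<in> topspace X"
    and e: "\<And>k. e k \<in> relcube_maps n X x"
    and step: "\<And>k. cube_htp n (subtopology X (S k)) x (g k) (concat_at 0 (e k) (g (Suc k)))"
    and small: "\<And>V. openin X V \<Longrightarrow> x \<in> V \<Longrightarrow> finite {k. \<not> topspace X \<inter> S k \<subseteq> V}"
  shows "cube_htp n X x (g 0) (slab_concat x e)"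
proof -
  let ?D = "{0..1::real} \<times> ucube n"
  have "\<forall>k. \<exists>h. continuous_map (top_of_set ?D) (subtopology X (S k)) h \<and>
     (\<forall>t\<in>ucube n. h (0, t) = g k t) \<and> (\<forall>t\<in>ucube n. h (1, t) = concat_at 0 (e k) (g (Suc k)) t) \<and>
     (\<forall>s\<in>{0..1}. \<forall>t\<in>cube_boundary n. h (s, t) = x)"
    using step unfolding cube_htp_iff by blast
  then obtain h where h: "\<And>k. continuous_map (top_of_set ?D) (subtopology X (S k)) (h k)"
     "\<And>k t. t\<in>ucube n \<Longrightarrow> h k (0, t) = g k t" "\<And>k t. t\<in>ucube n \<Longrightarrow> h k (1, t) = concat_at 0 (e k) (g (Suc k)) t"
     "\<And>k s t. s\<in>{0..1} \<Longrightarrow> t\<in>cube_boundary n \<Longrightarrow> h k (s, t) = x"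
    by metis
  have gb: "g k t = x" if "t \<in> cube_boundary n" for k t
    using cube_htp_imp_relcube(1)[OF step[of k]] that by (auto simp: relcube_maps_iff)
  have eb: "e k t = x" if "t \<in> cube_boundary n" for k t
    using e[of k] that by (auto simp: relcube_maps_iff)
  \<comment> \<open>Stage \<open>m\<close> lasts 1/2^(m+1), but the part of the cube that it moves
    has length 1/2^m: hence the two different factors. Clamping the time at 1 freezes the piece
    \<open>e m\<close> when its stage is over.\<close>
  define F where "F m p = h m (min 1 (2 ^ Suc m * (fst p - slab_left m)), (snd p)(0 := 2 ^ m * (snd p 0 - slab_left m)))" for m and p :: "real \<times> (nat \<Rightarrow> real)"
  \<comment> \<open>The minimum of time and position selects the formula: a point of slab
    \<open>k\<close> takes part in the stages up to \<open>k\<close> and rests afterwards.\<close>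
  define H where "H p = (if min (fst p) (snd p 0) < 1 then F (slab_index (min (fst p) (snd p 0))) p else x)" for p
  define Z where "Z m = {p \<in> ?D. slab_left m \<le> min (fst p) (snd p 0) \<and> min (fst p) (snd p 0) \<le> slab_left (Suc m)}" for m
  have coord: "(snd p)(0 := 2 ^ m * (snd p 0 - slab_left m)) \<in> ucube n" if "p \<in> ?D" "slab_left m \<le> snd p 0" for p m
    using that n ucube_coord[of "snd p" n 0] slab_coord_bounds[of m "snd p 0"] by (intro ucube_upd) auto
  have time: "min 1 (2 ^ Suc m * (fst p - slab_left m)) \<in> {0..1}" if "slab_left m \<le> fst p" for p :: "real \<times> (nat \<Rightarrow> real)" and m
    using that by auto
  have HF: "H p = F m p" if p: "p \<in> Z m" for p m
  proof (cases "min (fst p) (snd p 0) = slab_left (Suc m)")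
    case False
    then have "slab_index (min (fst p) (snd p 0)) = m" "min (fst p) (snd p 0) < 1"
      using p slab_left_less_1[of "Suc m"] by (auto simp: Z_def intro!: slab_index_eq)
    then show ?thesis by (simp add: H_def)
  next
    \<comment> \<open>On the common boundary of \<open>Z m\<close> and \<open>Z (Suc m)\<close>
      either the position is on the dividing face, where both formulas give \<open>x\<close>, or
      stage \<open>m\<close> has just ended and hands over \<open>g (Suc m)\<close>.\<close>
    case True
    have pD: "p \<in> ?D" "snd p \<in> ucube n" using p by (auto simp: Z_def)
    have le: "slab_left (Suc m) \<le> fst p" "slab_left (Suc m) \<le> snd p 0" using True by (auto simp: min_def split: if_splits)
    have "slab_left m < slab_left (Suc m)" by (simp add: slab_left_less_iff)
    then have le': "slab_left m \<le> fst p" "slab_left m \<le> snd p 0" using le by auto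
    have time1: "min 1 (2 ^ Suc m * (fst p - slab_left m)) = 1"
      using le(1) slab_left_Suc[of m "fst p"] slab_coord_bounds(1)[of "Suc m" "fst p"] pD by auto
    have "slab_index (min (fst p) (snd p 0)) = Suc m"
      unfolding True by (rule slab_index_eq) (auto simp: slab_left_less_iff)
    then have Hp: "H p = F (Suc m) p" using True slab_left_less_1[of "Suc m"] by (simp add: H_def)
    have Fm: "F m p = concat_at 0 (e m) (g (Suc m)) ((snd p)(0 := 2 ^ m * (snd p 0 - slab_left m)))"
      unfolding F_def time1 by (rule h(3)) (rule coord[OF pD(1) le'(2)])
    have half: "2 ^ m * (snd p 0 - slab_left m) \<ge> 1/2"
      using slab_left_Suc[of m "snd p 0"] slab_coord_bounds(1)[of "Suc m" "snd p 0"] le(2) ucube_coord[OF pD(2), of 0] by auto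
    show ?thesis
    proof (cases "snd p 0 = slab_left (Suc m)")
      case t: True
      then have "F m p = e m ((snd p)(0 := 1))"
        using slab_left_Suc[of m "snd p 0"] Fm by (simp add: concat_at_def)
      then have "F m p = x" using eb cube_boundary_upd[OF pD(2) n, of 1] by simp
      moreover have "F (Suc m) p = x"
        unfolding F_def using t time[OF le(1)] cube_boundary_upd[OF pD(2) n, of 0] by (intro h(4)) auto
      ultimately show ?thesis using Hp by simp
    next
      case ns: False
      then have fp: "fst p = slab_left (Suc m)" using True by (auto simp: min_def split: if_splits)
      have "2 ^ m * (snd p 0 - slab_left m) \<noteq> 1/2"
      proof -
        have "2 ^ Suc m * (snd p 0 - slab_left (Suc m)) \<noteq> 0" using ns by simp
        then show ?thesis unfolding slab_left_Suc by linarith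
      qed
      then have "F m p = g (Suc m) ((snd p)(0 := 2 ^ Suc m * (snd p 0 - slab_left (Suc m))))"
        unfolding Fm slab_left_Suc using half by (simp add: concat_at_def)
      also have "\<dots> = F (Suc m) p"
        unfolding F_def fp using h(2)[OF coord[OF pD(1) le(2)]] by simp
      finally show ?thesis using Hp by simp
    qed
  qed
  have contF: "continuous_map (top_of_set (Z m)) (subtopology X (S m)) (F m)" for m
    unfolding F_def
  proof (rule continuous_map_compose_on[OF h(1)])
    show "continuous_on (Z m) (\<lambda>p. (min 1 (2 ^ Suc m * (fst p - slab_left m)), (snd p)(0 := 2 ^ m * (snd p 0 - slab_left m))))"
      by (intro continuous_intros)
    show "(min 1 (2 ^ Suc m * (fst p - slab_left m)), (snd p)(0 := 2 ^ m * (snd p 0 - slab_left m))) \<in> ?D" if "p \<in> Z m" for p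
      using that time coord by (auto simp: Z_def)
  qed
  have contH: "continuous_map (top_of_set (Z m)) (subtopology X (S m)) H" for m
    by (rule continuous_map_top_of_set_cong[OF contF]) (simp add: HF)
  \<comment> \<open>Here time and first coordinate are both 1; this is where infinitely many stages
    accumulate.\<close>
  let ?C = "{p \<in> ?D. min (fst p) (snd p 0) = 1}"
  have cmin: "continuous_on ?D (\<lambda>p. min (fst p) (snd p 0))" by (intro continuous_intros)
  have min01: "0 \<le> min (fst p) (snd p 0) \<and> min (fst p) (snd p 0) \<le> 1" if "p \<in> ?D" for p
    using that ucube_coord[of "snd p" n 0] by auto
  have "continuous_map (top_of_set ?D) X H"
  proof (rule continuous_map_glue_null_on[where T="?C" and C="?C" and J=UNIV and Z=Z and a=x])
    show "closedin (top_of_set ?D) ?C"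
      using continuous_closedin_preimage_constant[OF cmin] .
    show "closedin (top_of_set ?D) (Z m)" for m
    proof -
      have "Z m = ?D \<inter> (\<lambda>p. min (fst p) (snd p 0)) -` {slab_left m..slab_left (Suc m)}" by (auto simp: Z_def)
      then show ?thesis using continuous_closedin_preimage[OF cmin] by simp
    qed
    show "?D \<subseteq> ?C \<union> (\<Union>i\<in>UNIV. Z i)"
    proof
      fix p assume pD: "p \<in> ?D"
      show "p \<in> ?C \<union> (\<Union>i\<in>UNIV. Z i)"
      proof (cases "min (fst p) (snd p 0) < 1")
        case True
        then have "p \<in> Z (slab_index (min (fst p) (snd p 0)))"
          using slab_index_lower[of "min (fst p) (snd p 0)"] slab_index_upper[OF True] min01[OF pD] pD
          unfolding Z_def by force
        then show ?thesis by blast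
      next
        case False
        then show ?thesis using min01[OF pD] pD by force
      qed
    qed
    have "continuous_map (top_of_set ?C) X (\<lambda>p. x)" using x by simp
    then show "continuous_map (top_of_set ?C) X H"
      by (rule continuous_map_top_of_set_cong) (auto simp: H_def)
    show "continuous_map (top_of_set (Z m)) X H" for m
      using contH[of m] by (simp add: continuous_map_in_subtopology)
    show "H p = x" if "p \<in> ?C" for p using that by (simp add: H_def)
    show "\<exists>N. openin (top_of_set ?D) N \<and> p \<in> N \<and> finite {i \<in> UNIV. Z i \<inter> N \<noteq> {}}"
      if p: "p \<in> ?D" "p \<notin> ?C" for p
    proof -
      define m where "m = slab_index (min (fst p) (snd p 0))"
      note pD = p(1)
      let ?N = "?D \<inter> (\<lambda>p. min (fst p) (snd p 0)) -` {..<slab_left (Suc m)}"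
      have "p \<in> ?N" using p min01[OF pD] slab_index_upper[of "min (fst p) (snd p 0)"] unfolding m_def by fastforce
      moreover have "openin (top_of_set ?D) ?N" by (rule continuous_openin_preimage_gen[OF cmin]) simp
      moreover have "{i \<in> UNIV. Z i \<inter> ?N \<noteq> {}} \<subseteq> {..m}"
      proof
        fix i assume "i \<in> {i \<in> UNIV. Z i \<inter> ?N \<noteq> {}}"
        then have "slab_left i < slab_left (Suc m)" by (auto simp: Z_def)
        then show "i \<in> {..m}" by (simp add: slab_left_less_iff)
      qed
      ultimately show ?thesis using finite_subset by blast
    qed
    show "finite {i \<in> UNIV. \<not> H ` Z i \<subseteq> V}" if V: "openin X V" "x \<in> V" for V
    proof (rule finite_subset[OF _ small[OF V]])
      have "H ` Z i \<subseteq> topspace X \<inter> S i" for i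
        using continuous_map_image_subset_topspace[OF contH[of i]] by simp
      then show "{i \<in> UNIV. \<not> H ` Z i \<subseteq> V} \<subseteq> {k. \<not> topspace X \<inter> S k \<subseteq> V}" by blast
    qed
  qed (use x in auto)
  then show ?thesis
  proof (rule cube_htpI)
    fix t assume t: "t \<in> ucube n"
    then have t01: "0 \<le> t 0" "t 0 \<le> 1" using ucube_coord by auto
    have "(0,t) \<in> Z 0" using t t01 by (auto simp: Z_def slab_left_def)
    then show "H (0, t) = g 0 t"
      using HF[of "(0,t)" 0] h(2)[OF t] by (simp add: F_def)
    show "H (1, t) = slab_concat x e t"
    proof (cases "t 0 < 1")
      case True
      define m where "m = slab_index (t 0)"
      have m: "slab_left m \<le> t 0" "t 0 < slab_left (Suc m)"
        using slab_index_lower slab_index_upper True t01 by (auto simp: m_def)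
      have "2 ^ Suc m * (1 - slab_left m) = 2" by (simp add: slab_left_def)
      then have "H (1, t) = h m (1, t(0 := 2 ^ m * (t 0 - slab_left m)))"
        using True t01 unfolding H_def F_def m_def by simp
      also have "\<dots> = concat_at 0 (e m) (g (Suc m)) (t(0 := 2 ^ m * (t 0 - slab_left m)))"
        using coord[of "(1,t)" m] m t by (intro h(3)) auto
      also have "\<dots> = e m (t(0 := 2 ^ Suc m * (t 0 - slab_left m)))"
      proof -
        have "2 ^ Suc m * (t 0 - slab_left (Suc m)) < 0" using m(2) by (simp add: mult_less_0_iff)
        then have "2 ^ m * (t 0 - slab_left m) \<le> 1/2" unfolding slab_left_Suc by linarith
        then show ?thesis by (simp add: concat_at_def mult.assoc)
      qed
      finally show ?thesis using True by (simp add: slab_concat_def m_def Let_def)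
    next
      case False
      then show ?thesis using t01 by (simp add: H_def slab_concat_def)
    qed
  next
    fix s :: real and t assume s: "0 \<le> s" "s \<le> 1" and t: "t \<in> cube_boundary n"
    have tu: "t \<in> ucube n" using t cube_boundary_subset by auto
    have t01: "0 \<le> t 0" "t 0 \<le> 1" using ucube_coord[OF tu] by auto
    show "H (s, t) = x"
    proof (cases "min s (t 0) < 1")
      case True
      define m where "m = slab_index (min s (t 0))"
      have m: "slab_left m \<le> min s (t 0)"
        using slab_index_lower[of "min s (t 0)"] s t01 by (auto simp: m_def)
      \<comment> \<open>On the face \<open>t 0 = 0\<close> only stage 0 acts, so the rescaling
        leaves this coordinate at 0.\<close>
      have m0: "m = 0" if "t 0 = 0"
        using that s unfolding m_def by (intro slab_index_eq) (auto simp: slab_left_def)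
      have "t(0 := 2 ^ m * (t 0 - slab_left m)) \<in> cube_boundary n"
        using t n m t01 slab_coord_bounds[of m "t 0"] m0
        by (intro cube_boundary_upd_fix) (auto simp: slab_left_def)
      then have "F m (s, t) = x"
        unfolding F_def using time[of m "(s,t)"] m by (intro h(4)) auto
      then show ?thesis using True by (simp add: H_def m_def)
    qed (simp add: H_def)
  qed
qed

text \<open>Each slice \<open>t 0 = r\<close> maps into a single summand and continues to do so
  while coordinate 1 is moved. Hence the coordinates of the wedge may be reparametrised
  independently, the \<open>j\<close>-th one towards \<open>slab_clamp j\<close>.\<close>

lemma slabwise_htp_inf_concat:
  assumes base: "\<And>j. a j \<in> topspace (A j)" and n: "1 < n"
    and f: "f \<in> relcube_maps n (shrinking_wedge A a) None"
    and mono: "\<And>r. \<exists>j. \<forall>t\<in>ucube n. t 0 = r \<longrightarrow> (\<forall>i. i \<noteq> j \<longrightarrow> wedge_retract a i (f t) = a i)"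
  shows "cube_htp n (shrinking_wedge A a) None f (inf_concat a (\<lambda>j. wedge_retract a j \<circ> f))"
proof -
  let ?c = "\<lambda>j s t. (1 - s) * t 1 + s * slab_clamp j (t 1)"
  let ?u = "\<lambda>p j. wedge_retract a j (f ((snd p)(1 := ?c j (fst p) (snd p))))"
  have fc: "continuous_map (top_of_set (ucube n)) (shrinking_wedge A a) f" "\<And>t. t \<in> cube_boundary n \<Longrightarrow> f t = None"
    using f by (auto simp: relcube_maps_iff)
  have fin: "f t \<in> wedge_carrier A a" if "t \<in> ucube n" for t
    using continuous_map_image_subset_topspace[OF fc(1)] that by auto
  have c01: "0 \<le> ?c j s t \<and> ?c j s t \<le> 1" if "0 \<le> s" "s \<le> 1" "t \<in> ucube n" for j s and t :: "nat \<Rightarrow> real"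
    using that slab_clamp_bounds[of j "t 1"] ucube_coord[OF that(3), of 1]
    by (intro conjI add_nonneg_nonneg mult_nonneg_nonneg convex_bound_le) auto
  have inu: "t(1 := ?c j s t) \<in> ucube n" if "0 \<le> s" "s \<le> 1" "t \<in> ucube n" for j s t
    using c01[OF that] that n by (intro ucube_upd) auto
  show ?thesis
  proof (rule cube_htpI[where h="\<lambda>p. wedge_point a (?u p)"])
    show "continuous_map (top_of_set ({0..1::real} \<times> ucube n)) (shrinking_wedge A a) (\<lambda>p. wedge_point a (?u p))"
    proof (rule continuous_map_wedge_point[OF base])
      fix p i j
      assume p: "p \<in> topspace (top_of_set ({0..1::real} \<times> ucube n))" and ij: "?u p i \<noteq> a i" "?u p j \<noteq> a j"
      obtain k where k: "\<And>t i. t\<in>ucube n \<Longrightarrow> t 0 = snd p 0 \<Longrightarrow> i \<noteq> k \<Longrightarrow> wedge_retract a i (f t) = a i"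
        using mono by blast
      have "?u p i = a i" if "i \<noteq> k" for i
        using p that inu[of "fst p" "snd p"] by (intro k) auto
      then show "i = j" using ij by metis
    next
      fix j
      have c: "continuous_on ({0..1::real} \<times> ucube n) (\<lambda>p. slab_clamp j (snd p 1))"
        by (rule continuous_on_compose2[OF continuous_on_slab_clamp[of UNIV]]) (auto intro!: continuous_intros)
      have "continuous_map (top_of_set (ucube n)) (A j) (\<lambda>t. wedge_retract a j (f t))"
        using continuous_map_compose[OF fc(1) continuous_map_wedge_retract[where A=A, OF base]] by (simp add: o_def)
      then show "continuous_map (top_of_set ({0..1::real} \<times> ucube n)) (A j) (\<lambda>p. ?u p j)"
      proof (rule continuous_map_compose_on)
        show "continuous_on ({0..1::real} \<times> ucube n) (\<lambda>p. (snd p)(1 := ?c j (fst p) (snd p)))"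
          by (intro continuous_intros c)
        show "(snd p)(1 := ?c j (fst p) (snd p)) \<in> ucube n" if "p \<in> {0..1::real} \<times> ucube n" for p
          using that by (intro inu) auto
      qed
    qed
  next
    fix t assume t: "t \<in> ucube n"
    have one: "i = j" if "wedge_retract a i (f t) \<noteq> a i" "wedge_retract a j (f t) \<noteq> a j" for i j
      using wedge_retract_inj_on[OF fin[OF t] that] .
    show "wedge_point a (?u (0, t)) = f t"
    proof (rule wedge_eqI[where A=A and a=a])
      show "wedge_point a (?u (0, t)) \<in> wedge_carrier A a"
        using one wedge_retract_in[where A=A, OF base fin[OF t]] by (intro wedge_point_in) auto
      show "wedge_retract a j (wedge_point a (?u (0, t))) = wedge_retract a j (f t)" for j
        using one by (subst wedge_retract_point) auto
    qed (rule fin[OF t])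
    show "wedge_point a (?u (1, t)) = inf_concat a (\<lambda>j. wedge_retract a j \<circ> f) t"
      by (simp add: inf_concat_def)
  next
    fix s :: real and t assume s: "0 \<le> s" "s \<le> 1" and t: "t \<in> cube_boundary n"
    then have "t \<in> ucube n" using cube_boundary_subset by auto
    then have "t(1 := ?c j s t) \<in> cube_boundary n" for j
      using c01[OF s, of t j] t n by (intro cube_boundary_upd_fix) auto
    then show "wedge_point a (?u (s, t)) = None"
      using fc(2) by (intro wedge_point_base) auto
  qed
qed

subsection \<open>Null families\<close>

text \<open>Uniform convergence of the family to the constant \<open>a\<close>, stated by
  neighbourhoods because \<open>A\<close> carries no metric.\<close>

definition null_family :: "'i set \<Rightarrow> 'a topology \<Rightarrow> 'a \<Rightarrow> ('i \<Rightarrow> 'b set) \<Rightarrow> ('i \<Rightarrow> 'b \<Rightarrow> 'a) \<Rightarrow> bool" where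
  "null_family J A a K g \<longleftrightarrow> (\<forall>V. openin A V \<longrightarrow> a \<in> V \<longrightarrow> finite {i\<in>J. \<not> g i ` K i \<subseteq> V})"

definition harm_set :: "real set" where
  "harm_set = insert 0 {1 / real m | m. m \<ge> 1}"

text \<open>Recovers \<open>i\<close> from \<open>1 / real (Suc i)\<close>; numbering starts at 0,
  hence the subtraction.\<close>

definition harm_index :: "real \<Rightarrow> nat" where
  "harm_index u = nat \<lfloor>1 / u\<rfloor> - 1"

lemma harmonic_space_eq: "harmonic_space = top_of_set harm_set"
  by (simp add: harmonic_space_def harm_set_def)

lemma harm_eq: "harm_set = insert 0 (range (\<lambda>i. 1 / real (Suc i)))"
proof -
  have "{1 / real m | m. m \<ge> 1} = range (\<lambda>i. 1 / real (Suc i))"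
  proof (intro equalityI subsetI)
    fix x assume "x \<in> {1 / real m | m. m \<ge> 1}"
    then obtain m where "m \<ge> 1" "x = 1 / real m" by auto
    then show "x \<in> range (\<lambda>i. 1 / real (Suc i))" by (cases m) auto
  next
    fix x assume "x \<in> range (\<lambda>i. 1 / real (Suc i))"
    then obtain i where "x = 1 / real (Suc i)" by auto
    then show "x \<in> {1 / real m | m. m \<ge> 1}" by (intro CollectI exI[of _ "Suc i"]) simp
  qed
  then show ?thesis by (simp add: harm_set_def)
qed

lemma harm_index_inverse [simp]: "harm_index (1 / real (Suc i)) = i"
  by (simp add: harm_index_def del: of_nat_Suc)

lemma harm_cases:
  assumes "u \<in> harm_set" obtains "u = 0" | i where "u = 1 / real (Suc i)"
  using assms by (auto simp: harm_eq)

lemma in_harm [simp]: "0 \<in> harm_set" "1 / real (Suc i) \<in> harm_set" by (auto simp: harm_eq)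

lemma compact_harm: "compact harm_set"
  unfolding harm_eq
proof (rule compact_sequence_with_limit)
  show "(\<lambda>i. 1 / real (Suc i)) \<longlonglongrightarrow> 0" by (rule LIMSEQ_Suc) (rule lim_1_over_n)
qed

text \<open>A null sequence of maps on \<open>K\<close> becomes one map on the product with the
  harmonic space: the fibres over positive points are locally finite off the fibre over 0, so the
  pasting principle applies.\<close>

lemma continuous_map_harm_family:
  fixes K :: "'b::t2_space set"
  assumes cont: "\<And>i. continuous_map (top_of_set K) A (g i)" and null: "null_family UNIV A a (\<lambda>_. K) g"
    and a: "a \<in> topspace A"
  shows "continuous_map (top_of_set (harm_set \<times> K)) A (\<lambda>p. if fst p = 0 then a else g (harm_index (fst p)) (snd p))"
    (is "continuous_map _ _ ?H")
proof -
  let ?D = "harm_set \<times> K"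
  have cf: "continuous_on ?D fst" by (intro continuous_intros)
  let ?T = "{0} \<times> K" and ?Z = "\<lambda>i. {1 / real (Suc i)} \<times> K"
  have cl: "closedin (top_of_set ?D) ({u} \<times> K)" if "u \<in> harm_set" for u
  proof -
    have "{u} \<times> K = {p \<in> ?D. fst p = u}" using that by auto
    then show ?thesis using continuous_closedin_preimage_constant[OF cf] by metis
  qed
  show ?thesis
  proof (rule continuous_map_glue_null_on[where T="?T" and C="?T" and J=UNIV and Z="?Z" and a=a])
    show "closedin (top_of_set ?D) ?T" "closedin (top_of_set ?D) (?Z i)" for i
      by (rule cl, rule in_harm)+
    show "?D \<subseteq> ?T \<union> (\<Union>i\<in>UNIV. ?Z i)"
      by (auto simp: harm_eq)
    show "continuous_map (top_of_set ?T) A ?H"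
      by (rule continuous_map_top_of_set_cong[where f="\<lambda>_. a"]) (use a in auto)
    show "continuous_map (top_of_set (?Z i)) A ?H" for i
    proof (rule continuous_map_top_of_set_cong)
      show "continuous_map (top_of_set (?Z i)) A (\<lambda>p. g i (snd p))"
        by (rule continuous_map_compose_on[OF cont continuous_on_snd[OF continuous_on_id]]) auto
      show "\<And>x. x \<in> ?Z i \<Longrightarrow> g i (snd x) = ?H x"
        using harm_index_inverse[of i] by auto
    qed
    show "?H x = a" if "x \<in> ?T" for x using that by auto
    show "\<exists>N. openin (top_of_set ?D) N \<and> p \<in> N \<and> finite {i \<in> UNIV. ?Z i \<inter> N \<noteq> {}}"
      if p: "p \<in> ?D" "p \<notin> ?T" for p
    proof -
      obtain m where m: "fst p = 1 / real (Suc m)" using p by (auto elim!: harm_cases)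
      let ?N = "?D \<inter> fst -` {1 / real (Suc (Suc m))<..}"
      have "openin (top_of_set ?D) ?N" by (rule continuous_openin_preimage_gen[OF cf]) simp
      moreover have "1 / real (Suc (Suc m)) < fst p" unfolding m by (simp add: frac_less2)
      then have "p \<in> ?N" using p by simp
      moreover have "{i \<in> UNIV. ?Z i \<inter> ?N \<noteq> {}} \<subseteq> {..m}"
        by (auto simp: divide_simps)
      ultimately show ?thesis using finite_subset by blast
    qed
    show "finite {i \<in> UNIV. \<not> ?H ` ?Z i \<subseteq> V}" if "openin A V" "a \<in> V" for V
    proof -
      have "?H ` ?Z i = g i ` K" for i using harm_index_inverse[of i] by (force simp: image_iff)
      then show ?thesis using null that by (simp add: null_family_def)
    qed
  qed (rule a)
qed

lemma compact_outside:
  assumes "continuous_map (top_of_set K) A f" "compact K" "openin A V"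
  shows "compact {p \<in> K. f p \<notin> V}"
proof -
  have "f p \<in> topspace A" if "p \<in> K" for p
    using continuous_map_image_subset_topspace[OF assms(1)] that by auto
  then have "{p \<in> topspace (top_of_set K). f p \<in> topspace A - V} = {p \<in> K. f p \<notin> V}" by auto
  moreover have "closedin A (topspace A - V)" using assms(3) by auto
  then have "closedin (top_of_set K) {p \<in> topspace (top_of_set K). f p \<in> topspace A - V}"
    using assms(1)[unfolded continuous_map_closedin] by blast
  ultimately have "closedin (top_of_set K) {p \<in> K. f p \<notin> V}" by (simp only:)
  then show ?thesis using closedin_compact assms(2) by blast
qed

text \<open>Converse of the preceding translation, by compactness of \<open>K\<close>: the points
  where \<open>G\<close> leaves \<open>V\<close> form a compact set that misses the fibre over 0, so
  their first coordinates are bounded away from 0.\<close>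

lemma harm_family_null:
  fixes K :: "'b::t2_space set"
  assumes cont: "continuous_map (top_of_set (harm_set \<times> K)) A G" and K: "compact K"
    and G0: "\<And>x. x \<in> K \<Longrightarrow> G (0, x) = a"
  shows "null_family UNIV A a (\<lambda>_. K) (\<lambda>i x. G (1 / real (Suc i), x))"
  unfolding null_family_def
proof (intro allI impI)
  fix V assume V: "openin A V" "a \<in> V"
  let ?D = "harm_set \<times> K"
  let ?W = "{p \<in> ?D. G p \<notin> V}"
  have "compact ?W" by (rule compact_outside[OF cont compact_Times[OF compact_harm K] V(1)])
  then have c: "compact (fst ` ?W)" by (intro compact_continuous_image continuous_intros)
  have "0 \<notin> fst ` ?W" using G0 V by auto
  then obtain \<epsilon> where eps: "\<epsilon> > 0" "\<And>u. u \<in> fst ` ?W \<Longrightarrow> \<epsilon> \<le> dist 0 u"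
    using separate_point_closed[OF compact_imp_closed[OF c], of 0] by blast
  obtain N :: nat where N: "1 / \<epsilon> < real N" using reals_Archimedean2 by blast
  have "{i \<in> UNIV. \<not> (\<lambda>x. G (1 / real (Suc i), x)) ` K \<subseteq> V} \<subseteq> {..N}"
  proof
    fix i assume "i \<in> {i \<in> UNIV. \<not> (\<lambda>x. G (1 / real (Suc i), x)) ` K \<subseteq> V}"
    then obtain x where "x \<in> K" "G (1 / real (Suc i), x) \<notin> V" by auto
    then have "(1 / real (Suc i), x) \<in> ?W" by (simp del: of_nat_Suc)
    then have "1 / real (Suc i) \<in> fst ` ?W" by (metis (no_types, lifting) fst_conv image_eqI)
    then have "\<epsilon> \<le> 1 / real (Suc i)" using eps(2) by fastforce
    then have "real (Suc i) \<le> 1 / \<epsilon>" using eps(1) by (simp add: field_simps)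
    then show "i \<in> {..N}" using N by simp
  qed
  then show "finite {i \<in> UNIV. \<not> (\<lambda>x. G (1 / real (Suc i), x)) ` K \<subseteq> V}" using finite_subset by blast
qed

subsection \<open>Sequential connectedness and extension of null families\<close>

definition usphere :: "nat \<Rightarrow> (nat \<Rightarrow> real) set" where
  "usphere k = {x. (\<Sum>i\<le>k. (x i)\<^sup>2) = 1 \<and> (\<forall>i>k. x i = 0)}"

lemma nsphere_eq: "nsphere k = top_of_set (usphere k)"
proof -
  have "{x. \<forall>i\<ge>Suc k. x i = 0} \<inter> {x::nat\<Rightarrow>real. (\<Sum>i\<le>k. (x i)\<^sup>2) = 1} = usphere k"
    by (auto simp: usphere_def Suc_le_eq)
  then show ?thesis
    by (simp add: nsphere_def Euclidean_space_def euclidean_product_topology subtopology_subtopology)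
qed

lemma topspace_nsphere_usphere [simp]: "topspace (nsphere k) = usphere k"
  by (simp add: nsphere_eq)

lemma usphere_coord_le:
  assumes "x \<in> usphere k" shows "\<bar>x i\<bar> \<le> 1"
proof (cases "i \<le> k")
  case True
  have "(x i)\<^sup>2 \<le> (\<Sum>i\<le>k. (x i)\<^sup>2)" using True by (intro member_le_sum) auto
  then show ?thesis using assms by (simp add: usphere_def abs_square_le_1)
qed (use assms in \<open>auto simp: usphere_def\<close>)

lemma continuous_on_coord: "continuous_on S (\<lambda>x::nat\<Rightarrow>real. x i)"
  by (rule continuous_on_subset[OF continuous_on_product_coordinates]) simp

lemma compact_usphere: "compact (usphere k)"
proof -
  have "compactin (product_topology (\<lambda>i::nat. euclideanreal) UNIV) (PiE UNIV (\<lambda>i. {-1..1}))"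
    by (subst compactin_PiE) auto
  then have c: "compact (PiE UNIV (\<lambda>i::nat. {-1..1::real}))" by (simp add: euclidean_product_topology)
  have "continuous_on UNIV (\<lambda>x::nat\<Rightarrow>real. \<Sum>i\<le>k. (x i)\<^sup>2)" by (intro continuous_intros continuous_on_coord)
  then have "closed ((\<lambda>x::nat\<Rightarrow>real. \<Sum>i\<le>k. (x i)\<^sup>2) -` {1})" by (rule closed_vimage[rotated]) simp
  moreover have "closed ((\<lambda>x::nat\<Rightarrow>real. x i) -` {0})" for i
    by (rule closed_vimage[rotated, OF continuous_on_coord]) simp
  ultimately have "closed ((\<lambda>x::nat\<Rightarrow>real. \<Sum>i\<le>k. (x i)\<^sup>2) -` {1} \<inter> (\<Inter>i\<in>{k<..}. (\<lambda>x::nat\<Rightarrow>real. x i) -` {0}))"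
    by (intro closed_Int closed_INT) auto
  also have "(\<lambda>x::nat\<Rightarrow>real. \<Sum>i\<le>k. (x i)\<^sup>2) -` {1} \<inter> (\<Inter>i\<in>{k<..}. (\<lambda>x::nat\<Rightarrow>real. x i) -` {0}) = usphere k"
    by (auto simp: usphere_def)
  finally have "closed (usphere k)" .
  moreover have "usphere k \<subseteq> PiE UNIV (\<lambda>i::nat. {-1..1::real})"
    using usphere_coord_le by (fastforce simp: abs_le_iff)
  ultimately show ?thesis using c by (metis compact_Int_closed inf.absorb2 inf.commute)
qed

lemma sphere_base_in: "sphere_base \<in> usphere k"
proof -
  have "(\<Sum>i\<le>k. (sphere_base i)\<^sup>2) = (\<Sum>i\<in>{..k}. if i = 0 then 1 else 0)"
    by (intro sum.cong) (auto simp: sphere_base_def)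
  then show ?thesis by (auto simp: usphere_def sphere_base_def)
qed

lemma based_classes_singletonD:
  assumes "is_singleton (based_htpy_classes X x0 Z z)" "continuous_map X Z f" "f x0 = z" "z \<in> topspace Z"
  shows "homotopic_with (\<lambda>h. h x0 = z) X Z f (\<lambda>_. z)"
proof -
  obtain c where c: "based_htpy_classes X x0 Z z = {c}" using assms(1) by (auto simp: is_singleton_def)
  have "{g. homotopic_with (\<lambda>h. h x0 = z) X Z f g} \<in> based_htpy_classes X x0 Z z"
    unfolding based_htpy_classes_def using assms by (intro image_eqI[of _ _ f]) auto
  moreover have "{g. homotopic_with (\<lambda>h. h x0 = z) X Z (\<lambda>_. z) g} \<in> based_htpy_classes X x0 Z z"
    unfolding based_htpy_classes_def using assms by (intro image_eqI[of _ _ "\<lambda>_. z"]) auto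
  ultimately have "{g. homotopic_with (\<lambda>h. h x0 = z) X Z f g} = {g. homotopic_with (\<lambda>h. h x0 = z) X Z (\<lambda>_. z) g}"
    using c by auto
  moreover have "(\<lambda>_. z) \<in> {g. homotopic_with (\<lambda>h. h x0 = z) X Z (\<lambda>_. z) g}" using assms by auto
  ultimately show ?thesis by blast
qed

text \<open>Sequential 0-connectedness in usable form: the points of a sequence converging to
  \<open>a\<close> are joined to \<open>a\<close> by paths that together converge to the constant
  path.\<close>

lemma harmonic_null_path:
  assumes conn: "is_singleton (based_htpy_classes harmonic_space 0 A a)" and a: "a \<in> topspace A"
    and s: "continuous_map (top_of_set harm_set) A s" "s 0 = a"
  shows "\<exists>P. continuous_map (top_of_set ({0..1::real} \<times> harm_set)) A P \<and>
    (\<forall>u. P (0, u) = s u) \<and> (\<forall>u. P (1, u) = a) \<and> (\<forall>t\<in>{0..1}. P (t, 0) = a)"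
proof -
  have "homotopic_with (\<lambda>h. h 0 = a) harmonic_space A s (\<lambda>_. a)"
    using assms by (intro based_classes_singletonD) (auto simp: harmonic_space_eq)
  then obtain P where "continuous_map (prod_topology (top_of_set {0..1::real}) (top_of_set harm_set)) A P"
    "\<forall>u. P (0, u) = s u" "\<forall>u. P (1, u) = a" "\<forall>t\<in>{0..1}. P (t, 0) = a"
    unfolding homotopic_with_def harmonic_space_eq by auto
  then show ?thesis by (auto simp: prod_topology_subtopology_eu)
qed

text \<open>Homotopies of families indexed by the first coordinate. Keeping the fibre over the limit
  index 0 at \<open>a\<close> makes every stage a null sequence again when the fibres are
  compact.\<close>

definition fam_htp :: "(real \<times> 'b::topological_space) set \<Rightarrow> 'a topology \<Rightarrow> 'a \<Rightarrow> (real \<times> 'b \<Rightarrow> 'a) \<Rightarrow> (real \<times> 'b \<Rightarrow> 'a) \<Rightarrow> bool" where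
  "fam_htp D A a f g \<longleftrightarrow> homotopic_with (\<lambda>h. \<forall>p\<in>D. fst p = 0 \<longrightarrow> h p = a) (top_of_set D) A f g"

lemma fam_htp_iff: "fam_htp D A a f g \<longleftrightarrow> (\<exists>h. continuous_map (top_of_set ({0..1::real} \<times> D)) A h \<and>
   (\<forall>p\<in>D. h (0, p) = f p) \<and> (\<forall>p\<in>D. h (1, p) = g p) \<and> (\<forall>s\<in>{0..1}. \<forall>p\<in>D. fst p = 0 \<longrightarrow> h (s, p) = a))"
proof -
  have *: "prod_topology (top_of_set {0..1::real}) (top_of_set D) = top_of_set ({0..1} \<times> D)"
    by (simp add: prod_topology_subtopology_eu)
  have "fam_htp D A a f g \<longleftrightarrow> (\<exists>h. continuous_map (prod_topology (top_of_set {0..1::real}) (top_of_set D)) A h \<and>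
     (\<forall>t\<in>topspace (top_of_set D). h (0, t) = f t) \<and> (\<forall>t\<in>topspace (top_of_set D). h (1, t) = g t) \<and>
     (\<forall>s\<in>{0..1}. \<forall>p\<in>D. fst p = 0 \<longrightarrow> h (s, p) = a))"
    unfolding fam_htp_def
    by (rule homotopic_with[where P="\<lambda>h. \<forall>p\<in>D. fst p = 0 \<longrightarrow> h p = a"]) auto
  then show ?thesis unfolding * by auto
qed

lemma fam_htpI:
  assumes "continuous_map (top_of_set ({0..1::real} \<times> D)) A h"
    "\<And>p. p \<in> D \<Longrightarrow> h (0, p) = f p" "\<And>p. p \<in> D \<Longrightarrow> h (1, p) = g p"
    "\<And>s p. 0 \<le> s \<Longrightarrow> s \<le> 1 \<Longrightarrow> p \<in> D \<Longrightarrow> fst p = 0 \<Longrightarrow> h (s, p) = a"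
  shows "fam_htp D A a f g"
  unfolding fam_htp_iff using assms by (intro exI[of _ h]) auto

lemma fam_htp_trans: "fam_htp D A a f g \<Longrightarrow> fam_htp D A a g h \<Longrightarrow> fam_htp D A a f h"
  unfolding fam_htp_def by (rule homotopic_with_trans)

text \<open>Collapses the fibre over 0 and all base points to the wedge point; homotopies on the
  earring are pulled back along this map.\<close>

lemma continuous_map_to_earring:
  "continuous_map (top_of_set (harm_set \<times> usphere k)) (earring_space k)
     (\<lambda>p. if fst p = 0 then None else wedge_inj (\<lambda>_. sphere_base) (harm_index (fst p)) (snd p))"
  (is "continuous_map _ _ ?\<kappa>")
  unfolding earring_space_def
proof (rule continuous_map_into_wedge)
  show "sphere_base \<in> topspace (nsphere k)" by (simp add: sphere_base_in)
  show "?\<kappa> p \<in> wedge_carrier (\<lambda>_. nsphere k) (\<lambda>_. sphere_base)" if "p \<in> topspace (top_of_set (harm_set \<times> usphere k))" for p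
    using that by (auto intro!: wedge_inj_in_carrier)
  fix j :: nat
  let ?g = "\<lambda>i x. if i = j then x else sphere_base"
  have "continuous_map (top_of_set (harm_set \<times> usphere k)) (nsphere k) (\<lambda>p. if fst p = 0 then sphere_base else ?g (harm_index (fst p)) (snd p))"
  proof (rule continuous_map_harm_family)
    show "continuous_map (top_of_set (usphere k)) (nsphere k) (?g i)" for i
      by (cases "i = j") (auto simp: nsphere_eq sphere_base_in)
    show "null_family UNIV (nsphere k) sphere_base (\<lambda>_. usphere k) ?g"
      unfolding null_family_def
    proof (intro allI impI)
      fix V :: "(nat \<Rightarrow> real) set" assume "sphere_base \<in> V"
      then have "{i \<in> UNIV. \<not> ?g i ` usphere k \<subseteq> V} \<subseteq> {j}" by auto
      then show "finite {i \<in> UNIV. \<not> ?g i ` usphere k \<subseteq> V}" using finite_subset by blast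
    qed
  qed (simp add: sphere_base_in)
  then show "continuous_map (top_of_set (harm_set \<times> usphere k)) (nsphere k) (\<lambda>p. wedge_retract (\<lambda>_. sphere_base) j (?\<kappa> p))"
    by (rule continuous_map_top_of_set_cong) (auto simp: wedge_inj_def)
qed

text \<open>A null sequence of based spheres amounts to a map \<open>F\<close> on the earring,
  nullness giving continuity at the wedge point. There the hypothesis contracts it.\<close>

lemma earring_null:
  assumes conn: "is_singleton (based_htpy_classes (earring_space k) None A a)" and a: "a \<in> topspace A"
    and G: "continuous_map (top_of_set (harm_set \<times> usphere k)) A G"
    and G0: "\<And>x. x \<in> usphere k \<Longrightarrow> G (0, x) = a"
    and Gb: "\<And>u. u \<in> harm_set \<Longrightarrow> G (u, sphere_base) = a"
  shows "fam_htp (harm_set \<times> usphere k) A a G (\<lambda>_. a)"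
proof -
  define F where "F y = (case y of None \<Rightarrow> a | Some (j, x) \<Rightarrow> G (1 / real (Suc j), x))" for y
  let ?b = "\<lambda>_::nat. sphere_base"
  have Finj: "F (wedge_inj ?b j x) = G (1 / real (Suc j), x)" for j x
    using Gb[OF in_harm(2)[of j]] by (simp add: F_def wedge_inj_def)
  have "continuous_map (earring_space k) A F"
    unfolding continuous_map_def
  proof (intro conjI allI impI)
    have GA: "G p \<in> topspace A" if "p \<in> harm_set \<times> usphere k" for p
      using continuous_map_image_subset_topspace[OF G] that by auto
    show "F \<in> topspace (earring_space k) \<rightarrow> topspace A"
      using a GA by (auto simp: F_def earring_space_def wedge_carrier_def simp del: of_nat_Suc)
    fix V assume V: "openin A V"
    let ?U = "{y \<in> wedge_carrier (\<lambda>_. nsphere k) ?b. F y \<in> V}"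
    have eq: "{x \<in> topspace (nsphere k). wedge_inj ?b j x \<in> ?U} = {x \<in> usphere k. G (1 / real (Suc j), x) \<in> V}" for j
      using wedge_inj_in_carrier[of _ "\<lambda>_. nsphere k" j ?b] Finj by auto
    have "continuous_map (nsphere k) A (\<lambda>x. G (1 / real (Suc j), x))" for j
      unfolding nsphere_eq by (rule continuous_map_compose_on[OF G]) (auto intro!: continuous_on_Pair continuous_on_id continuous_on_const simp del: of_nat_Suc)
    then have op: "openin (nsphere k) {x \<in> usphere k. G (1 / real (Suc j), x) \<in> V}" for j
      using V by (simp add: continuous_map_def)
    have fin: "finite {j. \<not> wedge_inj ?b j ` topspace (nsphere k) \<subseteq> ?U}" if "None \<in> ?U"
    proof -
      have "a \<in> V" using that by (simp add: F_def)
      then have "finite {i \<in> UNIV. \<not> (\<lambda>x. G (1 / real (Suc i), x)) ` usphere k \<subseteq> V}"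
        using harm_family_null[OF G compact_usphere G0] V unfolding null_family_def by blast
      moreover have "wedge_inj ?b j ` topspace (nsphere k) \<subseteq> ?U" if "(\<lambda>x. G (1 / real (Suc j), x)) ` usphere k \<subseteq> V" for j
        using that wedge_inj_in_carrier[of _ "\<lambda>_. nsphere k" j ?b] Finj by auto
      ultimately show ?thesis by (elim finite_subset[rotated]) auto
    qed
    have "openin (earring_space k) ?U"
      unfolding earring_space_def openin_shrinking_wedge eq using op fin by auto
    then show "openin (earring_space k) {x \<in> topspace (earring_space k). F x \<in> V}"
      by (simp add: earring_space_def)
  qed
  then have "homotopic_with (\<lambda>h. h None = a) (earring_space k) A F (\<lambda>_. a)"
    using a by (intro based_classes_singletonD[OF conn]) (auto simp: F_def)
  then have "homotopic_with (\<lambda>h. \<forall>p\<in>harm_set \<times> usphere k. fst p = 0 \<longrightarrow> h p = a) (top_of_set (harm_set \<times> usphere k)) A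
    (F \<circ> (\<lambda>p. if fst p = 0 then None else wedge_inj ?b (harm_index (fst p)) (snd p)))
    ((\<lambda>_. a) \<circ> (\<lambda>p. if fst p = 0 then None else wedge_inj ?b (harm_index (fst p)) (snd p)))"
    by (rule homotopic_with_compose_continuous_map_right[OF _ continuous_map_to_earring]) auto
  then obtain h where h: "continuous_map (top_of_set ({0..1::real} \<times> (harm_set \<times> usphere k))) A h"
    "\<forall>p\<in>harm_set \<times> usphere k. h (0, p) = (F \<circ> (\<lambda>p. if fst p = 0 then None else wedge_inj ?b (harm_index (fst p)) (snd p))) p"
    "\<forall>p\<in>harm_set \<times> usphere k. h (1, p) = a" "\<forall>s\<in>{0..1}. \<forall>p\<in>harm_set \<times> usphere k. fst p = 0 \<longrightarrow> h (s, p) = a"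
    unfolding fam_htp_def[symmetric] fam_htp_iff by auto
  show ?thesis
  proof (rule fam_htpI[OF h(1)])
    fix p assume p: "p \<in> harm_set \<times> usphere k"
    show "h (0, p) = G p"
    proof (cases "fst p = 0")
      case True
      then have "h (0, p) = a" using h(4) p by auto
      moreover have "G p = a" using True p G0[of "snd p"] by (metis mem_Times_iff prod.collapse)
      ultimately show ?thesis by simp
    next
      case False
      then obtain i where i: "fst p = 1 / real (Suc i)" using p by (auto elim!: harm_cases)
      have "h (0, p) = F (wedge_inj ?b (harm_index (fst p)) (snd p))" using bspec[OF h(2) p] False by simp
      then have "h (0, p) = F (wedge_inj ?b i (snd p))" unfolding i harm_index_inverse .
      then show ?thesis using Finj i by (cases p) auto
    qed
  qed (use h in auto)
qed

section \<open>Null sequences of spheres without base point condition\<close>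

definition enorm :: "nat \<Rightarrow> (nat \<Rightarrow> real) \<Rightarrow> real" where
  "enorm k x = sqrt (\<Sum>i\<le>k. (x i)\<^sup>2)"

definition enormalize :: "nat \<Rightarrow> (nat \<Rightarrow> real) \<Rightarrow> nat \<Rightarrow> real" where
  "enormalize k x = (\<lambda>i. x i / enorm k x)"

lemma continuous_on_enorm: "continuous_on S (enorm k)"
  unfolding enorm_def by (intro continuous_intros continuous_on_coord)

lemma enorm_pos: "i \<le> k \<Longrightarrow> x i \<noteq> 0 \<Longrightarrow> 0 < enorm k x"
  unfolding enorm_def real_sqrt_gt_0_iff by (rule sum_pos2[of _ i]) auto

lemma enorm_usphere: "x \<in> usphere k \<Longrightarrow> enorm k x = 1"
  by (simp add: enorm_def usphere_def)

lemma enormalize_in: "0 < enorm k x \<Longrightarrow> (\<And>i. i > k \<Longrightarrow> x i = 0) \<Longrightarrow> enormalize k x \<in> usphere k"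
proof -
  assume a: "0 < enorm k x" "\<And>i. i > k \<Longrightarrow> x i = 0"
  have "(\<Sum>i\<le>k. (x i)\<^sup>2) = (enorm k x)\<^sup>2" by (simp add: enorm_def sum_nonneg)
  then have "(\<Sum>i\<le>k. (x i / enorm k x)\<^sup>2) = 1"
    using a by (simp add: power_divide flip: sum_divide_distrib)
  then show ?thesis using a by (simp add: usphere_def enormalize_def)
qed

lemma enormalize_usphere: "x \<in> usphere k \<Longrightarrow> enormalize k x = x"
  by (simp add: enormalize_def enorm_usphere)

lemma continuous_on_enormalize:
  assumes "\<And>x. x \<in> S \<Longrightarrow> enorm k x \<noteq> 0" shows "continuous_on S (enormalize k)"
  unfolding enormalize_def
  by (rule continuous_on_coordinatewise_then_product)
     (use assms in \<open>auto intro!: continuous_intros continuous_on_coord continuous_on_enorm\<close>)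

text \<open>At \<open>s = 1\<close> the factor vanishes exactly on the cap
  \<open>x 0 \<ge> 1/3\<close>, since 3/4 * (1 + 1/3) = 1. For \<open>s\<close> in the unit interval
  it is at least 1/4 on the equator \<open>x 0 = 0\<close>, so the vector to be normalised is never
  zero.\<close>

definition cap_shrink :: "real \<Rightarrow> (nat \<Rightarrow> real) \<Rightarrow> real" where
  "cap_shrink s x = max 0 (1 - 3/4 * s * (1 + x 0))"

definition cap_vec :: "real \<Rightarrow> (nat \<Rightarrow> real) \<Rightarrow> nat \<Rightarrow> real" where
  "cap_vec s x = (\<lambda>i. if i = 0 then x 0 else cap_shrink s x * x i)"

lemma cap_vec_enorm:
  assumes "x \<in> usphere k" "0 \<le> s" "s \<le> 1" shows "0 < enorm k (cap_vec s x)"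
proof (cases "x 0 = 0")
  case True
  have "\<exists>i\<le>k. x i \<noteq> 0"
  proof (rule ccontr)
    assume "\<not> (\<exists>i\<le>k. x i \<noteq> 0)"
    then have "(\<Sum>i\<le>k. (x i)\<^sup>2) = 0" by (intro sum.neutral) auto
    then show False using assms(1) by (simp add: usphere_def)
  qed
  then obtain i where i: "i \<le> k" "x i \<noteq> 0" by blast
  then have "i \<noteq> 0" using True by metis
  moreover have "cap_shrink s x > 0" using assms True by (simp add: cap_shrink_def)
  ultimately show ?thesis using i by (intro enorm_pos[of i]) (auto simp: cap_vec_def)
qed (auto intro!: enorm_pos[of 0] simp: cap_vec_def)

lemma cap_vec_in:
  assumes "x \<in> usphere k" "0 \<le> s" "s \<le> 1" shows "enormalize k (cap_vec s x) \<in> usphere k"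
  using assms by (intro enormalize_in cap_vec_enorm) (auto simp: cap_vec_def usphere_def)

lemma cap_vec_0:
  assumes "x \<in> usphere k" shows "enormalize k (cap_vec 0 x) = x"
proof -
  have "cap_vec 0 x = x" by (auto simp: cap_vec_def cap_shrink_def)
  then show ?thesis using assms by (simp add: enormalize_usphere)
qed

lemma cap_vec_1:
  assumes "x 0 \<ge> 1/3" shows "enormalize k (cap_vec 1 x) = sphere_base"
proof -
  have *: "cap_vec 1 x = (\<lambda>i. if i = 0 then x 0 else 0)"
    using assms by (auto simp: cap_vec_def cap_shrink_def)
  have "enorm k (\<lambda>i. if i = 0 then x 0 else 0) = x 0"
  proof -
    have "(\<Sum>i\<le>k. (if i = 0 then x 0 else 0)\<^sup>2) = (\<Sum>i\<in>{..k}. if i = 0 then (x 0)\<^sup>2 else 0)" by (intro sum.cong) auto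
    then show ?thesis using assms by (simp add: enorm_def)
  qed
  then show ?thesis using assms unfolding * by (auto simp: enormalize_def sphere_base_def)
qed

lemma continuous_on_cap:
  assumes "continuous_on S \<sigma>" "continuous_on S \<xi>"
    and "\<And>p. p \<in> S \<Longrightarrow> \<xi> p \<in> usphere k \<and> 0 \<le> \<sigma> p \<and> \<sigma> p \<le> 1"
  shows "continuous_on S (\<lambda>p. enormalize k (cap_vec (\<sigma> p) (\<xi> p)))"
proof (rule continuous_on_compose2[OF continuous_on_enormalize[where S="{x. enorm k x \<noteq> 0}"]])
  have coord: "continuous_on S (\<lambda>p. \<xi> p i)" for i
    by (rule continuous_on_product_then_coordinatewise[OF assms(2)])
  have "continuous_on S (\<lambda>p. cap_vec (\<sigma> p) (\<xi> p) i)" for i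
    unfolding cap_vec_def cap_shrink_def using assms(1) coord
    by (cases "i = 0") (auto intro!: continuous_intros)
  then show "continuous_on S (\<lambda>p. cap_vec (\<sigma> p) (\<xi> p))"
    by (rule continuous_on_coordinatewise_then_product)
  show "(\<lambda>p. cap_vec (\<sigma> p) (\<xi> p)) ` S \<subseteq> {x. enorm k x \<noteq> 0}"
    using assms(3) cap_vec_enorm by (fastforce simp: less_le)
qed auto

text \<open>A family of unbased spheres is made based by pushing the sphere off a cap around the base point
  and running along a path on that cap.\<close>

lemma sphere_family_null:
  assumes conn0: "is_singleton (based_htpy_classes harmonic_space 0 A a)"
    and conn: "is_singleton (based_htpy_classes (earring_space k) None A a)" and a: "a \<in> topspace A"
    and G: "continuous_map (top_of_set (harm_set \<times> usphere k)) A G"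
    and G0: "\<And>x. x \<in> usphere k \<Longrightarrow> G (0, x) = a"
  shows "fam_htp (harm_set \<times> usphere k) A a G (\<lambda>_. a)"
proof -
  let ?D = "harm_set \<times> usphere k"
  let ?st = "\<lambda>s x. enormalize k (cap_vec s x)"
  define G1 where "G1 p = G (fst p, ?st 1 (snd p))" for p
  have h1: "fam_htp ?D A a G G1"
  proof (rule fam_htpI[where h="\<lambda>q. G (fst (snd q), ?st (fst q) (snd (snd q)))"])
    show "continuous_map (top_of_set ({0..1::real} \<times> ?D)) A (\<lambda>q. G (fst (snd q), ?st (fst q) (snd (snd q))))"
      by (rule continuous_map_compose_on[OF G])
         (auto intro!: continuous_on_Pair continuous_on_cap continuous_on_fst continuous_on_snd continuous_on_id cap_vec_in)
  qed (auto simp: G1_def cap_vec_0 intro!: G0 cap_vec_in)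
  have contG1: "continuous_map (top_of_set ?D) A G1"
    unfolding G1_def
    by (rule continuous_map_compose_on[OF G])
       (auto intro!: continuous_on_Pair continuous_on_cap continuous_on_fst continuous_on_snd continuous_on_id continuous_on_const cap_vec_in)
  have "continuous_map (top_of_set harm_set) A (\<lambda>u. G (u, sphere_base))"
    by (rule continuous_map_compose_on[OF G]) (auto intro!: continuous_intros sphere_base_in)
  then obtain P where P: "continuous_map (top_of_set ({0..1::real} \<times> harm_set)) A P"
    "\<And>u. P (0, u) = G (u, sphere_base)" "\<And>u. P (1, u) = a" "\<And>t. 0 \<le> t \<Longrightarrow> t \<le> 1 \<Longrightarrow> P (t, 0) = a"
    using harmonic_null_path[OF conn0 a, of "\<lambda>u. G (u, sphere_base)"] G0[OF sphere_base_in] by auto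
  \<comment> \<open>On the cap \<open>G1\<close> depends on the index only, so a path can be
    inserted there. The factor 3/2 is the inverse of 1 - 1/3: at the base point, where coordinate 0
    equals 1, the path has been followed up to time \<open>s\<close>.\<close>
  define G2 where "G2 s p = (if snd p 0 \<le> 1/3 then G1 p else P (s * (snd p 0 - 1/3) * 3/2, fst p))" for s and p :: "real \<times> (nat \<Rightarrow> real)"
  have x0: "snd p 0 \<le> 1" if "p \<in> ?D" for p using usphere_coord_le[of "snd p" k 0] that by auto
  have tm: "0 \<le> s * (snd p 0 - 1/3) * 3/2 \<and> s * (snd p 0 - 1/3) * 3/2 \<le> 1" if "p \<in> ?D" "1/3 \<le> snd p 0" "0 \<le> s" "s \<le> 1" for p s
  proof -
    have "s * (snd p 0 - 1/3) \<le> 1 * (2/3)" using that x0[OF that(1)] by (intro mult_mono) auto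
    moreover have "0 \<le> s * (snd p 0 - 1/3)" using that by (intro mult_nonneg_nonneg) auto
    ultimately show ?thesis by linarith
  qed
  have G1cap: "G1 p = G (fst p, sphere_base)" if "1/3 \<le> snd p 0" for p
    using that by (simp add: G1_def cap_vec_1)
  have cont2: "continuous_map (top_of_set ({0..1::real} \<times> ?D)) A (\<lambda>q. G2 (fst q) (snd q))"
    unfolding G2_def
  proof (rule continuous_map_cases_on)
    show c: "continuous_on ({0..1::real} \<times> ?D) (\<lambda>q. snd (snd q) 0)"
      by (rule continuous_on_product_then_coordinatewise) (intro continuous_intros)
    show "continuous_map (top_of_set {q \<in> {0..1::real} \<times> ?D. snd (snd q) 0 \<le> 1/3}) A (\<lambda>q. G1 (snd q))"
      by (rule continuous_map_compose_on[OF contG1]) (auto intro!: continuous_intros)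
    show "continuous_map (top_of_set {q \<in> {0..1::real} \<times> ?D. 1/3 \<le> snd (snd q) 0}) A (\<lambda>q. P (fst q * (snd (snd q) 0 - 1/3) * 3/2, fst (snd q)))"
    proof (rule continuous_map_compose_on[OF P(1)])
      show "continuous_on {q \<in> {0..1::real} \<times> ?D. 1/3 \<le> snd (snd q) 0} (\<lambda>q. (fst q * (snd (snd q) 0 - 1/3) * 3/2, fst (snd q)))"
        by (intro continuous_intros continuous_on_subset[OF c]) auto
      show "(fst q * (snd (snd q) 0 - 1/3) * 3/2, fst (snd q)) \<in> {0..1} \<times> harm_set" if "q \<in> {q \<in> {0..1::real} \<times> ?D. 1/3 \<le> snd (snd q) 0}" for q
        using tm[of "snd q" "fst q"] that by auto
    qed
    fix q assume "q \<in> {0..1::real} \<times> ?D" and q: "snd (snd q) 0 = 1/3"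
    then show "G1 (snd q) = P (fst q * (snd (snd q) 0 - 1/3) * 3/2, fst (snd q))"
      using G1cap[of "snd q"] unfolding q by (simp add: P(2))
  qed (rule continuous_on_const)
  have h2: "fam_htp ?D A a G1 (G2 1)"
  proof (rule fam_htpI[OF cont2])
    show "G2 (fst (0, p)) (snd (0, p)) = G1 p" if "p \<in> ?D" for p
      by (simp add: G2_def P(2) G1cap)
    fix s :: real and p :: "real \<times> (nat \<Rightarrow> real)" assume s: "0 \<le> s" "s \<le> 1" and p: "p \<in> ?D" "fst p = 0"
    show "G2 (fst (s, p)) (snd (s, p)) = a"
      using tm[OF p(1) _ s] p P(4) G0 cap_vec_in[of "snd p" k 1] by (auto simp: G2_def G1_def)
  qed auto
  have "fam_htp ?D A a (G2 1) (\<lambda>_. a)"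
  proof (rule earring_null[OF conn a])
    have "continuous_map (top_of_set ?D) A (\<lambda>p. G2 (fst (1::real, p)) (snd (1::real, p)))"
      by (rule continuous_map_compose_on[OF cont2]) (auto intro!: continuous_intros)
    then show "continuous_map (top_of_set ?D) A (G2 1)" by simp
    show "G2 1 (0, x) = a" if x: "x \<in> usphere k" for x
      using tm[of "(0,x)" 1] x P(4) G0 cap_vec_in[of x k 1] by (auto simp: G2_def G1_def)
    show "G2 1 (u, sphere_base) = a" if "u \<in> harm_set" for u
      by (simp add: G2_def sphere_base_def P(3))
  qed
  then show ?thesis by (rule fam_htp_trans[OF h1 fam_htp_trans[OF h2]])
qed

section \<open>Extending null sequences from the boundary of a box to the box\<close>

primrec supn :: "nat \<Rightarrow> (nat \<Rightarrow> real) \<Rightarrow> real" where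
  "supn 0 w = \<bar>w 0\<bar>"
| "supn (Suc k) w = max (supn k w) \<bar>w (Suc k)\<bar>"

lemma supn_le_iff: "supn k w \<le> c \<longleftrightarrow> (\<forall>i\<le>k. \<bar>w i\<bar> \<le> c)"
  by (induction k) (auto simp: le_Suc_eq)

lemma supn_attained: "\<exists>i\<le>k. supn k w = \<bar>w i\<bar>"
proof (induction k)
  case (Suc k)
  then show ?case by (auto simp: max_def intro: le_SucI)
qed simp

lemma supn_ge: "i \<le> k \<Longrightarrow> \<bar>w i\<bar> \<le> supn k w"
  using supn_le_iff[of k w "supn k w"] by simp

lemma supn_nonneg: "0 \<le> supn k w"
  using supn_attained[of k w] by auto

lemma supn_scale: "supn k (\<lambda>i. c * w i) = \<bar>c\<bar> * supn k w"
  by (induction k) (auto simp: abs_mult max_mult_distrib_left)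

lemma continuous_on_supn: "continuous_on S (supn k)"
proof (induction k)
  case 0
  have "continuous_on S (\<lambda>w. \<bar>w 0\<bar>)" by (intro continuous_intros continuous_on_coord)
  then show ?case by (simp cong: continuous_on_cong_simp)
next
  case (Suc k)
  have "continuous_on S (\<lambda>w. max (supn k w) \<bar>w (Suc k)\<bar>)" by (intro continuous_intros continuous_on_coord Suc)
  then show ?case by (simp cong: continuous_on_cong_simp)
qed

text \<open>There are \<open>k + 1\<close> coordinates, so the boundary is a
  \<open>k\<close>-sphere; in a prism over a \<open>k\<close>-cell one of them is time.\<close>

definition bbox :: "nat \<Rightarrow> (nat \<Rightarrow> real) set" where
  "bbox k = {w. (\<forall>i\<le>k. \<bar>w i\<bar> \<le> 1) \<and> (\<forall>i>k. w i = 0)}"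

definition bbox_bd :: "nat \<Rightarrow> (nat \<Rightarrow> real) set" where
  "bbox_bd k = {w \<in> bbox k. \<exists>i\<le>k. \<bar>w i\<bar> = 1}"

lemma bbox_bd_iff: "w \<in> bbox_bd k \<longleftrightarrow> supn k w = 1 \<and> (\<forall>i>k. w i = 0)"
proof
  assume w: "w \<in> bbox_bd k"
  then have "supn k w \<le> 1" by (simp add: bbox_bd_def bbox_def supn_le_iff)
  moreover have "1 \<le> supn k w" using w supn_ge[of _ k w] by (fastforce simp: bbox_bd_def)
  ultimately show "supn k w = 1 \<and> (\<forall>i>k. w i = 0)" using w by (auto simp: bbox_bd_def bbox_def)
next
  assume w: "supn k w = 1 \<and> (\<forall>i>k. w i = 0)"
  then show "w \<in> bbox_bd k"
    using supn_attained[of k w] supn_ge[of _ k w] by (auto simp: bbox_bd_def bbox_def)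
qed

lemma compact_bbox: "compact (bbox k)"
proof -
  have "bbox k = PiE UNIV (\<lambda>i. if i \<le> k then {-1..1} else {0})"
    by (auto simp: bbox_def PiE_iff abs_le_iff not_le split: if_splits)
      (smt (verit, ccfv_SIG) not_le atLeastAtMost_iff singletonD)+
  moreover have "compactin (product_topology (\<lambda>i::nat. euclideanreal) UNIV) (PiE UNIV (\<lambda>i. if i \<le> k then {-1..1} else {0}))"
    by (subst compactin_PiE) auto
  ultimately show ?thesis
    by (simp add: euclidean_product_topology)
qed

text \<open>The form in which sequential connectedness is applied to cells: it mentions neither the
  harmonic space nor base points on the spheres.\<close>

definition seq_ext :: "nat \<Rightarrow> 'a topology \<Rightarrow> 'a \<Rightarrow> bool" where
  "seq_ext k A a \<longleftrightarrow> (\<forall>g. (\<forall>i::nat. continuous_map (top_of_set (bbox_bd k)) A (g i)) \<longrightarrow>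
     null_family UNIV A a (\<lambda>_. bbox_bd k) g \<longrightarrow>
     (\<exists>G. (\<forall>i. continuous_map (top_of_set (bbox k)) A (G i)) \<and> (\<forall>i. \<forall>w\<in>bbox_bd k. G i w = g i w) \<and>
        null_family UNIV A a (\<lambda>_. bbox k) G))"

lemma seq_extI:
  assumes a: "a \<in> topspace A"
    and ext: "\<And>g. continuous_map (top_of_set (harm_set \<times> bbox_bd k)) A g \<Longrightarrow> (\<And>w. w \<in> bbox_bd k \<Longrightarrow> g (0, w) = a) \<Longrightarrow>
      \<exists>G. continuous_map (top_of_set (harm_set \<times> bbox k)) A G \<and> (\<forall>u\<in>harm_set. \<forall>w\<in>bbox_bd k. G (u, w) = g (u, w)) \<and>
        (\<forall>w\<in>bbox k. G (0, w) = a)"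
  shows "seq_ext k A a"
  unfolding seq_ext_def
proof (intro allI impI)
  fix g :: "nat \<Rightarrow> (nat \<Rightarrow> real) \<Rightarrow> 'a"
  assume g: "\<forall>i::nat. continuous_map (top_of_set (bbox_bd k)) A (g i)" "null_family UNIV A a (\<lambda>_. bbox_bd k) g"
  let ?g = "\<lambda>p. if fst p = 0 then a else g (harm_index (fst p)) (snd p)"
  have "continuous_map (top_of_set (harm_set \<times> bbox_bd k)) A ?g"
    by (rule continuous_map_harm_family[OF _ g(2) a]) (use g in blast)
  from ext[OF this] obtain G where G: "continuous_map (top_of_set (harm_set \<times> bbox k)) A G"
    "\<forall>u\<in>harm_set. \<forall>w\<in>bbox_bd k. G (u, w) = ?g (u, w)" "\<forall>w\<in>bbox k. G (0, w) = a" by auto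
  show "\<exists>G. (\<forall>i. continuous_map (top_of_set (bbox k)) A (G i)) \<and> (\<forall>i. \<forall>w\<in>bbox_bd k. G i w = g i w) \<and>
        null_family UNIV A a (\<lambda>_. bbox k) G"
  proof (intro exI[of _ "\<lambda>i w. G (1 / real (Suc i), w)"] conjI allI ballI)
    show "continuous_map (top_of_set (bbox k)) A (\<lambda>w. G (1 / real (Suc i), w))" for i
      by (rule continuous_map_compose_on[OF G(1)])
         (auto intro!: continuous_on_Pair continuous_on_id continuous_on_const simp del: of_nat_Suc)
    show "G (1 / real (Suc i), w) = g i w" if "w \<in> bbox_bd k" for i w
      using bspec[OF bspec[OF G(2) in_harm(2)[of i]] that] harm_index_inverse[of i] by simp
    show "null_family UNIV A a (\<lambda>_. bbox k) (\<lambda>i w. G (1 / real (Suc i), w))"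
      by (rule harm_family_null[OF G(1) compact_bbox]) (use G(3) in auto)
  qed
qed

text \<open>Radial projection identifies the boundary of the box with the round sphere. The null
  homotopy is spread over the shell of sup norm between 1/2 and 1, from time 1 to time 0, and the
  inner box goes to \<open>a\<close>.\<close>

lemma seq_ext_sphere:
  assumes conn0: "is_singleton (based_htpy_classes harmonic_space 0 A a)"
    and conn: "is_singleton (based_htpy_classes (earring_space k) None A a)" and a: "a \<in> topspace A"
  shows "seq_ext k A a"
proof (rule seq_extI[OF a])
  fix g assume g: "continuous_map (top_of_set (harm_set \<times> bbox_bd k)) A g" "\<And>w. w \<in> bbox_bd k \<Longrightarrow> g (0, w) = a"
  have supos: "0 < supn k x" if "x \<in> usphere k" for x
  proof (rule ccontr)
    assume "\<not> 0 < supn k x"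
    then have "\<forall>i\<le>k. x i = 0" using supn_ge[of _ k x] by fastforce
    then show False using that by (simp add: usphere_def)
  qed
  have bd: "(\<lambda>i. x i / supn k x) \<in> bbox_bd k" if "x \<in> usphere k" for x
    using that supos[OF that] supn_scale[of k "1 / supn k x" x] by (auto simp: bbox_bd_iff usphere_def)
  define \<Gamma> where "\<Gamma> p = g (fst p, \<lambda>i. snd p i / supn k (snd p))" for p
  have "continuous_map (top_of_set (harm_set \<times> usphere k)) A \<Gamma>"
    unfolding \<Gamma>_def
  proof (rule continuous_map_compose_on[OF g(1)])
    have "continuous_on (harm_set \<times> usphere k) (\<lambda>p. supn k (snd p))"
      by (rule continuous_on_compose2[OF continuous_on_supn[of UNIV]]) (auto intro!: continuous_intros)
    moreover have "supn k (snd p) \<noteq> 0" if "p \<in> harm_set \<times> usphere k" for p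
      using that supos[of "snd p"] by auto
    ultimately show "continuous_on (harm_set \<times> usphere k) (\<lambda>p. (fst p, \<lambda>i. snd p i / supn k (snd p)))"
      by (intro continuous_on_Pair continuous_on_coordinatewise_then_product continuous_intros) auto
    show "(fst p, \<lambda>i. snd p i / supn k (snd p)) \<in> harm_set \<times> bbox_bd k" if "p \<in> harm_set \<times> usphere k" for p
      using that bd[of "snd p"] by auto
  qed
  moreover have "\<Gamma> (0, x) = a" if "x \<in> usphere k" for x using g(2)[OF bd[OF that]] by (simp add: \<Gamma>_def)
  ultimately have "fam_htp (harm_set \<times> usphere k) A a \<Gamma> (\<lambda>_. a)"
    by (rule sphere_family_null[OF conn0 conn a])
  then obtain N where N: "continuous_map (top_of_set ({0..1::real} \<times> (harm_set \<times> usphere k))) A N"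
   "\<And>p. p\<in>harm_set \<times> usphere k \<Longrightarrow> N (0, p) = \<Gamma> p" "\<And>p. p\<in>harm_set \<times> usphere k \<Longrightarrow> N (1, p) = a"
   "\<And>s p. s\<in>{0..1} \<Longrightarrow> p\<in>harm_set \<times> usphere k \<Longrightarrow> fst p = 0 \<Longrightarrow> N (s, p) = a"
    unfolding fam_htp_iff by blast
  define G where "G p = (if 1/2 \<le> supn k (snd p) then N (2 - 2 * supn k (snd p), fst p, enormalize k (snd p)) else a)" for p
  have enp: "0 < enorm k w" if "0 < supn k w" for w
  proof -
    obtain i where "i \<le> k" "supn k w = \<bar>w i\<bar>" using supn_attained by blast
    then show ?thesis using that by (intro enorm_pos[of i]) auto
  qed
  have en: "enormalize k w \<in> usphere k" if "w \<in> bbox k" "1/2 \<le> supn k w" for w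
    using that enp[of w] by (intro enormalize_in) (auto simp: bbox_def)
  have tm: "2 - 2 * supn k w \<in> {0..1}" if "w \<in> bbox k" "1/2 \<le> supn k w" for w
    using that supn_le_iff[of k w 1] by (auto simp: bbox_def)
  show "\<exists>G. continuous_map (top_of_set (harm_set \<times> bbox k)) A G \<and> (\<forall>u\<in>harm_set. \<forall>w\<in>bbox_bd k. G (u, w) = g (u, w)) \<and>
        (\<forall>w\<in>bbox k. G (0, w) = a)"
  proof (intro exI[of _ G] conjI ballI)
    have sc: "continuous_on S (\<lambda>p. supn k (snd p))" for S :: "(real \<times> (nat \<Rightarrow> real)) set"
      by (rule continuous_on_compose2[OF continuous_on_supn[of UNIV]]) (auto intro!: continuous_intros)
    show "continuous_map (top_of_set (harm_set \<times> bbox k)) A G"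
      unfolding G_def
    proof (rule continuous_map_cases_on)
      let ?S = "{x \<in> harm_set \<times> bbox k. 1/2 \<le> supn k (snd x)}"
      show "continuous_map (top_of_set ?S) A (\<lambda>p. N (2 - 2 * supn k (snd p), fst p, enormalize k (snd p)))"
      proof (rule continuous_map_compose_on[OF N(1)])
        have "continuous_on ?S (\<lambda>p. enormalize k (snd p))"
        proof (rule continuous_on_compose2[OF continuous_on_enormalize[of "{w. enorm k w \<noteq> 0}"]])
          show "snd ` ?S \<subseteq> {w. enorm k w \<noteq> 0}"
          proof
            fix w assume "w \<in> snd ` ?S"
            then have "0 < supn k w" by auto
            then show "w \<in> {w. enorm k w \<noteq> 0}" using enp[of w] by simp
          qed
        qed (auto intro: continuous_on_snd continuous_on_id)
        moreover have "continuous_on ?S (\<lambda>p. 2 - 2 * supn k (snd p))"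
          by (intro continuous_intros sc)
        moreover have "continuous_on ?S fst" by (intro continuous_intros)
        ultimately show "continuous_on ?S (\<lambda>p. (2 - 2 * supn k (snd p), fst p, enormalize k (snd p)))"
          by (intro continuous_on_Pair)
        show "(2 - 2 * supn k (snd p), fst p, enormalize k (snd p)) \<in> {0..1} \<times> harm_set \<times> usphere k" if "p \<in> ?S" for p
          using that tm[of "snd p"] en[of "snd p"] by auto
      qed
      show "N (2 - 2 * supn k (snd p), fst p, enormalize k (snd p)) = a" if "p \<in> harm_set \<times> bbox k" "1/2 = supn k (snd p)" for p
        using that en[of "snd p"] N(3)[of "(fst p, enormalize k (snd p))"] by (auto simp flip: that(2))
    qed (use a in \<open>auto intro: sc continuous_on_const\<close>)
    show "G (u, w) = g (u, w)" if u: "u \<in> harm_set" and w: "w \<in> bbox_bd k" for u w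
    proof -
      have s1: "supn k w = 1" using w by (simp add: bbox_bd_iff)
      have e: "enormalize k w \<in> usphere k" using w s1 by (intro en) (auto simp: bbox_bd_def)
      have ep: "0 < enorm k w" using enp s1 by simp
      have "supn k (enormalize k w) = 1 / enorm k w"
        using supn_scale[of k "1 / enorm k w" w] s1 ep by (simp add: enormalize_def)
      then have "(\<lambda>i. enormalize k w i / supn k (enormalize k w)) = w"
        using ep by (simp add: enormalize_def)
      then have "\<Gamma> (u, enormalize k w) = g (u, w)" by (simp add: \<Gamma>_def)
      then show ?thesis using N(2)[of "(u, enormalize k w)"] u e s1 by (simp add: G_def)
    qed
    show "G (0, w) = a" if "w \<in> bbox k" for w
      using that en[of w] tm[of w] by (auto simp: G_def intro!: N(4))
  qed
qed

text \<open>The boundary consists of two points. Both are joined to \<open>a\<close>, and the two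
  paths meet in the middle of the interval.\<close>

lemma seq_ext_0:
  assumes conn0: "is_singleton (based_htpy_classes harmonic_space 0 A a)" and a: "a \<in> topspace A"
  shows "seq_ext 0 A a"
proof (rule seq_extI[OF a])
  fix g assume g: "continuous_map (top_of_set (harm_set \<times> bbox_bd 0)) A g" "\<And>w. w \<in> bbox_bd 0 \<Longrightarrow> g (0, w) = a"
  define pt :: "real \<Rightarrow> nat \<Rightarrow> real" where "pt c = (\<lambda>i. if i = 0 then c else 0)" for c
  have ptbd: "pt 1 \<in> bbox_bd 0" "pt (-1) \<in> bbox_bd 0" by (auto simp: bbox_bd_def bbox_def pt_def)
  have "\<exists>P. continuous_map (top_of_set ({0..1::real} \<times> harm_set)) A P \<and>
    (\<forall>u. P (0, u) = g (u, pt c)) \<and> (\<forall>u. P (1, u) = a) \<and> (\<forall>t\<in>{0..1}. P (t, 0) = a)" if "pt c \<in> bbox_bd 0" for c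
  proof (rule harmonic_null_path[OF conn0 a])
    show "continuous_map (top_of_set harm_set) A (\<lambda>u. g (u, pt c))"
      by (rule continuous_map_compose_on[OF g(1)]) (use that in \<open>auto intro!: continuous_intros\<close>)
  qed (rule g(2)[OF that])
  then obtain P Q where P: "continuous_map (top_of_set ({0..1::real} \<times> harm_set)) A P"
    "\<And>u. P (0, u) = g (u, pt (-1))" "\<And>u. P (1, u) = a" "\<And>t. t\<in>{0..1} \<Longrightarrow> P (t, 0) = a"
    and Q: "continuous_map (top_of_set ({0..1::real} \<times> harm_set)) A Q"
    "\<And>u. Q (0, u) = g (u, pt 1)" "\<And>u. Q (1, u) = a" "\<And>t. t\<in>{0..1} \<Longrightarrow> Q (t, 0) = a"
    using ptbd by (metis (no_types, lifting))
  define G where "G p = (if snd p 0 \<le> 0 then P (1 + snd p 0, fst p) else Q (1 - snd p 0, fst p))" for p :: "real \<times> (nat \<Rightarrow> real)"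
  show "\<exists>G. continuous_map (top_of_set (harm_set \<times> bbox 0)) A G \<and> (\<forall>u\<in>harm_set. \<forall>w\<in>bbox_bd 0. G (u, w) = g (u, w)) \<and>
        (\<forall>w\<in>bbox 0. G (0, w) = a)"
  proof (intro exI[of _ G] conjI ballI)
    show "continuous_map (top_of_set (harm_set \<times> bbox 0)) A G"
      unfolding G_def
    proof (rule continuous_map_cases_on)
      show "continuous_map (top_of_set {x \<in> harm_set \<times> bbox 0. snd x 0 \<le> 0}) A (\<lambda>p. P (1 + snd p 0, fst p))"
        by (rule continuous_map_compose_on[OF P(1)]) (intro continuous_intros, auto simp: bbox_def abs_le_iff)
      show "continuous_map (top_of_set {x \<in> harm_set \<times> bbox 0. 0 \<le> snd x 0}) A (\<lambda>p. Q (1 - snd p 0, fst p))"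
        by (rule continuous_map_compose_on[OF Q(1)]) (intro continuous_intros, auto simp: bbox_def abs_le_iff)
      show "P (1 + snd p 0, fst p) = Q (1 - snd p 0, fst p)" if "snd p 0 = 0" for p
        unfolding that by (simp add: P(3) Q(3))
    qed (intro continuous_intros)+
    show "G (u, w) = g (u, w)" if u: "u \<in> harm_set" and w: "w \<in> bbox_bd 0" for u w
    proof -
      have "w = pt 1 \<and> w 0 = 1 \<or> w = pt (-1) \<and> w 0 = -1"
        using w by (auto simp: bbox_bd_def bbox_def pt_def fun_eq_iff abs_if split: if_splits)
      then show ?thesis using P(2) Q(2) by (auto simp: G_def)
    qed
    show "G (0, w) = a" if "w \<in> bbox 0" for w
      using that P(4)[of "1 + w 0"] Q(4)[of "1 - w 0"] by (auto simp: G_def bbox_def abs_le_iff)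
  qed
qed

lemma seq_connected_ext:
  assumes "seq_connected m A a" "a \<in> topspace A" "k \<le> m"
  shows "seq_ext k A a"
proof (cases "k = 0")
  case True
  then show ?thesis using assms seq_ext_0 by (auto simp: seq_connected_def)
next
  case False
  then have "is_singleton (based_htpy_classes (earring_space k) None A a)"
    using assms by (simp add: seq_connected_def)
  then show ?thesis using assms by (intro seq_ext_sphere) (auto simp: seq_connected_def)
qed

lemma seq_ext_charts:
  fixes \<xi> :: "'e \<Rightarrow> 'b::topological_space \<Rightarrow> nat \<Rightarrow> real"
  assumes ext: "seq_ext k A a" and a: "a \<in> topspace A" and J: "countable J"
    and xi: "\<And>e. e \<in> J \<Longrightarrow> continuous_on (D e) (\<xi> e)" "\<And>e p. e \<in> J \<Longrightarrow> p \<in> D e \<Longrightarrow> \<xi> e p \<in> bbox k"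
    and chi: "\<And>e. e \<in> J \<Longrightarrow> continuous_on (bbox_bd k) (ch e)" "\<And>e w. e \<in> J \<Longrightarrow> w \<in> bbox_bd k \<Longrightarrow> ch e w \<in> B e"
    and B: "\<And>e p. e \<in> J \<Longrightarrow> p \<in> B e \<Longrightarrow> \<xi> e p \<in> bbox_bd k \<and> ch e (\<xi> e p) = p"
    and b: "\<And>e. e \<in> J \<Longrightarrow> continuous_map (top_of_set (B e)) A (b e)" and null: "null_family J A a B b"
  shows "\<exists>G. (\<forall>e\<in>J. continuous_map (top_of_set (D e)) A (G e)) \<and> (\<forall>e\<in>J. \<forall>p\<in>B e. G e p = b e p) \<and> null_family J A a D G"
proof -
  obtain \<nu> :: "'e \<Rightarrow> nat" where nu: "inj_on \<nu> J" using J by (auto simp: countable_def)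
  define g where "g i = (if i \<in> \<nu> ` J then b (inv_into J \<nu> i) \<circ> ch (inv_into J \<nu> i) else (\<lambda>_. a))" for i
  have inv: "inv_into J \<nu> (\<nu> e) = e" if "e \<in> J" for e using nu that by simp
  have gn: "g (\<nu> e) w = b e (ch e w)" if "e \<in> J" for e w using that inv by (simp add: g_def)
  have "continuous_map (top_of_set (bbox_bd k)) A (g i)" for i
  proof (cases "i \<in> \<nu> ` J")
    case True
    then obtain e where e: "e \<in> J" "i = \<nu> e" by auto
    have "continuous_map (top_of_set (bbox_bd k)) A (\<lambda>w. b e (ch e w))"
      by (rule continuous_map_compose_on[OF b[OF e(1)] chi(1)[OF e(1)] chi(2)[OF e(1)]])
    then show ?thesis by (rule continuous_map_top_of_set_cong) (simp add: e gn)
  qed (use a in \<open>auto simp: g_def\<close>)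
  moreover have "null_family UNIV A a (\<lambda>_. bbox_bd k) g"
    unfolding null_family_def
  proof (intro allI impI)
    fix V assume V: "openin A V" "a \<in> V"
    have "finite (\<nu> ` {e\<in>J. \<not> b e ` B e \<subseteq> V})" using null V by (simp add: null_family_def)
    moreover have "{i \<in> UNIV. \<not> g i ` bbox_bd k \<subseteq> V} \<subseteq> \<nu> ` {e\<in>J. \<not> b e ` B e \<subseteq> V}"
    proof
      fix i assume "i \<in> {i \<in> UNIV. \<not> g i ` bbox_bd k \<subseteq> V}"
      then obtain w where w: "w \<in> bbox_bd k" "g i w \<notin> V" by auto
      then have "i \<in> \<nu> ` J" using V by (auto simp: g_def split: if_splits)
      then obtain e where e: "e \<in> J" "i = \<nu> e" by auto
      then have "b e (ch e w) \<notin> V" using w gn by simp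
      then show "i \<in> \<nu> ` {e\<in>J. \<not> b e ` B e \<subseteq> V}" using e chi(2)[OF e(1) w(1)] by blast
    qed
    ultimately show "finite {i \<in> UNIV. \<not> g i ` bbox_bd k \<subseteq> V}" using finite_subset by blast
  qed
  ultimately obtain G where G: "\<And>i. continuous_map (top_of_set (bbox k)) A (G i)"
    "\<And>i w. w\<in>bbox_bd k \<Longrightarrow> G i w = g i w" "null_family UNIV A a (\<lambda>_. bbox k) G"
    using ext unfolding seq_ext_def by metis
  show ?thesis
  proof (intro exI[of _ "\<lambda>e p. G (\<nu> e) (\<xi> e p)"] conjI ballI)
    show "continuous_map (top_of_set (D e)) A (\<lambda>p. G (\<nu> e) (\<xi> e p))" if "e \<in> J" for e
      by (rule continuous_map_compose_on[OF G(1) xi(1)[OF that] xi(2)[OF that]])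
    show "G (\<nu> e) (\<xi> e p) = b e p" if "e \<in> J" "p \<in> B e" for e p
      using B[OF that] G(2) gn[OF that(1)] by simp
    show "null_family J A a D (\<lambda>e p. G (\<nu> e) (\<xi> e p))"
      unfolding null_family_def
    proof (intro allI impI)
      fix V assume V: "openin A V" "a \<in> V"
      have "finite {i. \<not> G i ` bbox k \<subseteq> V}" using G(3) V by (simp add: null_family_def)
      then have "finite (inv_into J \<nu> ` {i. \<not> G i ` bbox k \<subseteq> V})" by simp
      moreover have "{e\<in>J. \<not> (\<lambda>p. G (\<nu> e) (\<xi> e p)) ` D e \<subseteq> V} \<subseteq> inv_into J \<nu> ` {i. \<not> G i ` bbox k \<subseteq> V}"
      proof
        fix e assume "e \<in> {e\<in>J. \<not> (\<lambda>p. G (\<nu> e) (\<xi> e p)) ` D e \<subseteq> V}"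
        then have e: "e \<in> J" "\<not> G (\<nu> e) ` bbox k \<subseteq> V" using xi(2) by fastforce+
        then show "e \<in> inv_into J \<nu> ` {i. \<not> G i ` bbox k \<subseteq> V}"
          by (intro image_eqI[of _ _ "\<nu> e"]) (auto simp: inv)
      qed
      ultimately show "finite {e\<in>J. \<not> (\<lambda>p. G (\<nu> e) (\<xi> e p)) ` D e \<subseteq> V}" using finite_subset by blast
    qed
  qed
qed

subsection \<open>Dyadic grids\<close>

text \<open>Counts how often coordinate \<open>i\<close> has been halved when the coordinates are
  halved cyclically, \<open>D\<close> times in total.\<close>

primrec lev :: "nat \<Rightarrow> nat \<Rightarrow> nat \<Rightarrow> nat" where
  "lev n 0 i = 0"
| "lev n (Suc D) i = lev n D i + (if i = D mod n then 1 else 0)"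

definition pw :: "nat \<Rightarrow> nat \<Rightarrow> nat \<Rightarrow> real" where "pw n D i = 2 ^ lev n D i"

definition gfl :: "nat \<Rightarrow> nat \<Rightarrow> (nat \<Rightarrow> real) \<Rightarrow> nat \<Rightarrow> int" where "gfl n D x i = \<lfloor>pw n D i * x i\<rfloor>"

definition gce :: "nat \<Rightarrow> nat \<Rightarrow> (nat \<Rightarrow> real) \<Rightarrow> nat \<Rightarrow> int" where "gce n D x i = \<lceil>pw n D i * x i\<rceil>"

text \<open>The smallest closed face of the depth \<open>D\<close> grid that contains
  \<open>x\<close>: in directions where \<open>x\<close> lies on a grid hyperplane, floor and
  ceiling coincide and the face has no extent.\<close>

definition gcell :: "nat \<Rightarrow> nat \<Rightarrow> (nat \<Rightarrow> real) \<Rightarrow> (nat \<Rightarrow> real) set" where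
  "gcell n D x = {y \<in> ucube n. \<forall>i<n. gfl n D x i \<le> pw n D i * y i \<and> pw n D i * y i \<le> gce n D x i}"

text \<open>The union of the closed grid boxes containing \<open>x\<close>. Ceiling - 1 and floor +
  1 give the intervals on both sides if \<open>x\<close> lies on a hyperplane, and otherwise the
  single interval around it.\<close>

definition gstar :: "nat \<Rightarrow> nat \<Rightarrow> (nat \<Rightarrow> real) \<Rightarrow> (nat \<Rightarrow> real) set" where
  "gstar n D x = {y \<in> ucube n. \<forall>i<n. gce n D x i - 1 \<le> pw n D i * y i \<and> pw n D i * y i \<le> gfl n D x i + 1}"

definition gfree :: "nat \<Rightarrow> nat \<Rightarrow> (nat \<Rightarrow> real) \<Rightarrow> nat set" where
  "gfree n D x = {i. i < n \<and> pw n D i * x i \<notin> \<int>}"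

lemma lev_mono: "D \<le> D' \<Longrightarrow> lev n D i \<le> lev n D' i"
  by (induction D' rule: dec_induct) auto

lemma lev_block: "r \<le> n \<Longrightarrow> lev n (n * m + r) i = lev n (n * m) i + (if i < r then 1 else 0)"
proof (induction r)
  case (Suc r)
  then have "(n * m + r) mod n = r" by simp
  then show ?case using Suc by auto
qed simp

lemma lev_mult: "i < n \<Longrightarrow> lev n (n * m) i = m"
proof (induction m)
  case (Suc m)
  then show ?case using lev_block[of n n m i] by (simp add: algebra_simps)
qed simp

lemma pw_pos [simp]: "0 < pw n D i" by (simp add: pw_def)

lemma pw_nonzero [simp]: "pw n D i \<noteq> 0" by (simp add: pw_def)

lemma pw_split:
  assumes "D \<le> D'" obtains k :: nat where "pw n D' i = 2 ^ k * pw n D i"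
  using lev_mono[OF assms, of n i] that[of "lev n D' i - lev n D i"]
  by (simp add: pw_def flip: power_add)

lemma gfl_le: "real_of_int (gfl n D x i) \<le> pw n D i * x i"
  by (simp add: gfl_def)

lemma gce_ge: "pw n D i * x i \<le> real_of_int (gce n D x i)"
  by (simp add: gce_def)

lemma gstar_subset: "gstar n D x \<subseteq> ucube n" by (auto simp: gstar_def)

lemma gcell_self: "x \<in> ucube n \<Longrightarrow> x \<in> gcell n D x"
  by (simp add: gcell_def gfl_le gce_ge)

lemma gcell_subset_star: "gcell n D x \<subseteq> gstar n D x"
proof
  fix y assume y: "y \<in> gcell n D x"
  have "real_of_int (gce n D x i) - 1 \<le> pw n D i * y i \<and> pw n D i * y i \<le> real_of_int (gfl n D x i) + 1" if "i < n" for i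
  proof -
    have "gce n D x i \<le> gfl n D x i + 1" unfolding gce_def gfl_def by linarith
    then have "real_of_int (gce n D x i) \<le> real_of_int (gfl n D x i) + 1" by linarith
    moreover have "gfl n D x i \<le> pw n D i * y i \<and> pw n D i * y i \<le> gce n D x i" using y that by (simp add: gcell_def)
    ultimately show ?thesis by linarith
  qed
  then show "y \<in> gstar n D x" using y by (simp add: gstar_def gcell_def)
qed

text \<open>Every grid box containing \<open>x\<close> contains the smallest face around
  \<open>x\<close>, hence \<open>y\<close>.\<close>

lemma gstar_gcell_mono:
  assumes "y \<in> gcell n D x" shows "gstar n D x \<subseteq> gstar n D y"
proof
  fix z assume z: "z \<in> gstar n D x"
  have "real_of_int (gce n D y i) - 1 \<le> pw n D i * z i \<and> pw n D i * z i \<le> real_of_int (gfl n D y i) + 1" if "i < n" for i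
  proof -
    have "gfl n D x i \<le> pw n D i * y i \<and> pw n D i * y i \<le> gce n D x i" using assms that by (simp add: gcell_def)
    then have "gfl n D x i \<le> gfl n D y i" "gce n D y i \<le> gce n D x i"
      by (simp_all add: gfl_def[of n D y] gce_def[of n D y] le_floor_iff ceiling_le_iff)
    then have "real_of_int (gfl n D x i) \<le> gfl n D y i" "real_of_int (gce n D y i) \<le> gce n D x i" by linarith+
    moreover have "gce n D x i - 1 \<le> pw n D i * z i \<and> pw n D i * z i \<le> gfl n D x i + 1" using z that by (simp add: gstar_def)
    ultimately show ?thesis by linarith
  qed
  then show "z \<in> gstar n D y" using z by (simp add: gstar_def)
qed

lemma gfl_refine: "pw n D' i = 2 ^ k * pw n D i \<Longrightarrow> 2 ^ k * gfl n D x i \<le> gfl n D' x i"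
proof -
  assume "pw n D' i = 2 ^ k * pw n D i"
  moreover have "2 ^ k * real_of_int (gfl n D x i) \<le> 2 ^ k * (pw n D i * x i)" using gfl_le by simp
  ultimately show ?thesis by (simp add: gfl_def[of n D'] le_floor_iff mult.assoc)
qed

lemma gce_refine: "pw n D' i = 2 ^ k * pw n D i \<Longrightarrow> gce n D' x i \<le> 2 ^ k * gce n D x i"
proof -
  assume "pw n D' i = 2 ^ k * pw n D i"
  moreover have "2 ^ k * (pw n D i * x i) \<le> 2 ^ k * real_of_int (gce n D x i)" using gce_ge by simp
  ultimately show ?thesis by (simp add: gce_def[of n D'] ceiling_le_iff mult.assoc)
qed

lemma gcell_antimono:
  assumes "D \<le> D'" shows "gcell n D' x \<subseteq> gcell n D x"
proof
  fix y assume y: "y \<in> gcell n D' x"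
  have "real_of_int (gfl n D x i) \<le> pw n D i * y i \<and> pw n D i * y i \<le> real_of_int (gce n D x i)" if "i < n" for i
  proof -
    obtain k where k: "pw n D' i = 2 ^ k * pw n D i" using pw_split[OF assms] by blast
    have "gfl n D' x i \<le> 2 ^ k * (pw n D i * y i) \<and> 2 ^ k * (pw n D i * y i) \<le> gce n D' x i"
      using y that unfolding mult.assoc[symmetric] k[symmetric] by (simp add: gcell_def)
    moreover have "2 ^ k * real_of_int (gfl n D x i) \<le> gfl n D' x i" "gce n D' x i \<le> 2 ^ k * real_of_int (gce n D x i)"
    proof -
      have "real_of_int (2 ^ k * gfl n D x i) \<le> real_of_int (gfl n D' x i)"
        "real_of_int (gce n D' x i) \<le> real_of_int (2 ^ k * gce n D x i)"
        using gfl_refine[OF k, of x] gce_refine[OF k, of x] by (simp_all only: of_int_le_iff)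
      then show "2 ^ k * real_of_int (gfl n D x i) \<le> gfl n D' x i" "gce n D' x i \<le> 2 ^ k * real_of_int (gce n D x i)"
        by simp_all
    qed
    ultimately have "2 ^ k * real_of_int (gfl n D x i) \<le> 2 ^ k * (pw n D i * y i)"
      "2 ^ k * (pw n D i * y i) \<le> 2 ^ k * real_of_int (gce n D x i)" by linarith+
    then show ?thesis by simp
  qed
  then show "y \<in> gcell n D x" using y by (simp add: gcell_def)
qed

lemma gstar_antimono:
  assumes "D \<le> D'" shows "gstar n D' x \<subseteq> gstar n D x"
proof
  fix y assume y: "y \<in> gstar n D' x"
  have "real_of_int (gce n D x i) - 1 \<le> pw n D i * y i \<and> pw n D i * y i \<le> real_of_int (gfl n D x i) + 1" if "i < n" for i
  proof -
    obtain k where k: "pw n D' i = 2 ^ k * pw n D i" using pw_split[OF assms] by blast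
    have *: "gce n D' x i - 1 \<le> 2 ^ k * (pw n D i * y i) \<and> 2 ^ k * (pw n D i * y i) \<le> gfl n D' x i + 1"
      using y that unfolding mult.assoc[symmetric] k[symmetric] by (simp add: gstar_def)
    have "real_of_int (gce n D x i - 1) < pw n D i * x i" unfolding gce_def by linarith
    then have "2 ^ k * real_of_int (gce n D x i - 1) < pw n D' i * x i" by (simp add: k mult.assoc)
    then have "real_of_int (2 ^ k * (gce n D x i - 1)) < real_of_int (gce n D' x i)" using gce_ge[of n D' i x] by simp
    \<comment> \<open>The strict inequality between integers yields the 1 that the definition of
      \<open>gstar\<close> subtracts.\<close>
    then have "2 ^ k * (gce n D x i - 1) \<le> gce n D' x i - 1" by linarith
    then have 1: "real_of_int (2 ^ k * (gce n D x i - 1)) \<le> real_of_int (gce n D' x i - 1)" by (simp only: of_int_le_iff)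
    have "pw n D i * x i < real_of_int (gfl n D x i + 1)" unfolding gfl_def by linarith
    then have "pw n D' i * x i < 2 ^ k * real_of_int (gfl n D x i + 1)" by (simp add: k mult.assoc)
    then have "real_of_int (gfl n D' x i) < real_of_int (2 ^ k * (gfl n D x i + 1))" using gfl_le[of n D' x i] by simp
    then have "gfl n D' x i + 1 \<le> 2 ^ k * (gfl n D x i + 1)" by linarith
    then have 2: "real_of_int (gfl n D' x i + 1) \<le> real_of_int (2 ^ k * (gfl n D x i + 1))" by (simp only: of_int_le_iff)
    have "2 ^ k * (real_of_int (gce n D x i) - 1) \<le> 2 ^ k * (pw n D i * y i)"
      "2 ^ k * (pw n D i * y i) \<le> 2 ^ k * (real_of_int (gfl n D x i) + 1)"
    proof -
      have "2 ^ k * (real_of_int (gce n D x i) - 1) \<le> real_of_int (gce n D' x i) - 1"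
        "real_of_int (gfl n D' x i) + 1 \<le> 2 ^ k * (real_of_int (gfl n D x i) + 1)" using 1 2 by simp_all
      then show "2 ^ k * (real_of_int (gce n D x i) - 1) \<le> 2 ^ k * (pw n D i * y i)"
        "2 ^ k * (pw n D i * y i) \<le> 2 ^ k * (real_of_int (gfl n D x i) + 1)" using * by linarith+
    qed
    then show ?thesis by simp
  qed
  then show "y \<in> gstar n D x" using y by (simp add: gstar_def)
qed

text \<open>Although the ambient product is infinite, the first \<open>n\<close> coordinates
  suffice: the others vanish on the cube, so a sequence of counterexamples would converge to
  \<open>x\<close> inside the closed complement of \<open>U\<close>.\<close>

lemma ucube_basis:
  assumes U: "openin (top_of_set (ucube n)) U" and x: "x \<in> U"
  obtains \<epsilon> where "\<epsilon> > 0" "\<And>y. y \<in> ucube n \<Longrightarrow> (\<And>i. i < n \<Longrightarrow> \<bar>y i - x i\<bar> \<le> \<epsilon>) \<Longrightarrow> y \<in> U"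
proof -
  have xu: "x \<in> ucube n" using U x openin_imp_subset by blast
  have "\<exists>m. \<forall>y\<in>ucube n. (\<forall>i<n. \<bar>y i - x i\<bar> \<le> 1 / real (Suc m)) \<longrightarrow> y \<in> U"
  proof (rule ccontr)
    assume "\<not> ?thesis"
    then have "\<forall>m. \<exists>y. y \<in> ucube n - U \<and> (\<forall>i<n. \<bar>y i - x i\<bar> \<le> 1 / real (Suc m))" by blast
    then obtain y where y: "\<And>m. y m \<in> ucube n - U" "\<And>m i. i < n \<Longrightarrow> \<bar>y m i - x i\<bar> \<le> 1 / real (Suc m)" by metis
    have "(\<lambda>m. y m i) \<longlonglongrightarrow> x i" for i
    proof (cases "i < n")
      case True
      have "(\<lambda>m. y m i - x i) \<longlonglongrightarrow> 0"
      proof (rule Lim_null_comparison)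
        show "\<forall>\<^sub>F m in sequentially. norm (y m i - x i) \<le> 1 / real (Suc m)" using y(2)[OF True] by simp
        show "(\<lambda>m. 1 / real (Suc m)) \<longlonglongrightarrow> 0" by (rule LIMSEQ_Suc) (rule lim_1_over_n)
      qed
      then show ?thesis by (simp add: LIM_zero_iff)
    next
      case False
      then have "y m i = x i" for m using y(1)[of m] xu by (auto simp: ucube_def)
      then show ?thesis by simp
    qed
    then have "limitin (product_topology (\<lambda>_. euclideanreal) UNIV) y x sequentially"
      by (simp add: limitin_componentwise)
    then have lim: "y \<longlonglongrightarrow> x" by (simp add: euclidean_product_topology)
    have "closedin (top_of_set (ucube n)) (ucube n - U)" using U by auto
    then have "closed (ucube n - U)" using compact_ucube compact_imp_closed closedin_closed_trans by blast
    then have "x \<in> ucube n - U" using lim y(1) closed_sequentially by blast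
    then show False using x by simp
  qed
  then obtain m where "\<forall>y\<in>ucube n. (\<forall>i<n. \<bar>y i - x i\<bar> \<le> 1 / real (Suc m)) \<longrightarrow> y \<in> U" by blast
  then show thesis by (intro that[of "1 / real (Suc m)"]) auto
qed

lemma gstar_diameter:
  assumes "y \<in> gstar n (n * m) x" "i < n"
  shows "\<bar>y i - x i\<bar> \<le> 1 / 2 ^ m"
proof -
  have p: "pw n (n * m) i = 2 ^ m" using assms(2) by (simp add: pw_def lev_mult)
  have "gce n (n*m) x i - 1 \<le> 2 ^ m * y i" "2 ^ m * y i \<le> gfl n (n*m) x i + 1"
    using assms by (auto simp: gstar_def p)
  moreover have "gfl n (n*m) x i \<le> 2 ^ m * x i" "2 ^ m * x i \<le> gce n (n*m) x i"
    using gfl_le[of n "n*m" x i] gce_ge[of n "n*m" i x] by (simp_all add: p)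
  ultimately have "\<bar>2 ^ m * (y i - x i)\<bar> \<le> 1" by (simp add: abs_le_iff algebra_simps)
  moreover have "\<bar>2 ^ m * (y i - x i)\<bar> = 2 ^ m * \<bar>y i - x i\<bar>" by (simp add: abs_mult)
  ultimately show ?thesis by (simp add: pos_le_divide_eq mult.commute)
qed

section \<open>The cell complex of a Whitney decomposition\<close>

locale cube_cells =
  fixes n :: nat and U :: "(nat \<Rightarrow> real) set"
  assumes U: "openin (top_of_set (ucube n)) U"
begin

text \<open>\<open>lam x\<close> is the largest depth of a Whitney box (a maximal dyadic box inside \<open>U\<close>) containing \<open>x\<close>.
  With cells taken at this depth, the boundary of a cell consists of cells of lower dimension even
  where boxes of different sizes meet.\<close>

definition lam :: "(nat \<Rightarrow> real) \<Rightarrow> nat" where "lam x = (LEAST D. gstar n D x \<subseteq> U)"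

definition cel :: "(nat \<Rightarrow> real) \<Rightarrow> (nat \<Rightarrow> real) set" where "cel x = gcell n (lam x) x"

definition fre :: "(nat \<Rightarrow> real) \<Rightarrow> nat set" where "fre x = gfree n (lam x) x"

definition cdim :: "(nat \<Rightarrow> real) \<Rightarrow> nat" where "cdim x = card (fre x)"

definition skel :: "nat \<Rightarrow> (nat \<Rightarrow> real) set" where "skel d = {x \<in> U. cdim x < d}"

definition Out :: "(nat \<Rightarrow> real) set" where "Out = ucube n - U"

lemma U_subset: "U \<subseteq> ucube n" using U openin_imp_subset by blast

lemma star_ex: assumes "x \<in> U" shows "\<exists>D. gstar n D x \<subseteq> U"
proof -
  obtain \<epsilon> where e: "\<epsilon> > 0" "\<And>y. y \<in> ucube n \<Longrightarrow> (\<And>i. i < n \<Longrightarrow> \<bar>y i - x i\<bar> \<le> \<epsilon>) \<Longrightarrow> y \<in> U"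
    using ucube_basis[OF U assms] by blast
  obtain m where "(1/2) ^ m < \<epsilon>" using real_arch_pow_inv[OF e(1), of "1/2"] by auto
  then have m: "1 / 2 ^ m < \<epsilon>" by (simp add: power_divide)
  have "gstar n (n * m) x \<subseteq> U"
  proof
    fix y assume y: "y \<in> gstar n (n * m) x"
    then show "y \<in> U"
      using gstar_diameter[OF y] m gstar_subset by (intro e(2)) fastforce+
  qed
  then show ?thesis by blast
qed

lemma star_lam: "x \<in> U \<Longrightarrow> gstar n (lam x) x \<subseteq> U"
  unfolding lam_def using star_ex by (rule LeastI_ex)

lemma lam_le: "gstar n D x \<subseteq> U \<Longrightarrow> lam x \<le> D"
  unfolding lam_def by (rule Least_le)

lemma cel_subset: "x \<in> U \<Longrightarrow> cel x \<subseteq> U"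
  unfolding cel_def using star_lam gcell_subset_star by blast

lemma cel_self: "x \<in> U \<Longrightarrow> x \<in> cel x"
  unfolding cel_def using gcell_self U_subset by blast

text \<open>If \<open>lam y\<close> were smaller, then at depth \<open>lam y\<close> the star of
  \<open>x\<close> would lie in that of \<open>y\<close>, hence in \<open>U\<close>, against the
  minimality of \<open>lam x\<close>.\<close>

lemma lam_cel:
  assumes "x \<in> U" "y \<in> cel x" shows "lam x \<le> lam y"
proof (rule ccontr)
  assume "\<not> lam x \<le> lam y"
  then have "y \<in> gcell n (lam y) x" using assms(2) gcell_antimono[of "lam y" "lam x" n x] by (auto simp: cel_def)
  then have "gstar n (lam y) x \<subseteq> U" using gstar_gcell_mono star_lam assms cel_subset by blast
  then show False using lam_le \<open>\<not> lam x \<le> lam y\<close> by blast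
qed

text \<open>\<open>N\<close> is the open star of \<open>x\<close> at depth \<open>lam x\<close>. For
  \<open>y\<close> in it, \<open>x\<close> lies in the closed cell of \<open>y\<close> at that
  depth, so passing from \<open>x\<close> to \<open>y\<close> the depth cannot grow and the
  dimension cannot drop. This gives local finiteness and closed skeleta.\<close>

lemma nbhd:
  assumes x: "x \<in> U"
  obtains N where "openin (top_of_set (ucube n)) N" "x \<in> N" "N \<subseteq> U" "\<And>y. y \<in> N \<Longrightarrow> lam y \<le> lam x"
    "\<And>y. y \<in> N \<Longrightarrow> cdim x \<le> cdim y"
proof -
  let ?D = "lam x"
  define N where "N = {y \<in> ucube n. \<forall>i<n. gce n ?D x i - 1 < pw n ?D i * y i \<and> pw n ?D i * y i < gfl n ?D x i + 1}"
  have "N = ucube n \<inter> (\<Inter>i\<in>{..<n}. {y. gce n ?D x i - 1 < pw n ?D i * y i \<and> pw n ?D i * y i < gfl n ?D x i + 1})"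
    by (auto simp: N_def)
  moreover have "open (\<Inter>i\<in>{..<n}. {y. gce n ?D x i - 1 < pw n ?D i * y i \<and> pw n ?D i * y i < gfl n ?D x i + 1})"
    by (intro open_INT ballI open_Collect_conj open_Collect_less continuous_intros continuous_on_coord) auto
  ultimately have op: "openin (top_of_set (ucube n)) N" by (auto intro: openin_open_Int)
  have xN: "x \<in> N"
  proof -
    have "gce n ?D x i - 1 < pw n ?D i * x i \<and> pw n ?D i * x i < gfl n ?D x i + 1" for i
      unfolding gce_def gfl_def by (intro conjI) linarith+
    then show ?thesis using x U_subset by (auto simp: N_def)
  qed
  have fl: "gfl n ?D y i \<le> gfl n ?D x i" "gce n ?D x i \<le> gce n ?D y i" if "y \<in> N" "i < n" for y i
  proof -
    have *: "gce n ?D x i - 1 < pw n ?D i * y i" "pw n ?D i * y i < gfl n ?D x i + 1" using that by (auto simp: N_def)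
    have "real_of_int (gfl n ?D y i) < real_of_int (gfl n ?D x i + 1)" using *(2) gfl_le[of n ?D y i] by simp
    then show "gfl n ?D y i \<le> gfl n ?D x i" by linarith
    have "real_of_int (gce n ?D x i - 1) < real_of_int (gce n ?D y i)" using *(1) gce_ge[of n ?D i y] by simp
    then show "gce n ?D x i \<le> gce n ?D y i" by linarith
  qed
  have sub: "gstar n ?D y \<subseteq> U" if "y \<in> N" for y
  proof -
    have "x \<in> gcell n ?D y"
    proof -
      have "real_of_int (gfl n ?D y i) \<le> pw n ?D i * x i \<and> pw n ?D i * x i \<le> real_of_int (gce n ?D y i)" if "i < n" for i
        using fl[OF \<open>y \<in> N\<close> that] gfl_le[of n ?D x i] gce_ge[of n ?D i x] by linarith
      then show ?thesis using x U_subset by (auto simp: gcell_def)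
    qed
    then show ?thesis using gstar_gcell_mono star_lam[OF x] by blast
  qed
  have ly: "lam y \<le> ?D" if "y \<in> N" for y using lam_le[OF sub[OF that]] .
  have "cdim x \<le> cdim y" if y: "y \<in> N" for y
    unfolding cdim_def
  proof (rule card_mono)
    show "finite (fre y)" by (auto simp: fre_def gfree_def)
    show "fre x \<subseteq> fre y"
    proof
      fix i assume i: "i \<in> fre x"
      then have i: "i < n" "pw n ?D i * x i \<notin> \<int>" by (auto simp: fre_def gfree_def)
      then have "gce n ?D x i = gfl n ?D x i + 1" unfolding gce_def gfl_def by (simp add: ceiling_altdef)
          (metis Ints_of_int)
      then have *: "gfl n ?D x i < pw n ?D i * y i" "pw n ?D i * y i < gfl n ?D x i + 1"
        using y i by (auto simp: N_def)
      \<comment> \<open>The depth of \<open>y\<close> may be smaller, but hyperplanes of a coarser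
        grid belong to the grid at depth \<open>lam x\<close>, and none of those passes strictly
        between the floor and the ceiling of \<open>x\<close>.\<close>
      have "pw n (lam y) i * y i \<notin> \<int>"
      proof
        assume z: "pw n (lam y) i * y i \<in> \<int>"
        obtain k where k: "pw n ?D i = 2 ^ k * pw n (lam y) i" using pw_split[OF ly[OF y]] by blast
        have "2 ^ k * (pw n (lam y) i * y i) \<in> \<int>" by (rule Ints_mult[OF _ z]) simp
        then have "pw n ?D i * y i \<in> \<int>" by (simp add: k mult.assoc)
        then obtain q where "pw n ?D i * y i = of_int q" by (auto elim: Ints_cases)
        then have "gfl n ?D x i < q" "q < gfl n ?D x i + 1" using * by linarith+
        then show False by linarith
      qed
      then show "i \<in> fre y" using i by (simp add: fre_def gfree_def)
    qed
  qed
  moreover have "N \<subseteq> U"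
  proof
    fix y assume "y \<in> N"
    then have "y \<in> gstar n ?D y" using gcell_self gcell_subset_star N_def by blast
    then show "y \<in> U" using sub \<open>y \<in> N\<close> by blast
  qed
  ultimately show thesis using that op xN ly by blast
qed

lemma gcell_fixed:
  assumes "y \<in> gcell n D x" "i < n" "i \<notin> gfree n D x"
  shows "y i = x i"
proof -
  have "pw n D i * x i \<in> \<int>" using assms by (simp add: gfree_def)
  then have "gfl n D x i = pw n D i * x i" "gce n D x i = pw n D i * x i"
    unfolding gfl_def gce_def by (auto elim: Ints_cases)
  then have "pw n D i * y i = pw n D i * x i" using assms by (force simp: gcell_def)
  then show ?thesis by simp
qed

lemma gfree_ce:
  assumes "i \<in> gfree n D x" shows "gce n D x i = gfl n D x i + 1"
  using assms unfolding gfree_def gce_def gfl_def by (auto simp: ceiling_altdef) (metis Ints_of_int)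

text \<open>In a direction without extent the cell of \<open>x\<close> lies in a grid hyperplane,
  which belongs also to the finer grid used at \<open>y\<close>.\<close>

lemma fre_cel:
  assumes "x \<in> U" "y \<in> cel x" shows "fre y \<subseteq> fre x"
proof
  fix i assume "i \<in> fre y"
  then have i: "i < n" "pw n (lam y) i * y i \<notin> \<int>" by (auto simp: fre_def gfree_def)
  obtain k where k: "pw n (lam y) i = 2 ^ k * pw n (lam x) i" using pw_split[OF lam_cel[OF assms]] by blast
  show "i \<in> fre x"
  proof (rule ccontr)
    assume ni: "i \<notin> fre x"
    then have "y i = x i" using gcell_fixed assms i by (auto simp: cel_def fre_def)
    moreover have "pw n (lam x) i * x i \<in> \<int>" using ni i by (auto simp: fre_def gfree_def)
    ultimately have "2 ^ k * (pw n (lam x) i * y i) \<in> \<int>" by (intro Ints_mult[of "2 ^ k"]) auto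
    then show False using i by (simp add: k mult.assoc)
  qed
qed

lemma fre_cel_end:
  assumes "x \<in> U" "y \<in> cel x" "pw n (lam x) i * y i \<in> \<int>" shows "i \<notin> fre y"
proof -
  obtain k where k: "pw n (lam y) i = 2 ^ k * pw n (lam x) i" using pw_split[OF lam_cel[OF assms(1,2)]] by blast
  have "2 ^ k * (pw n (lam x) i * y i) \<in> \<int>" by (rule Ints_mult[OF _ assms(3)]) simp
  then show ?thesis by (simp add: fre_def gfree_def k mult.assoc)
qed

lemma finite_fre [simp]: "finite (fre x)" by (auto simp: fre_def gfree_def)

lemma cdim_cel: "x \<in> U \<Longrightarrow> y \<in> cel x \<Longrightarrow> cdim y \<le> cdim x"
  unfolding cdim_def by (intro card_mono fre_cel) auto

lemma cdim_cel_end: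
  assumes "x \<in> U" "y \<in> cel x" "i \<in> fre x" "pw n (lam x) i * y i \<in> \<int>" shows "cdim y < cdim x"
  unfolding cdim_def using fre_cel[OF assms(1,2)] fre_cel_end[OF assms(1,2,4)] assms(3)
  by (intro psubset_card_mono) auto

text \<open>In the relative interior floors and ceilings are those of \<open>x\<close>, hence so is
  the star, and the depth cannot grow.\<close>

lemma cel_interior:
  assumes x: "x \<in> U" and y: "y \<in> cel x"
    and int: "\<And>i. i \<in> fre x \<Longrightarrow> gfl n (lam x) x i < pw n (lam x) i * y i \<and> pw n (lam x) i * y i < gce n (lam x) x i"
  shows "cel y = cel x" "cdim y = cdim x"
proof -
  let ?D = "lam x"
  have eq: "gfl n ?D y i = gfl n ?D x i \<and> gce n ?D y i = gce n ?D x i" if "i < n" for i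
  proof (cases "i \<in> fre x")
    case True
    then have "gce n ?D x i = gfl n ?D x i + 1" using gfree_ce by (simp add: fre_def)
    then have "gfl n ?D x i < pw n ?D i * y i" "pw n ?D i * y i < gfl n ?D x i + 1" using int[OF True] by auto
    then have "\<lfloor>pw n ?D i * y i\<rfloor> = gfl n ?D x i" "\<lceil>pw n ?D i * y i\<rceil> = gfl n ?D x i + 1" by linarith+
    then show ?thesis using \<open>gce n ?D x i = gfl n ?D x i + 1\<close> by (simp add: gfl_def[of n ?D y] gce_def[of n ?D y])
  next
    case False
    then have "y i = x i" using gcell_fixed y that by (auto simp: cel_def fre_def)
    then show ?thesis by (simp add: gfl_def gce_def)
  qed
  then have "gstar n ?D y = gstar n ?D x" "gcell n ?D y = gcell n ?D x" by (auto simp: gstar_def gcell_def)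
  then have "lam y \<le> ?D" using star_lam[OF x] by (intro lam_le) simp
  then have l: "lam y = ?D" using lam_cel[OF x y] by simp
  then show "cel y = cel x" using \<open>gcell n ?D y = gcell n ?D x\<close> by (simp add: cel_def)
  have "i \<in> fre y" if i: "i \<in> fre x" for i
  proof -
    have "i < n" using i by (auto simp: fre_def gfree_def)
    moreover have "pw n ?D i * y i \<notin> \<int>"
    proof
      assume "pw n ?D i * y i \<in> \<int>"
      then have "\<lfloor>pw n ?D i * y i\<rfloor> = \<lceil>pw n ?D i * y i\<rceil>" by (auto elim: Ints_cases)
      then have "gfl n ?D x i = gce n ?D x i" using eq[OF \<open>i < n\<close>] by (simp add: gfl_def gce_def)
      then show False using gfree_ce[of i ?D x] i by (simp add: fre_def)
    qed
    ultimately show ?thesis by (simp add: fre_def gfree_def l)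
  qed
  then show "cdim y = cdim x" using fre_cel[OF x y] unfolding cdim_def by (metis subsetI subset_antisym)
qed

lemma cel_end_ex:
  assumes x: "x \<in> U" and y: "y \<in> cel x" and d: "cdim y < cdim x"
  obtains i where "i \<in> fre x" "pw n (lam x) i * y i = gfl n (lam x) x i \<or> pw n (lam x) i * y i = gce n (lam x) x i"
proof (rule ccontr)
  assume "\<not> thesis"
  then have *: "\<And>i. i \<in> fre x \<Longrightarrow> pw n (lam x) i * y i \<noteq> gfl n (lam x) x i \<and> pw n (lam x) i * y i \<noteq> gce n (lam x) x i"
    using that by blast
  have "gfl n (lam x) x i < pw n (lam x) i * y i \<and> pw n (lam x) i * y i < gce n (lam x) x i" if "i \<in> fre x" for i
  proof -
    have "i < n" using that by (auto simp: fre_def gfree_def)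
    then have "gfl n (lam x) x i \<le> pw n (lam x) i * y i" "pw n (lam x) i * y i \<le> gce n (lam x) x i"
      using y by (auto simp: cel_def gcell_def)
    then show ?thesis using *[OF that] by linarith
  qed
  from cel_interior(2)[OF x y this] d show False by simp
qed

text \<open>Distinct cells of equal dimension therefore meet in lower skeleta only, which makes maps
  given cell by cell well defined.\<close>

lemma cel_eq:
  assumes "x \<in> U" "y \<in> cel x" "cdim y = cdim x" shows "cel y = cel x"
proof (rule cel_interior(1)[OF assms(1,2)])
  fix i assume i: "i \<in> fre x"
  then have "i < n" by (auto simp: fre_def gfree_def)
  then have le: "gfl n (lam x) x i \<le> pw n (lam x) i * y i" "pw n (lam x) i * y i \<le> gce n (lam x) x i"
    using assms(2) by (auto simp: cel_def gcell_def)
  have "pw n (lam x) i * y i \<notin> \<int>" using cdim_cel_end[OF assms(1,2) i] assms(3) by auto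
  then show "gfl n (lam x) x i < pw n (lam x) i * y i \<and> pw n (lam x) i * y i < gce n (lam x) x i"
    using le by (metis Ints_of_int order_le_less)
qed

lemma finite_gcells: "finite (gcell n D ` ucube n)"
proof -
  define m :: int where "m = 2 ^ D + 1"
  have levD: "lev n D i \<le> D" for i by (induction D) auto
  let ?P = "PiE {..<n} (\<lambda>_. {0..m})"
  let ?c = "\<lambda>(f, h). {y \<in> ucube n. \<forall>i<n. real_of_int (f i) \<le> pw n D i * y i \<and> pw n D i * y i \<le> real_of_int (h i)}"
  have "gcell n D x \<in> ?c ` (?P \<times> ?P)" if x: "x \<in> ucube n" for x
  proof -
    have b: "0 \<le> gfl n D x i \<and> gfl n D x i \<le> m \<and> 0 \<le> gce n D x i \<and> gce n D x i \<le> m" for i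
    proof -
      have "(2::real) ^ lev n D i \<le> 2 ^ D" using levD by (intro power_increasing) auto
      then have "pw n D i * x i \<le> 2 ^ D * 1" using ucube_coord[OF x, of i] unfolding pw_def by (intro mult_mono) auto
      then have 1: "pw n D i * x i \<le> real_of_int (2 ^ D)" by simp
      have 2: "0 \<le> pw n D i * x i" using ucube_coord[OF x, of i] by (intro mult_nonneg_nonneg) (auto simp: less_imp_le)
      have "gce n D x i \<le> 2 ^ D" unfolding gce_def using 1 by (simp only: ceiling_le_iff)
      moreover have "gfl n D x i \<le> gce n D x i" unfolding gfl_def gce_def by linarith
      moreover have "0 \<le> gfl n D x i" unfolding gfl_def using 2 by simp
      ultimately show ?thesis unfolding m_def by linarith
    qed
    show ?thesis
    proof (rule image_eqI)
      show "gcell n D x = ?c (restrict (gfl n D x) {..<n}, restrict (gce n D x) {..<n})"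
        by (auto simp: gcell_def)
      show "(restrict (gfl n D x) {..<n}, restrict (gce n D x) {..<n}) \<in> ?P \<times> ?P"
        using b by auto
    qed
  qed
  then have "gcell n D ` ucube n \<subseteq> ?c ` (?P \<times> ?P)" by blast
  moreover have "finite (?c ` (?P \<times> ?P))" by (intro finite_imageI finite_cartesian_product finite_PiE) auto
  ultimately show ?thesis by (rule finite_subset)
qed

lemma finite_cels_le: "finite (cel ` {x \<in> U. lam x \<le> D})"
proof -
  have "cel ` {x \<in> U. lam x \<le> D} \<subseteq> (\<Union>k\<le>D. gcell n k ` ucube n)"
    using U_subset by (auto simp: cel_def)
  moreover have "finite (\<Union>k\<le>D. gcell n k ` ucube n)" by (intro finite_UN_I finite_gcells) simp
  ultimately show ?thesis by (rule finite_subset)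
qed

lemma countable_cels: "countable (cel ` U)"
proof -
  have "cel ` U \<subseteq> (\<Union>k. gcell n k ` ucube n)" using U_subset by (auto simp: cel_def)
  moreover have "countable (\<Union>k. gcell n k ` ucube n)" 
    by (rule countable_UN[OF countableI_type countable_finite[OF finite_gcells]])
  ultimately show ?thesis using countable_subset by blast
qed

text \<open>By \<open>lam_cel\<close> a cell that meets \<open>N\<close> has depth at most
  \<open>D\<close> itself, and the grids up to depth \<open>D\<close> have finitely many
  cells.\<close>

lemma finite_cels_meeting_nbhd:
  assumes "\<And>y. y \<in> N \<Longrightarrow> lam y \<le> D"
  shows "finite {e \<in> cel ` U. e \<inter> N \<noteq> {}}"
proof (rule finite_subset[OF _ finite_cels_le[of D]])
  show "{e \<in> cel ` U. e \<inter> N \<noteq> {}} \<subseteq> cel ` {x \<in> U. lam x \<le> D}"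
  proof
    fix e assume "e \<in> {e \<in> cel ` U. e \<inter> N \<noteq> {}}"
    then obtain x y where "x \<in> U" "e = cel x" "y \<in> cel x" "y \<in> N" by auto
    then have "lam x \<le> D" using lam_cel[of x y] assms[of y] by simp
    then show "e \<in> cel ` {x \<in> U. lam x \<le> D}" using \<open>x \<in> U\<close> \<open>e = cel x\<close> by blast
  qed
qed

lemma lam_bounded_on_compact:
  assumes "compact Q" "Q \<subseteq> U" obtains D where "\<And>y. y \<in> Q \<Longrightarrow> lam y \<le> D"
proof -
  have "\<forall>x\<in>U. \<exists>T. open T \<and> x \<in> T \<and> (\<forall>y\<in>T \<inter> ucube n. lam y \<le> lam x)"
  proof
    fix x assume "x \<in> U"
    then obtain N where N: "openin (top_of_set (ucube n)) N" "x \<in> N" "\<And>y. y \<in> N \<Longrightarrow> lam y \<le> lam x" using nbhd by metis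
    then obtain T where "open T" "N = ucube n \<inter> T" by (auto simp: openin_open)
    then show "\<exists>T. open T \<and> x \<in> T \<and> (\<forall>y\<in>T \<inter> ucube n. lam y \<le> lam x)" using N by auto
  qed
  then obtain T where T: "\<And>x. x \<in> U \<Longrightarrow> open (T x) \<and> x \<in> T x \<and> (\<forall>y\<in>T x \<inter> ucube n. lam y \<le> lam x)" by metis
  obtain X where X: "X \<subseteq> Q" "finite X" "Q \<subseteq> (\<Union>x\<in>X. T x)"
  proof (rule compactE_image[OF assms(1), of Q T])
    show "open (T x)" if "x \<in> Q" for x using T assms(2) that by blast
    show "Q \<subseteq> (\<Union>x\<in>Q. T x)" using T assms(2) by blast
  qed blast
  have "lam y \<le> Max (insert 0 (lam ` X))" if y: "y \<in> Q" for y
  proof -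
    obtain x where x: "x \<in> X" "y \<in> T x" using X y by blast
    then have "lam y \<le> lam x" using T[of x] X assms y U_subset by blast
    also have "\<dots> \<le> Max (insert 0 (lam ` X))" using X x by (intro Max_ge) auto
    finally show ?thesis .
  qed
  then show thesis using that by blast
qed

lemma finite_cels_meeting_compact:
  assumes "compact Q" "Q \<subseteq> U" shows "finite {e \<in> cel ` U. e \<inter> Q \<noteq> {}}"
proof -
  obtain D where "\<And>y. y \<in> Q \<Longrightarrow> lam y \<le> D" using lam_bounded_on_compact[OF assms] by blast
  then show ?thesis by (rule finite_cels_meeting_nbhd)
qed

lemma closed_gcell: "closed (gcell n D x)"
proof -
  have "gcell n D x = ucube n \<inter> (\<Inter>i\<in>{..<n}. {y. gfl n D x i \<le> pw n D i * y i \<and> pw n D i * y i \<le> gce n D x i})"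
    by (auto simp: gcell_def)
  moreover have "closed (\<Inter>i\<in>{..<n}. {y. gfl n D x i \<le> pw n D i * y i \<and> pw n D i * y i \<le> gce n D x i})"
    by (intro closed_INT ballI closed_Collect_conj closed_Collect_le continuous_intros continuous_on_coord)
  ultimately show ?thesis using compact_imp_closed[OF compact_ucube[of n]] by auto
qed

text \<open>The cells accumulate at \<open>Out\<close>, which has to be included; inside
  \<open>U\<close> the dimension is lower semicontinuous by \<open>nbhd\<close>.\<close>

lemma closed_skel: "closed (skel d \<union> Out)"
proof -
  have "openin (top_of_set (ucube n)) (ucube n - (skel d \<union> Out))"
  proof (subst openin_subopen, intro ballI)
    fix x assume x: "x \<in> ucube n - (skel d \<union> Out)"
    then have "x \<in> U" "d \<le> cdim x" by (auto simp: skel_def Out_def)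
    then obtain N where "openin (top_of_set (ucube n)) N" "x \<in> N" "N \<subseteq> U" "\<And>y. y \<in> N \<Longrightarrow> cdim x \<le> cdim y" using nbhd by metis
    then show "\<exists>T. openin (top_of_set (ucube n)) T \<and> x \<in> T \<and> T \<subseteq> ucube n - (skel d \<union> Out)"
      using \<open>d \<le> cdim x\<close> U_subset by (intro exI[of _ N]) (fastforce simp: skel_def Out_def)
  qed
  moreover have "skel d \<union> Out \<subseteq> ucube n" using U_subset by (auto simp: skel_def Out_def)
  ultimately have "closedin (top_of_set (ucube n)) (skel d \<union> Out)" by (simp add: closedin_def)
  then show ?thesis using compact_ucube compact_imp_closed closedin_closed_trans by blast
qed

lemma skel_Suc: "skel (Suc d) = skel d \<union> \<Union>(cel ` {x \<in> U. cdim x = d})"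
proof (intro equalityI subsetI)
  fix x assume "x \<in> skel (Suc d)"
  then show "x \<in> skel d \<union> \<Union>(cel ` {x \<in> U. cdim x = d})"
    using cel_self by (auto simp: skel_def less_Suc_eq)
next
  fix x assume "x \<in> skel d \<union> \<Union>(cel ` {x \<in> U. cdim x = d})"
  then show "x \<in> skel (Suc d)"
    using cel_subset cdim_cel by (fastforce simp: skel_def less_Suc_eq_le)
qed

lemma cdim_le: "cdim x \<le> n"
proof -
  have "card (fre x) \<le> card {..<n}" by (rule card_mono) (auto simp: fre_def gfree_def)
  then show ?thesis by (simp add: cdim_def)
qed

end

context cube_cells
begin

subsection \<open>Charts of cells\<close>

text \<open>Affine parametrisation of the cell of \<open>x\<close> by coordinates between -1 and 1
  in the free directions, with inverse \<open>crel\<close>; other entries of \<open>w\<close> are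
  ignored.\<close>

definition cpt :: "(nat \<Rightarrow> real) \<Rightarrow> (nat \<Rightarrow> real) \<Rightarrow> nat \<Rightarrow> real" where
  "cpt x w = (\<lambda>i. if i \<in> fre x then (gfl n (lam x) x i + (1 + w i) / 2) / pw n (lam x) i else x i)"

definition crel :: "(nat \<Rightarrow> real) \<Rightarrow> (nat \<Rightarrow> real) \<Rightarrow> nat \<Rightarrow> real" where
  "crel x y = (\<lambda>i. 2 * (pw n (lam x) i * y i - gfl n (lam x) x i) - 1)"

lemma fre_less: "i \<in> fre x \<Longrightarrow> i < n"
  by (simp add: fre_def gfree_def)

lemma fre_ce: "i \<in> fre x \<Longrightarrow> gce n (lam x) x i = gfl n (lam x) x i + 1"
  by (simp add: fre_def gfree_ce)

lemma cpt_in: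
  assumes x: "x \<in> U" and w: "\<And>i. i \<in> fre x \<Longrightarrow> \<bar>w i\<bar> \<le> 1"
  shows "cpt x w \<in> cel x"
proof -
  have xu: "x \<in> ucube n" using x U_subset by blast
  have val: "pw n (lam x) i * cpt x w i = gfl n (lam x) x i + (1 + w i) / 2" if "i \<in> fre x" for i
    using that by (simp add: cpt_def)
  have rng: "gfl n (lam x) x i \<le> pw n (lam x) i * cpt x w i \<and> pw n (lam x) i * cpt x w i \<le> gce n (lam x) x i" if "i \<in> fre x" for i
    using w[OF that] fre_ce[OF that] val[OF that] by (auto simp: abs_le_iff)
  have "0 \<le> cpt x w i \<and> cpt x w i \<le> 1" if "i \<in> fre x" for i
  proof -
    have "0 \<le> pw n (lam x) i * x i" using ucube_coord[OF xu, of i] by (simp add: less_imp_le)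
    then have 1: "0 \<le> gfl n (lam x) x i" by (simp add: gfl_def)
    have "pw n (lam x) i * x i \<le> real_of_int (2 ^ lev n (lam x) i)"
      using ucube_coord[OF xu, of i] by (simp add: pw_def mult_left_le)
    then have "gce n (lam x) x i \<le> 2 ^ lev n (lam x) i" unfolding gce_def by (simp only: ceiling_le_iff)
    then have "real_of_int (gce n (lam x) x i) \<le> real_of_int (2 ^ lev n (lam x) i)" by (simp only: of_int_le_iff)
    then have "real_of_int (gce n (lam x) x i) \<le> pw n (lam x) i" by (simp add: pw_def)
    then have "pw n (lam x) i * cpt x w i \<le> pw n (lam x) i * 1" "pw n (lam x) i * 0 \<le> pw n (lam x) i * cpt x w i"
      using rng[OF that] 1 by linarith+
    then show ?thesis by (simp only: mult_le_cancel_left_pos[OF pw_pos])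
  qed
  then have "cpt x w \<in> ucube n"
    using xu fre_less by (fastforce simp: ucube_def cpt_def)
  moreover have "gfl n (lam x) x i \<le> pw n (lam x) i * cpt x w i \<and> pw n (lam x) i * cpt x w i \<le> gce n (lam x) x i" for i
    using rng by (cases "i \<in> fre x") (auto simp: cpt_def gfl_le gce_ge)
  ultimately show ?thesis by (simp add: cel_def gcell_def)
qed

lemma cpt_end:
  assumes x: "x \<in> U" and w: "\<And>i. i \<in> fre x \<Longrightarrow> \<bar>w i\<bar> \<le> 1" and i: "i \<in> fre x" "\<bar>w i\<bar> = 1"
  shows "cpt x w \<in> skel (cdim x)"
proof -
  have c: "cpt x w \<in> cel x" using cpt_in[OF x w] .
  have "pw n (lam x) i * cpt x w i = gfl n (lam x) x i + (1 + w i) / 2" using i by (simp add: cpt_def)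
  moreover have "(1 + w i) / 2 = 0 \<or> (1 + w i) / 2 = 1" using i(2) by (auto simp: abs_if split: if_splits)
  ultimately have "pw n (lam x) i * cpt x w i \<in> \<int>" by auto
  then have "cdim (cpt x w) < cdim x" using cdim_cel_end[OF x c i(1)] by blast
  then show ?thesis using c cel_subset[OF x] by (auto simp: skel_def)
qed

lemma crel_bound:
  assumes "y \<in> cel x" "i \<in> fre x" shows "\<bar>crel x y i\<bar> \<le> 1"
proof -
  have "gfl n (lam x) x i \<le> pw n (lam x) i * y i" "pw n (lam x) i * y i \<le> gfl n (lam x) x i + 1"
    using assms fre_less[OF assms(2)] fre_ce[OF assms(2)] by (force simp: cel_def gcell_def)+
  then show ?thesis by (simp add: crel_def abs_le_iff)
qed

lemma cpt_crel:
  assumes "x \<in> U" "y \<in> cel x" and w: "\<And>i. i \<in> fre x \<Longrightarrow> w i = crel x y i"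
  shows "cpt x w = y"
proof
  fix i
  show "cpt x w i = y i"
  proof (cases "i \<in> fre x")
    case True
    then have "(1 + w i) / 2 = pw n (lam x) i * y i - gfl n (lam x) x i" using w[OF True] by (simp add: crel_def)
    then have "gfl n (lam x) x i + (1 + w i) / 2 = pw n (lam x) i * y i" by linarith
    moreover have "cpt x w i = (gfl n (lam x) x i + (1 + w i) / 2) / pw n (lam x) i" using True by (simp add: cpt_def)
    ultimately show ?thesis by (simp only:) simp
  next
    case False
    show ?thesis
    proof (cases "i < n")
      case True
      then show ?thesis using gcell_fixed[of y "lam x" x i] False assms by (simp add: cpt_def cel_def fre_def)
    next
      case F: False
      have "x \<in> ucube n" "y \<in> ucube n" using assms cel_subset U_subset by blast+
      then show ?thesis using F False by (simp add: cpt_def ucube_def)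
    qed
  qed
qed

lemma crel_end:
  assumes "x \<in> U" "y \<in> cel x" "y \<in> skel (cdim x)"
  shows "\<exists>i\<in>fre x. \<bar>crel x y i\<bar> = 1"
proof -
  obtain i where i: "i \<in> fre x" "pw n (lam x) i * y i = gfl n (lam x) x i \<or> pw n (lam x) i * y i = gce n (lam x) x i"
    using cel_end_ex[OF assms(1,2)] assms(3) by (auto simp: skel_def)
  then have "\<bar>crel x y i\<bar> = 1" using fre_ce[OF i(1)] by (auto simp: crel_def)
  then show ?thesis using i by blast
qed

lemma continuous_on_cpt:
  assumes "\<And>i. i \<in> fre x \<Longrightarrow> continuous_on S (\<lambda>p. w p i)"
  shows "continuous_on S (\<lambda>p. cpt x (w p))"
proof (rule continuous_on_coordinatewise_then_product)
  fix i show "continuous_on S (\<lambda>p. cpt x (w p) i)"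
    using assms by (cases "i \<in> fre x") (auto simp: cpt_def intro!: continuous_intros)
qed

text \<open>The boundary of the prism over a cell \<open>e\<close> of dimension \<open>d\<close>:
  since \<open>e\<close> meets \<open>skel d\<close> in its own boundary, the first condition
  describes the sides, the others bottom and top.\<close>

definition cbd :: "(nat \<Rightarrow> real) set \<Rightarrow> nat \<Rightarrow> (real \<times> (nat \<Rightarrow> real)) set" where
  "cbd e d = {p \<in> {0..1} \<times> e. snd p \<in> skel d \<or> fst p = 0 \<or> fst p = 1}"

text \<open>Coordinate 0 of the box is time, the following ones are the free directions of the cell,
  in an arbitrary order \<open>\<psi>\<close>.\<close>

lemma cell_chart:
  assumes x: "x \<in> U"
  shows "\<exists>\<xi> ch. continuous_on ({0..1::real} \<times> cel x) \<xi> \<and> (\<forall>p\<in>{0..1} \<times> cel x. \<xi> p \<in> bbox (cdim x)) \<and>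
    continuous_on (bbox_bd (cdim x)) ch \<and> (\<forall>w\<in>bbox_bd (cdim x). ch w \<in> cbd (cel x) (cdim x)) \<and>
    (\<forall>p\<in>cbd (cel x) (cdim x). \<xi> p \<in> bbox_bd (cdim x) \<and> ch (\<xi> p) = p)"
proof -
  define d where "d = cdim x"
  obtain \<psi> where psi: "bij_betw \<psi> (fre x) {0..<d}"
    using ex_bij_betw_finite_nat[of "fre x"] by (auto simp: d_def cdim_def)
  define \<phi> where "\<phi> = inv_into (fre x) \<psi>"
  have phi: "\<phi> m \<in> fre x" "\<psi> (\<phi> m) = m" if "m < d" for m
    using psi that unfolding \<phi>_def bij_betw_def by (auto simp: inv_into_into f_inv_into_f)
  have psi': "\<psi> i < d" "\<phi> (\<psi> i) = i" if "i \<in> fre x" for i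
    using psi that unfolding \<phi>_def bij_betw_def by auto
  define \<xi> where "\<xi> p = (\<lambda>m. case m of 0 \<Rightarrow> 2 * fst p - 1 | Suc k \<Rightarrow> if k < d then crel x (snd p) (\<phi> k) else 0)"
    for p :: "real \<times> (nat \<Rightarrow> real)"
  define ch where "ch w = ((1 + w 0) / 2, cpt x (\<lambda>i. w (Suc (\<psi> i))))" for w :: "nat \<Rightarrow> real"
  have xi_in: "\<xi> p \<in> bbox d" if "p \<in> {0..1} \<times> cel x" for p
  proof -
    have "\<bar>\<xi> p m\<bar> \<le> 1" if "m \<le> d" for m
      using \<open>p \<in> {0..1} \<times> cel x\<close> that crel_bound[OF _ phi(1)] by (cases m) (auto simp: \<xi>_def)
    moreover have "\<xi> p m = 0" if "m > d" for m using that by (cases m) (auto simp: \<xi>_def)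
    ultimately show ?thesis by (simp add: bbox_def)
  qed
  have "continuous_on ({0..1::real} \<times> cel x) \<xi>"
  proof (rule continuous_on_coordinatewise_then_product)
    fix m show "continuous_on ({0..1::real} \<times> cel x) (\<lambda>p. \<xi> p m)"
    proof (cases m)
      case 0
      then show ?thesis unfolding \<xi>_def by (auto intro!: continuous_intros)
    next
      case (Suc k)
      then show ?thesis unfolding \<xi>_def crel_def by (cases "k < d") (auto intro!: continuous_intros)
    qed
  qed
  moreover have "continuous_on (bbox_bd d) ch"
    unfolding ch_def by (intro continuous_on_Pair continuous_on_cpt continuous_intros continuous_on_coord) auto
  moreover have "ch w \<in> cbd (cel x) d" if w: "w \<in> bbox_bd d" for w
  proof -
    have b: "\<bar>w m\<bar> \<le> 1" for m using w by (cases "m \<le> d") (auto simp: bbox_bd_def bbox_def)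
    have c: "cpt x (\<lambda>i. w (Suc (\<psi> i))) \<in> cel x" using b by (intro cpt_in x) auto
    have b0: "0 \<le> (1 + w 0) / 2" "(1 + w 0) / 2 \<le> 1" using b[of 0] by (auto simp: abs_le_iff)
    obtain m where m: "m \<le> d" "\<bar>w m\<bar> = 1" using w by (auto simp: bbox_bd_def)
    show ?thesis
    proof (cases m)
      case 0
      then have "(1 + w 0) / 2 = 0 \<or> (1 + w 0) / 2 = 1" using m by (auto simp: abs_if split: if_splits)
      then show ?thesis using b0 c by (auto simp: cbd_def ch_def)
    next
      case (Suc k)
      then have "k < d" using m by simp
      then have "cpt x (\<lambda>i. w (Suc (\<psi> i))) \<in> skel (cdim x)"
        using b phi m Suc by (intro cpt_end[where i="\<phi> k"] x) auto
      then show ?thesis using b0 c by (auto simp: cbd_def ch_def d_def)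
    qed
  qed
  moreover have "\<xi> p \<in> bbox_bd d \<and> ch (\<xi> p) = p" if p: "p \<in> cbd (cel x) d" for p
  proof
    have pin: "p \<in> {0..1} \<times> cel x" using p by (auto simp: cbd_def)
    have "\<exists>m\<le>d. \<bar>\<xi> p m\<bar> = 1"
    proof (cases "snd p \<in> skel d")
      case True
      then obtain i where i: "i \<in> fre x" "\<bar>crel x (snd p) i\<bar> = 1"
        using crel_end[OF x, of "snd p"] pin by (auto simp: d_def)
      then have "\<bar>\<xi> p (Suc (\<psi> i))\<bar> = 1" using psi' by (simp add: \<xi>_def)
      then show ?thesis using psi'(1)[OF i(1)] by (intro exI[of _ "Suc (\<psi> i)"]) auto
    next
      case False
      then have "\<bar>\<xi> p 0\<bar> = 1" using p by (auto simp: cbd_def \<xi>_def)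
      then show ?thesis by blast
    qed
    then show "\<xi> p \<in> bbox_bd d" using xi_in[OF pin] by (simp add: bbox_bd_def)
    have "cpt x (\<lambda>i. \<xi> p (Suc (\<psi> i))) = snd p"
      using pin psi' by (intro cpt_crel x) (auto simp: \<xi>_def)
    then show "ch (\<xi> p) = p" by (simp add: ch_def \<xi>_def prod_eq_iff)
  qed
  ultimately show ?thesis using xi_in unfolding d_def by blast
qed

text \<open>The boundary of this prism is an n-sphere, beyond the range of the connectedness
  assumption. Instead the prism is retracted to bottom and sides, leaving the top
  unprescribed.\<close>

lemma top_cell_retraction:
  assumes x: "x \<in> U" and d: "cdim x = n" and n: "0 < n"
  shows "\<exists>\<rho>. continuous_on ({0..1::real} \<times> cel x) \<rho> \<and> (\<forall>p\<in>{0..1} \<times> cel x. \<rho> p \<in> cbd (cel x) n) \<and>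
    (\<forall>p\<in>{0..1} \<times> cel x. snd p \<in> skel n \<or> fst p = 0 \<longrightarrow> \<rho> p = p)"
proof -
  have fre: "fre x = {..<n}"
  proof (rule card_subset_eq)
    show "fre x \<subseteq> {..<n}" using fre_less by auto
  qed (use d in \<open>auto simp: cdim_def\<close>)
  define m where "m p = supn (n - 1) (crel x (snd p))" for p :: "real \<times> (nat \<Rightarrow> real)"
  let ?D = "{0..1::real} \<times> cel x"
  have crel: "\<bar>crel x (snd p) i\<bar> \<le> m p" if "i < n" for p :: "real \<times> (nat \<Rightarrow> real)" and i
    using that unfolding m_def by (intro supn_ge) auto
  have m1: "m p \<le> 1" if "p \<in> ?D" for p
    unfolding m_def supn_le_iff using that crel_bound[of "snd p" x] fre n by auto
  have m0: "0 \<le> m p" for p unfolding m_def by (rule supn_nonneg)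
  have crelc: "continuous_on S (\<lambda>p. crel x (snd p))" for S :: "(real \<times> (nat \<Rightarrow> real)) set"
    unfolding crel_def by (intro continuous_on_coordinatewise_then_product continuous_intros)
  have crelci: "continuous_on S (\<lambda>p. crel x (snd p) i)" for S :: "(real \<times> (nat \<Rightarrow> real)) set" and i
    unfolding crel_def by (intro continuous_intros)
  have mc: "continuous_on S m" for S
    unfolding m_def by (rule continuous_on_compose2[OF continuous_on_supn[of UNIV] crelc]) auto
  \<comment> \<open>Points with \<open>(1 + fst p) * m p \<le> 1\<close> go to the bottom while the
    cell is expanded by the factor \<open>1 + fst p\<close>; the others leave through the sides.
    Where the product is 1 the formulas agree.\<close>
  define \<rho> where "\<rho> p = (if (1 + fst p) * m p \<le> 1 then (0, cpt x (\<lambda>i. (1 + fst p) * crel x (snd p) i))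
     else ((1 + fst p) * m p - 1, cpt x (\<lambda>i. crel x (snd p) i / m p)))" for p
  have "continuous_map (top_of_set ?D) euclidean \<rho>"
    unfolding \<rho>_def
  proof (rule continuous_map_cases_on)
    show "continuous_on ?D (\<lambda>p. (1 + fst p) * m p)" by (intro continuous_intros mc)
    have "continuous_on {p \<in> ?D. (1 + fst p) * m p \<le> 1} (\<lambda>p. (0::real, cpt x (\<lambda>i. (1 + fst p) * crel x (snd p) i)))"
      by (intro continuous_on_Pair continuous_on_cpt continuous_intros crelci)
    then show "continuous_map (top_of_set {p \<in> ?D. (1 + fst p) * m p \<le> 1}) euclidean (\<lambda>p. (0::real, cpt x (\<lambda>i. (1 + fst p) * crel x (snd p) i)))"
      by simp
    have "m p \<noteq> 0" if "p \<in> {p \<in> ?D. 1 \<le> (1 + fst p) * m p}" for p using that by auto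
    then have "continuous_on {p \<in> ?D. 1 \<le> (1 + fst p) * m p} (\<lambda>p. ((1 + fst p) * m p - 1, cpt x (\<lambda>i. crel x (snd p) i / m p)))"
      by (intro continuous_on_Pair continuous_on_cpt continuous_intros crelci mc) auto
    then show "continuous_map (top_of_set {p \<in> ?D. 1 \<le> (1 + fst p) * m p}) euclidean (\<lambda>p. ((1 + fst p) * m p - 1, cpt x (\<lambda>i. crel x (snd p) i / m p)))"
      by simp
    show "(0, cpt x (\<lambda>i. (1 + fst p) * crel x (snd p) i)) = ((1 + fst p) * m p - 1, cpt x (\<lambda>i. crel x (snd p) i / m p))"
      if eq: "(1 + fst p) * m p = 1" for p
    proof -
      have "m p \<noteq> 0" using eq by auto
      then have "1 + fst p = 1 / m p" using eq by (simp add: eq_divide_eq)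
      then show ?thesis using eq by (simp add: mult.commute)
    qed
  qed (rule continuous_on_const)
  then have "continuous_on ?D \<rho>" by simp
  moreover have "\<rho> p \<in> cbd (cel x) n" if p: "p \<in> ?D" for p
  proof (cases "(1 + fst p) * m p \<le> 1")
    case True
    have "\<bar>(1 + fst p) * crel x (snd p) i\<bar> \<le> 1" if "i \<in> fre x" for i
    proof -
      have "\<bar>(1 + fst p) * crel x (snd p) i\<bar> = (1 + fst p) * \<bar>crel x (snd p) i\<bar>" using p by (auto simp: abs_mult)
      also have "\<dots> \<le> (1 + fst p) * m p" using p crel that fre by (intro mult_left_mono) auto
      finally show ?thesis using True by simp
    qed
    then have "cpt x (\<lambda>i. (1 + fst p) * crel x (snd p) i) \<in> cel x" by (intro cpt_in x)
    then show ?thesis using True by (simp add: \<rho>_def cbd_def)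
  next
    case False
    then have mp: "0 < m p" using m0[of p] by (cases "m p = 0") auto
    have b: "\<bar>crel x (snd p) i / m p\<bar> \<le> 1" if "i \<in> fre x" for i
      using crel[of i p] that mp fre by auto
    obtain i where i: "i \<le> n - 1" "m p = \<bar>crel x (snd p) i\<bar>" using supn_attained unfolding m_def by blast
    have "cpt x (\<lambda>i. crel x (snd p) i / m p) \<in> skel (cdim x)"
      using i mp n fre b by (intro cpt_end[where i=i] x) auto
    moreover have "cpt x (\<lambda>i. crel x (snd p) i / m p) \<in> cel x" using b by (intro cpt_in x)
    moreover have "(1 + fst p) * m p \<le> 2 * 1" using p m1[OF p] m0[of p] by (intro mult_mono) auto
    ultimately show ?thesis using False d by (simp add: \<rho>_def cbd_def)
  qed
  moreover have "\<rho> p = p" if p: "p \<in> ?D" and q: "snd p \<in> skel n \<or> fst p = 0" for p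
  proof (cases "fst p = 0")
    case True
    then have "\<rho> p = (0, cpt x (\<lambda>i. crel x (snd p) i))" using m1[OF p] by (simp add: \<rho>_def)
    also have "cpt x (\<lambda>i. crel x (snd p) i) = snd p" using p by (intro cpt_crel x) auto
    finally show ?thesis using True by (simp add: prod_eq_iff)
  next
    case False
    then have "snd p \<in> skel (cdim x)" using q d by simp
    then obtain i where "i \<in> fre x" "\<bar>crel x (snd p) i\<bar> = 1" using crel_end[OF x, of "snd p"] p by auto
    then have mp: "m p = 1" using crel[of i p] m1[OF p] fre by auto
    have "0 < fst p" using p False by auto
    then have "\<rho> p = (fst p, cpt x (\<lambda>i. crel x (snd p) i))" by (simp add: \<rho>_def mp)
    also have "cpt x (\<lambda>i. crel x (snd p) i) = snd p" using p by (intro cpt_crel x) auto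
    finally show ?thesis by simp
  qed
  ultimately show ?thesis by blast
qed

subsection \<open>The homotopy on the skeleta\<close>

definition skel_htp :: "'a topology \<Rightarrow> 'a \<Rightarrow> ((nat \<Rightarrow> real) \<Rightarrow> 'a) \<Rightarrow> nat \<Rightarrow> (real \<times> (nat \<Rightarrow> real) \<Rightarrow> 'a) \<Rightarrow> bool" where
  "skel_htp A a g d H \<longleftrightarrow> continuous_map (top_of_set ({0..1} \<times> (skel d \<union> Out))) A H \<and>
     (\<forall>x\<in>skel d \<union> Out. H (0, x) = g x) \<and> (\<forall>t\<in>{0..1}. \<forall>x\<in>Out. H (t, x) = a)"

lemma compact_skel: "compact (skel d \<union> Out)"
proof -
  have "skel d \<union> Out \<subseteq> ucube n" using U_subset by (auto simp: skel_def Out_def)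
  then show ?thesis using closed_skel compact_ucube by (metis compact_Int_closed inf.absorb2 inf.commute)
qed

text \<open>The data on the boundaries of the prisms: \<open>H\<close> on the sides,
  \<open>g\<close> at the bottom, \<open>a\<close> at the top. They form a null family because the
  points over which \<open>H\<close> or \<open>g\<close> leaves a neighbourhood of \<open>a\<close>
  form a compact subset of \<open>U\<close>, which meets finitely many cells.\<close>

lemma skel_htp_boundary:
  assumes g: "continuous_map (top_of_set (ucube n)) A g" "\<And>x. x \<in> Out \<Longrightarrow> g x = a" and a: "a \<in> topspace A"
    and H: "skel_htp A a g d H" and H1: "\<And>x. x \<in> skel d \<Longrightarrow> H (1, x) = a"
    and b: "b = (\<lambda>p. if snd p \<in> skel d then H p else if fst p = 0 then g (snd p) else a)"
  shows "\<And>e. e \<in> cel ` U \<Longrightarrow> continuous_map (top_of_set (cbd e d)) A b"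
    and "null_family (cel ` U) A a (\<lambda>e. cbd e d) (\<lambda>e. b)"
proof -
  note Hc = H[unfolded skel_htp_def]
  fix e assume "e \<in> cel ` U"
  then have e: "e \<subseteq> U" "closed e" using cel_subset closed_gcell by (auto simp: cel_def)
  let ?B = "cbd e d"
  have cf: "continuous_on ?B fst" and cs: "continuous_on ?B snd" by (intro continuous_intros)+
  show "continuous_map (top_of_set ?B) A b"
  proof (rule continuous_map_glue_null_on[where T="{p \<in> ?B. snd p \<in> skel d}" and J="{0,1::real}" and Z="\<lambda>t. {p \<in> ?B. fst p = t}" and C="{}" and a=a])
    have "{p \<in> ?B. snd p \<in> skel d} = ?B \<inter> snd -` (skel d \<union> Out)" using e by (auto simp: cbd_def Out_def)
    then show "closedin (top_of_set ?B) {p \<in> ?B. snd p \<in> skel d}"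
      using continuous_closedin_preimage[OF cs closed_skel] by simp
    show "closedin (top_of_set ?B) {p \<in> ?B. fst p = t}" for t
      by (rule continuous_closedin_preimage_constant[OF cf])
    have "continuous_map (top_of_set {p \<in> ?B. snd p \<in> skel d}) A H"
      by (rule continuous_map_top_of_set_subset[OF conjunct1[OF Hc]]) (auto simp: cbd_def)
    then show "continuous_map (top_of_set {p \<in> ?B. snd p \<in> skel d}) A b"
      by (rule continuous_map_top_of_set_cong) (simp add: b)
    show "continuous_map (top_of_set {p \<in> ?B. fst p = t}) A b" if "t \<in> {0,1}" for t
    proof (cases "t = 0")
      case True
      have "continuous_map (top_of_set {p \<in> ?B. fst p = t}) A (\<lambda>p. g (snd p))"
        by (rule continuous_map_compose_on[OF g(1)]) (use e U_subset in \<open>auto simp: cbd_def intro: continuous_on_snd continuous_on_id\<close>)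
      then show ?thesis
        by (rule continuous_map_top_of_set_cong) (use Hc True in \<open>auto simp: b\<close>)
    next
      case False
      then have t: "t = 1" using that by simp
      show ?thesis
        by (rule continuous_map_top_of_set_cong[where f="\<lambda>_. a"]) (use a H1 t in \<open>auto simp: b\<close>)
    qed
    show "\<exists>N. openin (top_of_set ?B) N \<and> p \<in> N \<and> finite {i \<in> {0, 1}. {p \<in> ?B. fst p = i} \<inter> N \<noteq> {}}"
      if "p \<in> ?B" for p
      using that by (intro exI[of _ ?B]) auto
  qed (use a in \<open>auto simp: cbd_def\<close>)
next
  note Hc = H[unfolded skel_htp_def]
  show "null_family (cel ` U) A a (\<lambda>e. cbd e d) (\<lambda>e. b)"
    unfolding null_family_def
  proof (intro allI impI)
    fix V assume V: "openin A V" "a \<in> V"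
    let ?K = "{0..1} \<times> (skel d \<union> Out)"
    define Q where "Q = snd ` {p \<in> ?K. H p \<notin> V} \<union> {x \<in> ucube n. g x \<notin> V}"
    have "compact (snd ` {p \<in> ?K. H p \<notin> V})"
      by (intro compact_continuous_image continuous_intros compact_outside[OF conjunct1[OF Hc] _ V(1)] compact_Times compact_skel) auto
    then have "compact Q" unfolding Q_def using compact_outside[OF g(1) compact_ucube V(1)] by (rule compact_Un)
    moreover have "Q \<subseteq> U"
    proof -
      have "snd p \<in> U" if "p \<in> ?K" "H p \<notin> V" for p
      proof -
        have "snd p \<notin> Out" using that Hc V(2) by (cases p) auto
        then show ?thesis using that by (auto simp: skel_def)
      qed
      moreover have "x \<in> U" if "x \<in> ucube n" "g x \<notin> V" for x
        using that g(2)[of x] V(2) by (auto simp: Out_def)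
      ultimately show ?thesis unfolding Q_def by blast
    qed
    ultimately have "finite {e \<in> cel ` U. e \<inter> Q \<noteq> {}}" by (rule finite_cels_meeting_compact)
    moreover have "{e \<in> cel ` U. \<not> b ` cbd e d \<subseteq> V} \<subseteq> {e \<in> cel ` U. e \<inter> Q \<noteq> {}}"
    proof
      fix e assume "e \<in> {e \<in> cel ` U. \<not> b ` cbd e d \<subseteq> V}"
      then obtain p where p: "e \<in> cel ` U" "p \<in> cbd e d" "b p \<notin> V" by auto
      have se: "snd p \<in> e" "fst p \<in> {0..1}" using p(2) by (auto simp: cbd_def)
      moreover have "snd p \<in> ucube n" using se p(1) cel_subset U_subset by blast
      ultimately have "snd p \<in> Q"
        using p(3) V(2) unfolding Q_def b by (cases p) (auto split: if_splits intro!: image_eqI[of _ snd])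
      then show "e \<in> {e \<in> cel ` U. e \<inter> Q \<noteq> {}}" using se p(1) by blast
    qed
    ultimately show "finite {e \<in> cel ` U. \<not> b ` cbd e d \<subseteq> V}" by (rule finite_subset[rotated])
  qed
qed

text \<open>The \<open>d\<close>-cells overlap only in \<open>skel d\<close>, where every
  \<open>G e\<close> agrees with \<open>H\<close>; at \<open>Out\<close>, where they accumulate,
  nullness of \<open>G\<close> gives continuity.\<close>

lemma skel_htp_glue:
  assumes a: "a \<in> topspace A" and H: "skel_htp A a g d H"
    and J: "J = cel ` {x \<in> U. cdim x = d}"
    and G: "\<And>e. e \<in> J \<Longrightarrow> continuous_map (top_of_set ({0..1} \<times> e)) A (G e)"
      "null_family J A a (\<lambda>e. {0..1} \<times> e) G"
      "\<And>e p. e \<in> J \<Longrightarrow> p \<in> {0..1} \<times> e \<Longrightarrow> snd p \<in> skel d \<Longrightarrow> G e p = H p"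
      "\<And>e x. e \<in> J \<Longrightarrow> x \<in> e \<Longrightarrow> G e (0, x) = g x"
  shows "\<exists>H'. skel_htp A a g (Suc d) H' \<and> (\<forall>p\<in>{0..1} \<times> (skel d \<union> Out). H' p = H p) \<and> (\<forall>e\<in>J. \<forall>p\<in>{0..1} \<times> e. H' p = G e p)"
proof -
  note Hc = H[unfolded skel_htp_def]
  define H' where "H' p = (if snd p \<in> skel d \<union> Out then H p else G (cel (snd p)) p)" for p
  have JU: "J \<subseteq> cel ` U" by (auto simp: J)
  have HG: "H' p = G e p" if e: "e \<in> J" and p: "p \<in> {0..1} \<times> e" for e p
  proof -
    obtain x where x: "x \<in> U" "cdim x = d" "e = cel x" using e by (auto simp: J)
    have y: "snd p \<in> cel x" using p x by auto
    then have yU: "snd p \<in> U" using cel_subset[OF x(1)] by blast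
    show ?thesis
    proof (cases "snd p \<in> skel d")
      case True
      then show ?thesis using G(3)[OF e p] by (simp add: H'_def)
    next
      case False
      then have "cdim (snd p) = cdim x" using cdim_cel[OF x(1) y] yU x by (auto simp: skel_def)
      then have "cel (snd p) = e" using cel_eq[OF x(1) y] x by simp
      then show ?thesis using False yU by (simp add: H'_def Out_def)
    qed
  qed
  let ?D = "{0..1::real} \<times> (skel (Suc d) \<union> Out)"
  have sk: "skel (Suc d) = skel d \<union> \<Union>J" unfolding J by (rule skel_Suc)
  have cs: "continuous_on ?D snd" by (intro continuous_intros)
  have clo: "closedin (top_of_set ?D) ({0..1} \<times> S)" if "closed S" "S \<subseteq> skel (Suc d) \<union> Out" for S
  proof -
    have "{0..1} \<times> S = ?D \<inter> snd -` S" using that by auto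
    then show ?thesis using continuous_closedin_preimage[OF cs that(1)] by simp
  qed
  have "continuous_map (top_of_set ?D) A H'"
  proof (rule continuous_map_glue_null_on[where T="{0..1} \<times> (skel d \<union> Out)" and J=J and Z="\<lambda>e. {0..1} \<times> e" and C="{0..1} \<times> Out" and a=a])
    show "closedin (top_of_set ?D) ({0..1} \<times> (skel d \<union> Out))"
      using sk by (intro clo closed_skel) auto
    show "closedin (top_of_set ?D) ({0..1} \<times> e)" if "e \<in> J" for e
    proof (rule clo)
      show "closed e" using that closed_gcell by (auto simp: J cel_def)
    qed (use that sk in auto)
    show "?D \<subseteq> {0..1} \<times> (skel d \<union> Out) \<union> (\<Union>e\<in>J. {0..1} \<times> e)" using sk by auto
    show "continuous_map (top_of_set ({0..1} \<times> (skel d \<union> Out))) A H'"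
      by (rule continuous_map_top_of_set_cong[OF conjunct1[OF Hc]]) (auto simp: H'_def)
    show "continuous_map (top_of_set ({0..1} \<times> e)) A H'" if "e \<in> J" for e
      by (rule continuous_map_top_of_set_cong[OF G(1)[OF that]]) (use HG[OF that] in auto)
    show "H' p = a" if "p \<in> {0..1} \<times> Out" for p using that Hc by (auto simp: H'_def)
    show "\<exists>N. openin (top_of_set ?D) N \<and> p \<in> N \<and> finite {e \<in> J. {0..1} \<times> e \<inter> N \<noteq> {}}"
      if p: "p \<in> ?D" "p \<notin> {0..1} \<times> Out" for p
    proof -
      have "snd p \<in> U" using p U_subset by (auto simp: skel_def Out_def)
      then obtain N where N: "openin (top_of_set (ucube n)) N" "snd p \<in> N" "\<And>y. y \<in> N \<Longrightarrow> lam y \<le> lam (snd p)" using nbhd by metis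
      obtain T where T: "open T" "N = ucube n \<inter> T" using N(1) by (auto simp: openin_open)
      have Dn: "snd q \<in> ucube n" if "q \<in> ?D" for q using that U_subset by (auto simp: skel_def Out_def)
      have "openin (top_of_set ?D) (?D \<inter> snd -` T)" by (rule continuous_openin_preimage_gen[OF cs T(1)])
      moreover have "finite {e \<in> cel ` U. e \<inter> N \<noteq> {}}" using N(3) by (rule finite_cels_meeting_nbhd)
      moreover have "{e \<in> J. {0..1} \<times> e \<inter> (?D \<inter> snd -` T) \<noteq> {}} \<subseteq> {e \<in> cel ` U. e \<inter> N \<noteq> {}}"
        using JU T(2) Dn by fastforce
      ultimately show ?thesis using p N(2) T(2) by (intro exI[of _ "?D \<inter> snd -` T"]) (auto intro: finite_subset)
    qed
    show "finite {e \<in> J. \<not> H' ` ({0..1} \<times> e) \<subseteq> V}" if "openin A V" "a \<in> V" for V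
    proof -
      have "{e \<in> J. \<not> H' ` ({0..1} \<times> e) \<subseteq> V} = {e \<in> J. \<not> G e ` ({0..1} \<times> e) \<subseteq> V}"
        using HG by (intro Collect_cong conj_cong refl arg_cong[where f=Not]) (simp add: image_subset_iff)
      then show ?thesis using G(2) that by (simp add: null_family_def)
    qed
  qed (rule a)
  moreover have "H' (0, x) = g x" if xs: "x \<in> skel (Suc d) \<union> Out" for x
  proof (cases "x \<in> skel d \<union> Out")
    case True
    then show ?thesis using Hc by (simp add: H'_def)
  next
    case False
    then obtain e where "e \<in> J" "x \<in> e" using xs sk by auto
    then show ?thesis using HG[of e "(0,x)"] G(4) by simp
  qed
  moreover have "H' (t, x) = a" if "t \<in> {0..1}" "x \<in> Out" for t x
    using that Hc by (simp add: H'_def)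
  ultimately have "skel_htp A a g (Suc d) H'" by (simp add: skel_htp_def)
  then show ?thesis using HG by (intro exI[of _ H']) (auto simp: H'_def)
qed

text \<open>Each step fills the prisms over all \<open>d\<close>-cells at once. Prescribing
  \<open>a\<close> at the top makes the end of the homotopy trivial on the next skeleton. The start
  is the constant \<open>a\<close> on \<open>Out\<close>, as \<open>skel 0\<close> is empty.\<close>

lemma skel_htp_exists:
  assumes g: "continuous_map (top_of_set (ucube n)) A g" "\<And>x. x \<in> Out \<Longrightarrow> g x = a" and a: "a \<in> topspace A"
    and ext: "\<And>k. k < n \<Longrightarrow> seq_ext k A a"
  shows "d \<le> n \<Longrightarrow> \<exists>H. skel_htp A a g d H \<and> (\<forall>x\<in>skel d. H (1, x) = a)"
proof (induction d)
  case 0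
  have "skel_htp A a g 0 (\<lambda>_. a)" using g(2) a by (simp add: skel_htp_def skel_def)
  then show ?case by (auto simp: skel_def)
next
  case (Suc d)
  then obtain H where H: "skel_htp A a g d H" "\<And>x. x \<in> skel d \<Longrightarrow> H (1, x) = a" by auto
  note Hc = H(1)[unfolded skel_htp_def]
  define b where "b = (\<lambda>p. if snd p \<in> skel d then H p else if fst p = 0 then g (snd p) else a)"
  define J where "J = cel ` {x \<in> U. cdim x = d}"
  note bd = skel_htp_boundary[OF g a H b_def]
  have JU: "J \<subseteq> cel ` U" by (auto simp: J_def)
  have "\<forall>e\<in>J. \<exists>\<xi> ch. continuous_on ({0..1::real} \<times> e) \<xi> \<and> (\<forall>p\<in>{0..1} \<times> e. \<xi> p \<in> bbox d) \<and>
    continuous_on (bbox_bd d) ch \<and> (\<forall>w\<in>bbox_bd d. ch w \<in> cbd e d) \<and>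
    (\<forall>p\<in>cbd e d. \<xi> p \<in> bbox_bd d \<and> ch (\<xi> p) = p)"
    using cell_chart by (auto simp: J_def)
  then obtain \<xi> ch where ch: "\<forall>e\<in>J. continuous_on ({0..1::real} \<times> e) (\<xi> e) \<and> (\<forall>p\<in>{0..1} \<times> e. \<xi> e p \<in> bbox d) \<and>
    continuous_on (bbox_bd d) (ch e) \<and> (\<forall>w\<in>bbox_bd d. ch e w \<in> cbd e d) \<and>
    (\<forall>p\<in>cbd e d. \<xi> e p \<in> bbox_bd d \<and> ch e (\<xi> e p) = p)" by metis
  have "seq_ext d A a" using ext Suc.prems by simp
  have "null_family J A a (\<lambda>e. cbd e d) (\<lambda>e. b)"
    using bd(2) JU unfolding null_family_def by (blast intro: finite_subset[rotated])
  then have "\<exists>G. (\<forall>e\<in>J. continuous_map (top_of_set ({0..1} \<times> e)) A (G e)) \<and> (\<forall>e\<in>J. \<forall>p\<in>cbd e d. G e p = b p) \<and>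
     null_family J A a (\<lambda>e. {0..1} \<times> e) G"
    using ch bd(1) JU countable_subset[OF JU countable_cels]
    by (intro seq_ext_charts[OF \<open>seq_ext d A a\<close> a, where \<xi>=\<xi> and ch=ch]) auto
  then obtain G where G: "\<And>e. e\<in>J \<Longrightarrow> continuous_map (top_of_set ({0..1} \<times> e)) A (G e)"
    "\<And>e p. e\<in>J \<Longrightarrow> p\<in>cbd e d \<Longrightarrow> G e p = b p" "null_family J A a (\<lambda>e. {0..1} \<times> e) G" by metis
  have "\<exists>H'. skel_htp A a g (Suc d) H' \<and> (\<forall>p\<in>{0..1} \<times> (skel d \<union> Out). H' p = H p) \<and> (\<forall>e\<in>J. \<forall>p\<in>{0..1} \<times> e. H' p = G e p)"
  proof (rule skel_htp_glue[OF a H(1) J_def G(1,3)])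
    show "G e p = H p" if "e \<in> J" "p \<in> {0..1} \<times> e" "snd p \<in> skel d" for e p
      using that G(2)[of e p] by (auto simp: cbd_def b_def)
    show "G e (0, x) = g x" if "e \<in> J" "x \<in> e" for e x
      using that G(2)[of e "(0,x)"] Hc by (auto simp: cbd_def b_def)
  qed
  then obtain H' where H': "skel_htp A a g (Suc d) H'" "\<And>p. p\<in>{0..1} \<times> (skel d \<union> Out) \<Longrightarrow> H' p = H p"
    "\<And>e p. e\<in>J \<Longrightarrow> p\<in>{0..1} \<times> e \<Longrightarrow> H' p = G e p" by metis
  have "H' (1, x) = a" if x: "x \<in> skel (Suc d)" for x
  proof (cases "x \<in> skel d")
    case True
    then show ?thesis using H'(2)[of "(1,x)"] H(2) by simp
  next
    case False
    then obtain e where e: "e \<in> J" "x \<in> e" using x skel_Suc[of d] by (auto simp: J_def)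
    then have "G e (1, x) = b (1, x)" by (intro G(2)) (auto simp: cbd_def)
    then show ?thesis using H'(3)[of e "(1,x)"] e False by (simp add: b_def)
  qed
  then show ?case using H'(1) by blast
qed

text \<open>Over the n-cells the homotopy is the boundary data composed with the retraction of the
  prism; its end is controlled on their boundaries.\<close>

lemma cell_homotopy:
  assumes g: "continuous_map (top_of_set (ucube n)) A g" "\<And>x. x \<in> Out \<Longrightarrow> g x = a" and a: "a \<in> topspace A"
    and ext: "\<And>k. k < n \<Longrightarrow> seq_ext k A a" and n: "0 < n"
  shows "\<exists>H. continuous_map (top_of_set ({0..1::real} \<times> ucube n)) A H \<and> (\<forall>x\<in>ucube n. H (0, x) = g x) \<and>
     (\<forall>t\<in>{0..1}. \<forall>x\<in>Out. H (t, x) = a) \<and> (\<forall>x\<in>skel n. H (1, x) = a)"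
proof -
  obtain H where H: "skel_htp A a g n H" "\<And>x. x \<in> skel n \<Longrightarrow> H (1, x) = a"
    using skel_htp_exists[OF g a ext] by blast
  note Hc = H(1)[unfolded skel_htp_def]
  define b where "b = (\<lambda>p. if snd p \<in> skel n then H p else if fst p = 0 then g (snd p) else a)"
  define J where "J = cel ` {x \<in> U. cdim x = n}"
  note bd = skel_htp_boundary[OF g a H b_def]
  have JU: "J \<subseteq> cel ` U" by (auto simp: J_def)
  have "\<forall>e\<in>J. \<exists>\<rho>. continuous_on ({0..1::real} \<times> e) \<rho> \<and> (\<forall>p\<in>{0..1} \<times> e. \<rho> p \<in> cbd e n) \<and>
    (\<forall>p\<in>{0..1} \<times> e. snd p \<in> skel n \<or> fst p = 0 \<longrightarrow> \<rho> p = p)"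
    using top_cell_retraction n by (auto simp: J_def)
  then obtain \<rho> where rho: "\<And>e. e\<in>J \<Longrightarrow> continuous_on ({0..1::real} \<times> e) (\<rho> e)" "\<And>e p. e\<in>J \<Longrightarrow> p\<in>{0..1} \<times> e \<Longrightarrow> \<rho> e p \<in> cbd e n"
    "\<And>e p. e\<in>J \<Longrightarrow> p\<in>{0..1} \<times> e \<Longrightarrow> snd p \<in> skel n \<or> fst p = 0 \<Longrightarrow> \<rho> e p = p" by metis
  have "\<exists>H'. skel_htp A a g (Suc n) H' \<and> (\<forall>p\<in>{0..1} \<times> (skel n \<union> Out). H' p = H p) \<and> (\<forall>e\<in>J. \<forall>p\<in>{0..1} \<times> e. H' p = b (\<rho> e p))"
  proof (rule skel_htp_glue[OF a H(1) J_def])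
    show "continuous_map (top_of_set ({0..1} \<times> e)) A (\<lambda>p. b (\<rho> e p))" if "e \<in> J" for e
      using that JU by (intro continuous_map_compose_on[OF bd(1) rho(1,2)]) auto
    show "null_family J A a (\<lambda>e. {0..1} \<times> e) (\<lambda>e p. b (\<rho> e p))"
      unfolding null_family_def
    proof (intro allI impI)
      fix V assume "openin A V" "a \<in> V"
      then have "finite {e \<in> cel ` U. \<not> b ` cbd e n \<subseteq> V}" using bd(2) by (simp add: null_family_def)
      moreover have "{e \<in> J. \<not> (\<lambda>p. b (\<rho> e p)) ` ({0..1} \<times> e) \<subseteq> V} \<subseteq> {e \<in> cel ` U. \<not> b ` cbd e n \<subseteq> V}"
        using JU rho(2) by blast
      ultimately show "finite {e \<in> J. \<not> (\<lambda>p. b (\<rho> e p)) ` ({0..1} \<times> e) \<subseteq> V}" by (rule finite_subset[rotated])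
    qed
    show "b (\<rho> e p) = H p" if "e \<in> J" "p \<in> {0..1} \<times> e" "snd p \<in> skel n" for e p
      using that rho(3)[of e p] by (simp add: b_def)
    show "b (\<rho> e (0, x)) = g x" if "e \<in> J" "x \<in> e" for e x
      using that rho(3)[of e "(0,x)"] Hc by (simp add: b_def)
  qed
  then obtain H' where H': "skel_htp A a g (Suc n) H'" "\<And>p. p\<in>{0..1} \<times> (skel n \<union> Out) \<Longrightarrow> H' p = H p" by metis
  have "skel (Suc n) \<union> Out = ucube n" using U_subset cdim_le by (auto simp: skel_def Out_def less_Suc_eq_le)
  then show ?thesis using H'(1) H'(2) H(2) unfolding skel_htp_def by (intro exI[of _ H']) auto
qed

end

subsection \<open>Dyadic boxes\<close>

text \<open>Words are read from the right; the box of a word of length \<open>D\<close> is halved in the direction of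
  coordinate \<open>D mod n\<close>.\<close>

primrec kmap :: "nat \<Rightarrow> bool list \<Rightarrow> (nat \<Rightarrow> real) \<Rightarrow> nat \<Rightarrow> real" where
  "kmap n [] t = t"
| "kmap n (b # w) t = kmap n w (t(length w mod n := (t (length w mod n) + of_bool b) / 2))"

text \<open>The integers \<open>k i\<close> locate the lower corner: the box of \<open>w\<close> is
  a box of the dyadic grid of depth \<open>length w\<close>, so stars and cells apply to it.\<close>

lemma kmap_coord: "\<exists>k :: nat \<Rightarrow> int. \<forall>t i. pw n (length w) i * kmap n w t i = real_of_int (k i) + t i"
proof (induction w)
  case Nil
  show ?case by (intro exI[of _ "\<lambda>_. 0"]) (simp add: pw_def)
next
  case (Cons b w)
  then obtain k :: "nat \<Rightarrow> int" where k: "\<And>t i. pw n (length w) i * kmap n w t i = real_of_int (k i) + t i" by blast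
  let ?j = "length w mod n"
  have "pw n (length (b # w)) i * kmap n (b # w) t i = real_of_int (if i = ?j then 2 * k i + of_bool b else k i) + t i" for t i
    using k[of i "t(?j := (t ?j + of_bool b) / 2)"] by (auto simp: pw_def algebra_simps)
  then show ?case by (intro exI[of _ "\<lambda>i. if i = ?j then 2 * k i + of_bool b else k i"] allI)
qed

lemma kmap_ucube: "0 < n \<Longrightarrow> t \<in> ucube n \<Longrightarrow> kmap n w t \<in> ucube n"
proof (induction w arbitrary: t)
  case (Cons b w)
  have "0 \<le> t (length w mod n) \<and> t (length w mod n) \<le> 1" using ucube_coord[OF Cons.prems(2)] .
  then have "t(length w mod n := (t (length w mod n) + of_bool b) / 2) \<in> ucube n"
    using Cons.prems by (intro ucube_upd) auto
  then show ?case using Cons by simp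
qed simp

lemma continuous_on_kmap: "continuous_on S (kmap n w)"
proof (induction w arbitrary: S)
  case Nil
  then show ?case by (simp add: continuous_on_id)
next
  case (Cons b w)
  have c: "continuous_on S (\<lambda>t. t(length w mod n := (t (length w mod n) + of_bool b) / 2))"
    by (intro continuous_intros continuous_on_coord) auto
  have eq: "kmap n (b # w) = (\<lambda>t. kmap n w (t(length w mod n := (t (length w mod n) + of_bool b) / 2)))"
    by (rule ext) (rule kmap.simps(2))
  show ?case unfolding eq by (rule continuous_on_compose2[OF Cons[of UNIV] c]) simp
qed

lemma concat_at_kmap:
  "concat_at (length w mod n) (\<lambda>t. f (kmap n (False # w) t)) (\<lambda>t. f (kmap n (True # w) t)) = (\<lambda>t. f (kmap n w t))"
  by (auto simp: concat_at_def fun_eq_iff)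

lemma kmap_box_subset_star:
  assumes n: "0 < n" and t: "t \<in> ucube n" shows "kmap n w ` ucube n \<subseteq> gstar n (length w) (kmap n w t)"
proof
  fix y assume "y \<in> kmap n w ` ucube n"
  then obtain s where s: "s \<in> ucube n" "y = kmap n w s" by auto
  obtain k :: "nat \<Rightarrow> int" where k: "\<And>t i. pw n (length w) i * kmap n w t i = real_of_int (k i) + t i" using kmap_coord by metis
  have "gce n (length w) (kmap n w t) i - 1 \<le> pw n (length w) i * y i \<and> pw n (length w) i * y i \<le> gfl n (length w) (kmap n w t) i + 1" for i
  proof -
    have "gce n (length w) (kmap n w t) i \<le> k i + 1" "k i \<le> gfl n (length w) (kmap n w t) i"
      using ucube_coord[OF t, of i] unfolding gce_def gfl_def k by (simp_all add: ceiling_le_iff le_floor_iff)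
    then show ?thesis using ucube_coord[OF s(1), of i] unfolding s(2) k by linarith
  qed
  then show "y \<in> gstar n (length w) (kmap n w t)" using kmap_ucube[OF n s(1)] s(2) by (simp add: gstar_def)
qed

text \<open>A boundary point of a half lies on a hyperplane of the grid of depth
  \<open>length w + 1\<close>. Were it interior to an n-cell, its depth would be at most
  \<open>length w\<close>, and its star at depth \<open>length w\<close>, which contains the whole
  box of \<open>w\<close>, would lie in \<open>U\<close>.\<close>

lemma (in cube_cells) kmap_boundary_skel:
  assumes n: "0 < n" and t: "t \<in> cube_boundary n" and nU: "\<not> kmap n w ` ucube n \<subseteq> U"
  shows "kmap n (b # w) t \<in> skel n \<union> Out"
proof (rule ccontr)
  let ?x = "kmap n (b # w) t"
  assume nx: "?x \<notin> skel n \<union> Out"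
  have tu: "t \<in> ucube n" using t cube_boundary_subset by blast
  have xU: "?x \<in> U" using nx kmap_ucube[OF n tu, of "b # w"] by (auto simp: Out_def)
  have "cdim ?x = n" using nx xU cdim_le[of ?x] by (auto simp: skel_def)
  then have fre: "fre ?x = {..<n}"
    using fre_less by (intro card_subset_eq) (auto simp: cdim_def)
  obtain i where i: "i < n" "t i = 0 \<or> t i = 1" using t by (auto simp: cube_boundary_eq)
  then have "i \<in> fre ?x" using fre by blast
  then have ni: "pw n (lam ?x) i * ?x i \<notin> \<int>" unfolding fre_def gfree_def by blast
  obtain k :: "nat \<Rightarrow> int" where k: "\<And>t i. pw n (length (b # w)) i * kmap n (b # w) t i = real_of_int (k i) + t i" using kmap_coord by metis
  have z: "pw n (length (b # w)) i * ?x i \<in> \<int>" unfolding k using i(2) by auto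
  have "lam ?x \<le> length w"
  proof (rule ccontr)
    assume "\<not> lam ?x \<le> length w"
    then have "length (b # w) \<le> lam ?x" by simp
    then obtain m where m: "pw n (lam ?x) i = 2 ^ m * pw n (length (b # w)) i" using pw_split by blast
    have "2 ^ m * (pw n (length (b # w)) i * ?x i) \<in> \<int>" by (rule Ints_mult[OF _ z]) simp
    then show False using ni by (simp only: m mult.assoc) simp
  qed
  then have "gstar n (length w) ?x \<subseteq> gstar n (lam ?x) ?x" by (rule gstar_antimono)
  then have "gstar n (length w) ?x \<subseteq> U" using star_lam[OF xU] by (rule subset_trans)
  moreover have "t(length w mod n := (t (length w mod n) + of_bool b) / 2) \<in> ucube n"
    using ucube_coord[OF tu, of "length w mod n"] n tu by (intro ucube_upd) auto
  then have "kmap n w ` ucube n \<subseteq> gstar n (length w) ?x" using kmap_box_subset_star[OF n] by simp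
  ultimately show False using nU by blast
qed

subsection \<open>Exhausting the boxes by a breadth-first search\<close>

primrec conc :: "'a \<Rightarrow> ((nat \<Rightarrow> real) \<Rightarrow> 'a) list \<Rightarrow> (nat \<Rightarrow> real) \<Rightarrow> 'a" where
  "conc x [] = (\<lambda>t. x)"
| "conc x (f # fs) = concat_at 0 f (conc x fs)"

lemma conc_relcube:
  assumes "0 < n" "x \<in> topspace X" "set fs \<subseteq> relcube_maps n X x" shows "conc x fs \<in> relcube_maps n X x"
  using assms(3) by (induction fs) (auto intro!: concat_at_relcube const_relcube assms)

lemma conc_append:
  assumes n: "2 \<le> n" and x: "x \<in> topspace X" and "set fs \<subseteq> relcube_maps n X x" and gs: "set gs \<subseteq> relcube_maps n X x"
  shows "cube_htp n X x (conc x (fs @ gs)) (concat_at 0 (conc x fs) (conc x gs))"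
  using assms(3)
proof (induction fs)
  case Nil
  have "conc x gs \<in> relcube_maps n X x" using n x gs by (intro conc_relcube) auto
  from cube_htp_sym[OF concat_at_unit_left[OF this]] show ?case using n by simp
next
  case (Cons f fs)
  have r: "f \<in> relcube_maps n X x" "conc x fs \<in> relcube_maps n X x" "conc x gs \<in> relcube_maps n X x"
    using n x gs Cons.prems by (auto intro!: conc_relcube)
  have "cube_htp n X x (concat_at 0 f (conc x (fs @ gs))) (concat_at 0 f (concat_at 0 (conc x fs) (conc x gs)))"
    using Cons n r by (intro concat_at_htp cube_htp_refl) auto
  then show ?case
    using concat_at_assoc[OF r n, of 0] n by (auto intro: cube_htp_trans cube_htp_sym)
qed

text \<open>The halves go to the end of the queue instead of taking the place of the parent; the
  growth of the minimal word length depends on this.\<close>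

primrec bfs_step :: "(bool list \<Rightarrow> bool) \<Rightarrow> bool list list \<Rightarrow> bool list list" where
  "bfs_step P [] = []"
| "bfs_step P (w # ws) = (if P w then ws else ws @ [False # w, True # w])"

primrec bfs :: "(bool list \<Rightarrow> bool) \<Rightarrow> nat \<Rightarrow> bool list list" where
  "bfs P 0 = [[]]"
| "bfs P (Suc k) = bfs_step P (bfs P k)"

lemma bfs_step_cases:
  assumes "v \<in> set (bfs_step P ws)"
  shows "v \<in> set ws \<or> (\<exists>w b. w \<in> set ws \<and> \<not> P w \<and> v = b # w)"
  using assms by (cases ws) (auto split: if_splits)

lemma bfs_length_step:
  assumes "\<forall>w\<in>set (bfs P k). d \<le> length w" "k \<le> k'" shows "\<forall>w\<in>set (bfs P k'). d \<le> length w"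
  using assms(2)
proof (induction k' rule: dec_induct)
  case (step m)
  then show ?case by (auto dest!: bfs_step_cases)
qed (rule assms(1))

text \<open>While the words present at step \<open>k\<close> are being processed, only longer ones
  are appended; after \<open>length (bfs P k)\<close> steps the minimal length has gone up.\<close>

lemma bfs_drop:
  assumes "\<forall>w\<in>set (bfs P k). d \<le> length w" "j \<le> length (bfs P k)"
  shows "\<exists>vs. bfs P (k + j) = drop j (bfs P k) @ vs \<and> (\<forall>v\<in>set vs. Suc d \<le> length v)"
  using assms(2)
proof (induction j)
  case (Suc j)
  then obtain vs where vs: "bfs P (k + j) = drop j (bfs P k) @ vs" "\<forall>v\<in>set vs. Suc d \<le> length v" by auto
  define w where "w = bfs P k ! j"
  have dr: "drop j (bfs P k) = w # drop (Suc j) (bfs P k)"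
    using Suc.prems unfolding w_def by (simp add: Cons_nth_drop_Suc)
  have "w \<in> set (bfs P k)" using Suc.prems by (simp add: w_def)
  then have "d \<le> length w" using assms(1) by blast
  then show ?case using vs unfolding add_Suc_right bfs.simps vs(1) dr
    by (cases "P w") (auto intro: exI[of _ vs] exI[of _ "vs @ [False # w, True # w]"])
qed auto

lemma bfs_length_unbounded: "\<exists>k. \<forall>w\<in>set (bfs P k). d \<le> length w"
proof (induction d)
  case (Suc d)
  then obtain k where k: "\<forall>w\<in>set (bfs P k). d \<le> length w" by blast
  from bfs_drop[OF k, of "length (bfs P k)"] show ?case by auto
qed simp

text \<open>\<open>g k\<close> is the concatenation over the current queue. A step removes its first
  box as the piece \<open>e k\<close>, or moves the two halves to the end, which commutativity of
  the concatenation allows; \<open>telescope_htp\<close> assembles all steps.\<close>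

lemma bfs_htp:
  fixes f :: "(nat \<Rightarrow> real) \<Rightarrow> 'a"
  assumes n: "2 \<le> n" and f: "continuous_map (top_of_set (ucube n)) X f"
    and x: "x \<in> topspace X" "closedin X {x}"
    and root: "\<And>t. t \<in> cube_boundary n \<Longrightarrow> f t = x"
    and split: "\<And>w b t. \<not> P w \<Longrightarrow> t \<in> cube_boundary n \<Longrightarrow> f (kmap n (b # w) t) = x"
  shows "\<exists>e. (\<forall>k. e k = (\<lambda>t. x) \<or> (\<exists>w. P w \<and> e k = (\<lambda>t. f (kmap n w t)))) \<and> cube_htp n X x f (slab_concat x e)"
proof -
  have n0: "0 < n" using n by simp
  define fw where "fw w = (\<lambda>t. f (kmap n w t))" for w
  define Q where "Q = bfs P"
  \<comment> \<open>A step that merely splits a box contributes the constant map, so that pieces and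
    steps share one index.\<close>
  define e where "e k = (case Q k of [] \<Rightarrow> (\<lambda>t. x) | w # ws \<Rightarrow> if P w then fw w else (\<lambda>t. x))" for k
  define g where "g k = conc x (map fw (Q k))" for k
  \<comment> \<open>The homotopy of step \<open>k\<close> stays inside the images of the boxes in
    the queue, which shrink to \<open>x\<close>.\<close>
  define S where "S k = insert x (\<Union>w\<in>set (Q k). fw w ` ucube n)" for k
  define Bd where "Bd w \<longleftrightarrow> (\<forall>t\<in>cube_boundary n. fw w t = x)" for w
  have fwc: "continuous_map (top_of_set (ucube n)) X (fw w)" for w
    unfolding fw_def using kmap_ucube[OF n0] by (intro continuous_map_compose_on[OF f continuous_on_kmap]) auto
  have Bd: "Bd w" if "w \<in> set (Q k)" for w k
    using that
  proof (induction k arbitrary: w)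
    case 0
    then show ?case using root by (simp add: Q_def Bd_def fw_def)
  next
    case (Suc k)
    then show ?case using split by (auto simp: Q_def Bd_def fw_def dest!: bfs_step_cases simp del: kmap.simps(2))
  qed
  have fwX: "fw w ` ucube n \<subseteq> topspace X" for w
    using continuous_map_image_subset_topspace[OF fwc] by simp
  have rel: "fw w \<in> relcube_maps n (subtopology X T) x" if "Bd w" "fw w ` ucube n \<subseteq> T" for w T
    using that fwc[of w] by (auto simp: relcube_maps_iff Bd_def continuous_map_in_subtopology)
  have child: "fw (b # w) ` ucube n \<subseteq> fw w ` ucube n" for b w
  proof -
    have "fw (b # w) t \<in> fw w ` ucube n" if t: "t \<in> ucube n" for t
    proof -
      have h: "t(length w mod n := (t (length w mod n) + of_bool b) / 2) \<in> ucube n"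
        using ucube_coord[OF t, of "length w mod n"] n0 t by (intro ucube_upd) auto
      show ?thesis unfolding fw_def by (rule image_eqI[OF _ h]) simp
    qed
    then show ?thesis by blast
  qed
  have step: "cube_htp n (subtopology X (S k)) x (g k) (concat_at 0 (e k) (g (Suc k)))" for k
  proof -
    let ?X = "subtopology X (S k)"
    have xX: "x \<in> topspace ?X" using x(1) by (simp add: S_def)
    have relw: "fw w \<in> relcube_maps n ?X x" if "w \<in> set (Q k)" for w
      using that by (intro rel Bd) (auto simp: S_def)
    show ?thesis
    proof (cases "Q k")
      case Nil
      then have "Q (Suc k) = []" by (simp add: Q_def)
      then have "g k = (\<lambda>t. x)" "e k = (\<lambda>t. x)" "g (Suc k) = (\<lambda>t. x)" using Nil by (simp_all add: g_def e_def)
      then show ?thesis using concat_at_unit_left[OF const_relcube[OF xX] n0] cube_htp_sym by simp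
    next
      case (Cons w ws)
      have rws: "set (map fw ws) \<subseteq> relcube_maps n ?X x" using relw Cons by auto
      have cws: "conc x (map fw ws) \<in> relcube_maps n ?X x" using n0 xX rws by (rule conc_relcube)
      have rw: "fw w \<in> relcube_maps n ?X x" using relw Cons by simp
      show ?thesis
      proof (cases "P w")
        case True
        then have "Q (Suc k) = ws" using Cons by (simp add: Q_def)
        then have "g k = concat_at 0 (e k) (g (Suc k))" using Cons True by (simp add: g_def e_def)
        moreover have "g k \<in> relcube_maps n ?X x" unfolding g_def using n0 xX relw by (intro conc_relcube) auto
        ultimately show ?thesis using cube_htp_refl by metis
      next
        case False
        let ?u = "fw (False # w)" and ?v = "fw (True # w)" and ?i = "length w mod n"
        have inn: "?i < n" using n0 by simp
        have sub: "fw w ` ucube n \<subseteq> S k" using Cons by (auto simp: S_def)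
        have rc: "fw (b # w) \<in> relcube_maps n ?X x" for b
        proof (rule rel)
          show "Bd (b # w)" using split[OF False] by (auto simp: Bd_def fw_def simp del: kmap.simps(2))
        qed (use child[of b w] sub in blast)
        have Qk: "Q (Suc k) = ws @ [False # w, True # w]" using Cons False by (simp add: Q_def)
        have "cube_htp n ?X x (concat_at 0 ?u (concat_at 0 ?v (\<lambda>t. x))) (concat_at 0 ?u ?v)"
          by (intro concat_at_htp concat_at_unit_right cube_htp_refl rc n0)
        \<comment> \<open>The box was cut in coordinate \<open>?i\<close>, while the queue is
          concatenated in coordinate 0.\<close>
        moreover have "cube_htp n ?X x (concat_at 0 ?u ?v) (fw w)"
        proof -
          have "fw w = concat_at ?i ?u ?v" unfolding fw_def concat_at_kmap ..
          moreover have "cube_htp n ?X x (concat_at 0 ?u ?v) (concat_at ?i ?u ?v)"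
            using concat_at_indep[OF rc rc n0 inn] cube_htp_refl[OF concat_at_relcube[OF rc rc n0]] by (cases "?i = 0") auto
          ultimately show ?thesis by simp
        qed
        ultimately have uv: "cube_htp n ?X x (conc x [?u, ?v]) (fw w)" by (auto intro: cube_htp_trans)
        have "cube_htp n ?X x (g (Suc k)) (concat_at 0 (conc x (map fw ws)) (conc x [?u, ?v]))"
          unfolding g_def Qk map_append using conc_append[OF n xX rws, of "[?u, ?v]"] rc by simp
        moreover have "cube_htp n ?X x (concat_at 0 (conc x (map fw ws)) (conc x [?u, ?v])) (concat_at 0 (conc x (map fw ws)) (fw w))"
          by (intro concat_at_htp cube_htp_refl cws uv n0)
        moreover have "cube_htp n ?X x (concat_at 0 (conc x (map fw ws)) (fw w)) (concat_at 0 (fw w) (conc x (map fw ws)))"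
          by (intro concat_at_commute cws rw n n0)
        ultimately have gk: "cube_htp n ?X x (g (Suc k)) (concat_at 0 (fw w) (conc x (map fw ws)))"
          by (rule cube_htp_trans[OF cube_htp_trans])
        have "g k = concat_at 0 (fw w) (conc x (map fw ws))" using Cons by (simp add: g_def)
        moreover have "cube_htp n ?X x (concat_at 0 (\<lambda>t. x) (g (Suc k))) (g (Suc k))"
          by (rule concat_at_unit_left[OF cube_htp_imp_relcube(1)[OF gk] n0])
        moreover have "e k = (\<lambda>t. x)" using Cons False by (simp add: e_def)
        ultimately show ?thesis using gk by (metis cube_htp_sym cube_htp_trans)
      qed
    qed
  qed
  have small: "finite {k. \<not> topspace X \<inter> S k \<subseteq> V}" if V: "openin X V" "x \<in> V" for V
  proof -
    \<comment> \<open>A second use of the star machinery, for the set where \<open>f\<close> differs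
      from \<open>x\<close>; it measures smallness and is independent of \<open>P\<close>.\<close>
    define U where "U = {t \<in> ucube n. f t \<noteq> x}"
    have fX: "f t \<in> topspace X" if "t \<in> ucube n" for t
      using continuous_map_image_subset_topspace[OF f] that by auto
    have "openin X (topspace X - {x})" using x(2) by (simp add: closedin_def)
    then have "openin (top_of_set (ucube n)) {t \<in> topspace (top_of_set (ucube n)). f t \<in> topspace X - {x}}"
      using f unfolding continuous_map_def by blast
    also have "{t \<in> topspace (top_of_set (ucube n)). f t \<in> topspace X - {x}} = U" using fX by (auto simp: U_def)
    finally interpret cube_cells n U by unfold_locales
    have "{t \<in> ucube n. f t \<notin> V} \<subseteq> U" using V by (auto simp: U_def)
    then obtain D where D: "\<And>y. y \<in> {t \<in> ucube n. f t \<notin> V} \<Longrightarrow> lam y \<le> D"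
      using lam_bounded_on_compact[OF compact_outside[OF f compact_ucube V(1)]] by metis
    \<comment> \<open>A deep box with a point outside \<open>V\<close> would lie entirely in
      \<open>U\<close>, although its boundary goes to \<open>x\<close>.\<close>
    have inV: "fw w ` ucube n \<subseteq> V" if w: "Bd w" "D \<le> length w" for w
    proof (rule ccontr)
      assume "\<not> fw w ` ucube n \<subseteq> V"
      then obtain t where t: "t \<in> ucube n" "f (kmap n w t) \<notin> V" by (auto simp: fw_def)
      have y: "kmap n w t \<in> {t \<in> ucube n. f t \<notin> V}" using t kmap_ucube[OF n0] by simp
      then have "kmap n w t \<in> U" using V by (auto simp: U_def)
      then have "gstar n (length w) (kmap n w t) \<subseteq> U"
        using gstar_antimono[of "lam (kmap n w t)" "length w"] star_lam D[OF y] w(2) by (meson le_trans subset_trans)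
      then have "kmap n w ` ucube n \<subseteq> U" using kmap_box_subset_star[OF n0 t(1), of w] by blast
      moreover have "(\<lambda>_. 0) \<in> cube_boundary n" using n0 by (auto simp: cube_boundary_eq ucube_def)
      ultimately have "f (kmap n w (\<lambda>_. 0)) \<noteq> x" using cube_boundary_subset by (auto simp: U_def)
      then show False using w(1) \<open>(\<lambda>_. 0) \<in> cube_boundary n\<close> by (simp add: Bd_def fw_def)
    qed
    obtain K where K: "\<forall>w\<in>set (bfs P K). D \<le> length w" using bfs_length_unbounded by blast
    have "S k \<subseteq> V" if "K \<le> k" for k
      using bfs_length_step[OF K that] inV Bd V(2) unfolding S_def Q_def by blast
    then have "{k. \<not> topspace X \<inter> S k \<subseteq> V} \<subseteq> {..<K}" by (metis (no_types, lifting) inf.coboundedI2 lessThan_iff linorder_not_le mem_Collect_eq subsetI)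
    then show ?thesis using finite_subset by blast
  qed
  have "e k \<in> relcube_maps n X x" for k
  proof (cases "Q k")
    case (Cons w ws)
    then have "Bd w" using Bd[of w k] by simp
    then have "fw w \<in> relcube_maps n X x" using fwc by (simp add: relcube_maps_iff Bd_def)
    then show ?thesis using Cons const_relcube[OF x(1)] by (simp add: e_def)
  qed (simp add: e_def const_relcube[OF x(1)])
  then have gs: "cube_htp n X x (g 0) (slab_concat x e)"
    using step small by (intro telescope_htp[OF n0 x(1)])
  have "cube_htp n X x (g 0) f"
  proof -
    have "f \<in> relcube_maps n X x" using f root by (simp add: relcube_maps_iff)
    moreover have "g 0 = concat_at 0 f (\<lambda>t. x)" by (simp add: g_def Q_def fw_def)
    ultimately show ?thesis using concat_at_unit_right n0 by simp
  qed
  then have "cube_htp n X x f (slab_concat x e)" by (rule cube_htp_trans[OF cube_htp_sym gs])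
  moreover have "e k = (\<lambda>t. x) \<or> (\<exists>w. P w \<and> e k = (\<lambda>t. f (kmap n w t)))" for k
    by (cases "Q k") (auto simp: e_def fw_def)
  ultimately show ?thesis by blast
qed

subsection \<open>Sequentially connected summands\<close>

text \<open>Says that the section recovers the class of \<open>f\<close> from its image under
  \<open>canonical_phi\<close>.\<close>

lemma htp_inf_concat_retracts:
  assumes base: "\<And>j. a j \<in> topspace (A j)" and haus: "\<And>j. Hausdorff_space (A j)" and n: "2 \<le> n"
    and conn: "\<And>j. seq_connected (n - 1) (A j) (a j)"
    and f: "f \<in> relcube_maps n (shrinking_wedge A a) None"
  shows "cube_htp n (shrinking_wedge A a) None f (inf_concat a (\<lambda>j. wedge_retract a j \<circ> f))"
proof -
  let ?Y = "shrinking_wedge A a"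
  have n0: "0 < n" and n1: "1 < n" using n by auto
  have fc: "continuous_map (top_of_set (ucube n)) ?Y f" "\<And>t. t \<in> cube_boundary n \<Longrightarrow> f t = None"
    using f by (auto simp: relcube_maps_iff)
  have fin: "f t \<in> wedge_carrier A a" if "t \<in> ucube n" for t
    using continuous_map_image_subset_topspace[OF fc(1)] that by auto
  have rf: "continuous_map (top_of_set (ucube n)) (A j) (\<lambda>t. wedge_retract a j (f t))" for j
    using continuous_map_compose[OF fc(1) continuous_map_wedge_retract[where A=A, OF base]] by (simp add: o_def)
  \<comment> \<open>Closedness of the base points makes the sets \<open>U j\<close> open and the
    wedge point closed.\<close>
  have cla: "closedin (A j) {a j}" for j using haus base by (simp add: closedin_Hausdorff_singleton)
  define U where "U j = {t \<in> ucube n. wedge_retract a j (f t) \<noteq> a j}" for j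
  have "openin (top_of_set (ucube n)) (U j)" for j
  proof -
    have "openin (A j) (topspace (A j) - {a j})" using cla[of j] by (simp add: closedin_def)
    then have "openin (top_of_set (ucube n)) {t \<in> topspace (top_of_set (ucube n)). wedge_retract a j (f t) \<in> topspace (A j) - {a j}}"
      using rf[of j] unfolding continuous_map_def by blast
    also have "{t \<in> topspace (top_of_set (ucube n)). wedge_retract a j (f t) \<in> topspace (A j) - {a j}} = U j"
      using wedge_retract_in[where A=A, OF base fin] by (auto simp: U_def)
    finally show ?thesis .
  qed
  then have cells: "cube_cells n (U j)" for j by unfold_locales
  have Uone: "i = j" if "t \<in> U i" "t \<in> U j" for t i j
    using that wedge_retract_inj_on[OF fin] by (auto simp: U_def)
  have ext: "seq_ext k (A j) (a j)" if "k < n" for k j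
    using seq_connected_ext[OF conn base] that by simp
  have "\<forall>j. \<exists>H. continuous_map (top_of_set ({0..1::real} \<times> ucube n)) (A j) H \<and> (\<forall>x\<in>ucube n. H (0, x) = wedge_retract a j (f x)) \<and>
     (\<forall>t\<in>{0..1}. \<forall>x\<in>ucube n - U j. H (t, x) = a j) \<and> (\<forall>x\<in>cube_cells.skel n (U j) n. H (1, x) = a j)"
  proof
    fix j
    interpret cube_cells n "U j" by (rule cells)
    show "\<exists>H. continuous_map (top_of_set ({0..1::real} \<times> ucube n)) (A j) H \<and> (\<forall>x\<in>ucube n. H (0, x) = wedge_retract a j (f x)) \<and>
     (\<forall>t\<in>{0..1}. \<forall>x\<in>ucube n - U j. H (t, x) = a j) \<and> (\<forall>x\<in>skel n. H (1, x) = a j)"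
      using cell_homotopy[OF rf _ base ext n0] unfolding Out_def by (auto simp: U_def)
  qed
  then obtain H where H: "\<And>j. continuous_map (top_of_set ({0..1::real} \<times> ucube n)) (A j) (H j)"
     "\<And>j x. x\<in>ucube n \<Longrightarrow> H j (0, x) = wedge_retract a j (f x)"
     "\<And>j t x. t\<in>{0..1} \<Longrightarrow> x\<in>ucube n - U j \<Longrightarrow> H j (t, x) = a j"
     "\<And>j x. x\<in>cube_cells.skel n (U j) n \<Longrightarrow> H j (1, x) = a j"
    by metis
  \<comment> \<open>Each \<open>H j\<close> stays at \<open>a j\<close> outside \<open>U j\<close>,
    and the sets \<open>U j\<close> are disjoint; so the homotopies of all summands combine to one
    in the wedge.\<close>
  have one: "i = j" if "p \<in> {0..1} \<times> ucube n" "H i p \<noteq> a i" "H j p \<noteq> a j" for p i j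
  proof -
    have "snd p \<in> U k" if "H k p \<noteq> a k" for k
    proof (rule ccontr)
      assume "snd p \<notin> U k"
      then have "H k (fst p, snd p) = a k" using \<open>p \<in> {0..1} \<times> ucube n\<close> by (intro H(3)) auto
      then show False using that by simp
    qed
    then show ?thesis using that Uone by blast
  qed
  define f' where "f' t = wedge_point a (\<lambda>j. H j (1, t))" for t
  have ff': "cube_htp n ?Y None f f'"
  proof (rule cube_htpI[where h="\<lambda>p. wedge_point a (\<lambda>j. H j p)"])
    show "continuous_map (top_of_set ({0..1::real} \<times> ucube n)) ?Y (\<lambda>p. wedge_point a (\<lambda>j. H j p))"
      by (rule continuous_map_wedge_point[OF base]) (use one H(1) in auto)
    show "wedge_point a (\<lambda>j. H j (0, t)) = f t" if t: "t \<in> ucube n" for t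
    proof (rule wedge_eqI[where A=A and a=a])
      have o: "i = j" if "H i (0, t) \<noteq> a i" "H j (0, t) \<noteq> a j" for i j
        using one[of "(0,t)" i j] that t by simp
      show "wedge_point a (\<lambda>j. H j (0, t)) \<in> wedge_carrier A a"
        using o wedge_retract_in[where A=A, OF base fin[OF t]] H(2)[OF t] by (intro wedge_point_in) auto
      show "wedge_retract a j (wedge_point a (\<lambda>j. H j (0, t))) = wedge_retract a j (f t)" for j
        using o H(2)[OF t] by (subst wedge_retract_point) auto
    qed (rule fin[OF t])
    show "wedge_point a (\<lambda>j. H j (s, t)) = None" if "0 \<le> s" "s \<le> 1" "t \<in> cube_boundary n" for s t
    proof (rule wedge_point_base)
      have "t \<in> ucube n - U j" for j using that(3) fc(2) cube_boundary_subset[of n] by (auto simp: U_def)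
      then show "H j (s, t) = a j" for j using that H(3) by simp
    qed
  qed (simp add: f'_def)
  have f': "f' \<in> relcube_maps n ?Y None" by (rule cube_htp_imp_relcube(2)[OF ff'])
  have f'N: "f' t = None" if "\<And>j. H j (1, t) = a j" for t
    unfolding f'_def using that by (rule wedge_point_base)
  define P where "P w \<longleftrightarrow> (\<exists>j. kmap n w ` ucube n \<subseteq> U j)" for w
  have clN: "closedin ?Y {None}"
  proof -
    have "{None} = (\<Inter>j. {y \<in> topspace ?Y. wedge_retract a j y \<in> {a j}})"
      by (auto intro: wedge_eqI[where A=A and a=a])
    moreover have "closedin ?Y {y \<in> topspace ?Y. wedge_retract a j y \<in> {a j}}" for j
      by (rule closedin_continuous_map_preimage[OF continuous_map_wedge_retract[where A=A, OF base] cla])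
    ultimately show ?thesis by (metis (no_types, lifting) UNIV_not_empty closedin_INT)
  qed
  \<comment> \<open>A box contained in no \<open>U j\<close> satisfies the hypothesis of
    \<open>kmap_boundary_skel\<close> for every \<open>j\<close>, so all coordinates of
    \<open>f'\<close> are trivial on the boundaries of its halves.\<close>
  have split: "f' (kmap n (b # w) t) = None" if "\<not> P w" "t \<in> cube_boundary n" for w b t
  proof (rule f'N)
    fix j
    have "kmap n (b # w) t \<in> cube_cells.skel n (U j) n \<union> cube_cells.Out n (U j)"
      using that by (intro cube_cells.kmap_boundary_skel[OF cells n0]) (auto simp: P_def)
    then show "H j (1, kmap n (b # w) t) = a j"
      using H(3)[of 1] H(4) by (auto simp: cube_cells.Out_def[OF cells])
  qed
  obtain e where e: "\<And>k. e k = (\<lambda>t. None) \<or> (\<exists>w. P w \<and> e k = (\<lambda>t. f' (kmap n w t)))"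
    and htp: "cube_htp n ?Y None f' (slab_concat None e)"
  proof -
    have "\<exists>e. (\<forall>k. e k = (\<lambda>t. None) \<or> (\<exists>w. P w \<and> e k = (\<lambda>t. f' (kmap n w t)))) \<and> cube_htp n ?Y None f' (slab_concat None e)"
      by (rule bfs_htp[OF n _ _ clN]) (use f' split in \<open>auto simp: relcube_maps_iff simp del: kmap.simps(2)\<close>)
    then show thesis using that by blast
  qed
  let ?h = "slab_concat None e"
  have fh: "cube_htp n ?Y None f ?h" by (rule cube_htp_trans[OF ff' htp])
  \<comment> \<open>A slice with \<open>r < 1\<close> lies in one slab, whose piece is constant or
    \<open>f'\<close> on a box inside one \<open>U j\<close>; there the other coordinates of
    \<open>f'\<close> are trivial.\<close>
  have "\<exists>j. \<forall>t\<in>ucube n. t 0 = r \<longrightarrow> (\<forall>i. i \<noteq> j \<longrightarrow> wedge_retract a i (?h t) = a i)" for r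
  proof -
    have "\<exists>j. \<forall>t\<in>ucube n. \<forall>i. i \<noteq> j \<longrightarrow> wedge_retract a i (e k t) = a i" for k
    proof (cases "e k = (\<lambda>t. None)")
      case False
      then obtain w j where w: "kmap n w ` ucube n \<subseteq> U j" "e k = (\<lambda>t. f' (kmap n w t))" using e[of k] False by (auto simp: P_def)
      have "wedge_retract a i (f' y) = a i" if "y \<in> U j" "i \<noteq> j" for y i
      proof -
        have yu: "y \<in> ucube n" using that by (simp add: U_def)
        have "wedge_retract a i (f' y) = H i (1, y)"
          unfolding f'_def using one[of "(1,y)"] yu by (intro wedge_retract_point) auto
        then show ?thesis using that H(3)[of 1 y i] Uone yu by auto
      qed
      then show ?thesis using w by (intro exI[of _ j]) auto
    qed auto
    then obtain j where j: "\<And>t i. t\<in>ucube n \<Longrightarrow> i \<noteq> j \<Longrightarrow> wedge_retract a i (e (slab_index r) t) = a i" by metis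
    have "wedge_retract a i (?h t) = a i" if "t \<in> ucube n" "t 0 = r" "i \<noteq> j" for t i
    proof (cases "t 0 < 1")
      case True
      let ?m = "slab_index (t 0)"
      have "0 \<le> t 0" using ucube_coord[OF that(1)] by simp
      then have m: "slab_left ?m \<le> t 0" "t 0 < slab_left (Suc ?m)" using slab_index_lower slab_index_upper[OF True] by auto
      have "2 ^ Suc ?m * (t 0 - slab_left (Suc ?m)) < 0" using m(2) by (simp add: mult_less_0_iff)
      then have "2 ^ Suc ?m * (t 0 - slab_left ?m) \<le> 1" unfolding slab_left_Suc by simp
      then have "t(0 := 2 ^ Suc ?m * (t 0 - slab_left ?m)) \<in> ucube n"
        using m that n0 by (intro ucube_upd) auto
      then show ?thesis using j that True by (simp add: slab_concat_def Let_def)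
    qed (simp add: slab_concat_def)
    then show ?thesis by blast
  qed
  then have hc: "cube_htp n ?Y None ?h (inf_concat a (\<lambda>j. wedge_retract a j \<circ> ?h))"
    by (intro slabwise_htp_inf_concat[OF base n1 cube_htp_imp_relcube(2)[OF fh]])
  \<comment> \<open>\<open>?h\<close> has the right shape but the statement is about
    \<open>f\<close>: their retracts are homotopic, and \<open>inf_concat\<close> respects
    this.\<close>
  have "cube_htp n ?Y None (inf_concat a (\<lambda>j. wedge_retract a j \<circ> ?h)) (inf_concat a (\<lambda>j. wedge_retract a j \<circ> f))"
  proof (rule inf_concat_htp[OF base n1])
    show "cube_htp n (A j) (a j) (wedge_retract a j \<circ> ?h) (wedge_retract a j \<circ> f)" for j
      by (intro cube_htp_compose[OF cube_htp_sym[OF fh]] continuous_map_wedge_retract base) simp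
  qed
  then show ?thesis by (rule cube_htp_trans[OF cube_htp_trans[OF fh hc]])
qed

lemma wedge_section_canonical_phi:
  assumes base: "\<And>j. a j \<in> topspace (A j)" and haus: "\<And>j. Hausdorff_space (A j)" and n: "2 \<le> n"
    and conn: "\<And>j. seq_connected (n - 1) (A j) (a j)"
    and c: "c \<in> carrier (homotopy_group n (shrinking_wedge A a) None)"
  shows "wedge_section n A a (canonical_phi n A a c) = c"
proof -
  obtain f where f: "f \<in> relcube_maps n (shrinking_wedge A a) None" "c = homotopy_class n (shrinking_wedge A a) None f"
    using c by (auto simp: carrier_homotopy_group)
  have "wedge_retract a j \<circ> f \<in> relcube_maps n (A j) (a j)" for j
    by (rule relcube_compose[OF f(1) continuous_map_wedge_retract[where A=A, OF base]]) simp
  then have "wedge_section n A a (canonical_phi n A a c) = homotopy_class n (shrinking_wedge A a) None (inf_concat a (\<lambda>j. wedge_retract a j \<circ> f))"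
    using n by (simp add: f(2) canonical_phi_class[where A=A, OF base f(1)] wedge_section_class[where A=A, OF base])
  also have "\<dots> = c"
    using homotopy_class_eq_iff[OF f(1)] htp_inf_concat_retracts[OF base haus n conn f(1)] f(2) by metis
  finally show ?thesis .
qed

theorem theorem4p25:
  fixes n :: nat and A :: "nat \<Rightarrow> 'a topology" and a :: "nat \<Rightarrow> 'a"
  assumes n2: "n \<ge> 2"
    and haus: "\<And>j. Hausdorff_space (A j)"
    and base: "\<And>j. a j \<in> topspace (A j)"
  shows "canonical_phi n A a \<in> hom (homotopy_group n (shrinking_wedge A a) None)
                                  (product_group UNIV (\<lambda>j. homotopy_group n (A j) (a j)))
       \<and> (\<exists>s \<in> hom (product_group UNIV (\<lambda>j. homotopy_group n (A j) (a j)))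
                    (homotopy_group n (shrinking_wedge A a) None).
            \<forall>y \<in> carrier (product_group UNIV (\<lambda>j. homotopy_group n (A j) (a j))).
              canonical_phi n A a (s y) = y)
       \<and> ((\<forall>j. seq_connected (n - 1) (A j) (a j)) \<longrightarrow>
            canonical_phi n A a \<in> iso (homotopy_group n (shrinking_wedge A a) None)
                                   (product_group UNIV (\<lambda>j. homotopy_group n (A j) (a j))))"
proof (intro conjI impI)
  let ?G = "homotopy_group n (shrinking_wedge A a) None" and ?P = "product_group UNIV (\<lambda>j. homotopy_group n (A j) (a j))"
  have n1: "1 < n" "0 < n" using n2 by auto
  show hom: "canonical_phi n A a \<in> hom ?G ?P" by (rule canonical_phi_hom[OF base n1(2)])
  have shom: "wedge_section n A a \<in> hom ?P ?G" by (rule wedge_section_hom[OF base n1(1)])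
  have sec: "canonical_phi n A a (wedge_section n A a y) = y" if "y \<in> carrier ?P" for y
    by (rule canonical_phi_section[OF base n1(1) that])
  show "\<exists>s\<in>hom ?P ?G. \<forall>y\<in>carrier ?P. canonical_phi n A a (s y) = y"
    using shom sec by blast
  assume "\<forall>j. seq_connected (n - 1) (A j) (a j)"
  then have "wedge_section n A a (canonical_phi n A a c) = c" if "c \<in> carrier ?G" for c
    by (intro wedge_section_canonical_phi base haus n2 that) auto
  then have "bij_betw (canonical_phi n A a) (carrier ?G) (carrier ?P)"
    using hom shom sec by (intro bij_betw_byWitness[where f'="wedge_section n A a"]) (auto simp: hom_def)
  then show "canonical_phi n A a \<in> iso ?G ?P" using hom by (simp add: iso_def)
qed

end
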